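(* Let $m\ge 0$ and let $(s_{1,1},\ldots,s_{1,m})=\mathcal N(\sigma_1,\ldots,\sigma_m)$ be a Nikishin system, $\Delta_1=\mathrm{Co}(\mathrm{supp}\,\sigma_1)$. Then the system of functions $(1,\widehat s_{1,1},\ldots,\widehat s_{1,m})$ forms an AT-system on any interval $\Delta\subset\mathbb R$ disjoint from $\Delta_1$. Moreover, for each $\mathbf n=(n_0,\ldots,n_m)\in\mathbb Z_+^{m+1}$ and arbitrary polynomials with real coefficients $p_0,\ldots,p_m$, not all identically zero, with $\deg p_k\le n_k-1$, $k=0,\ldots,m$, the linear form $$p_0+\sum_{k=1}^m p_k\,\widehat s_{1,k}$$ has at most $|\mathbf n|-1$ zeros (counting multiplicities) in $\mathbb C\setminus\Delta_1$.
   Context: For a bounded interval $\Delta\subset\mathbb R$, $\mathcal M(\Delta)$ is the class of finite Borel measures $s$ of constant sign (positive or negative) on $\mathbb R$ whose support $\mathrm{supp}\,s$ is compact and infinite and such that $\Delta=\mathrm{Co}(\mathrm{supp}\,s)$ is the smallest interval containing $\mathrm{supp}\,s$ ($\mathrm{Co}$ = convex hull). The Cauchy transform is $\widehat s(z)=\int\frac{ds(x)}{z-x}$. If $\Delta_\alpha\cap\Delta_\beta=\emptyset$, $\sigma_\alpha\in\mathcal M(\Delta_\alpha)$, $\sigma_\beta\in\mathcal M(\Delta_\beta)$, then $\langle\sigma_\alpha,\sigma_\beta\rangle$ is the measure $d\langle\sigma_\alpha,\sigma_\beta\rangle(x)=\widehat\sigma_\beta(x)\,d\sigma_\alpha(x)$.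 Nikishin system: given $\sigma_j\in\mathcal M(\Delta_j)$, $j=1,\ldots,m$, with $\Delta_j\cap\Delta_{j+1}=\emptyset$ for consecutive $j$, put $s_{j,j}=\sigma_j$ and $s_{j,k}=\langle\sigma_j,\sigma_{j+1},\ldots,\sigma_k\rangle=\langle\sigma_j,\langle\sigma_{j+1},\ldots,\sigma_k\rangle\rangle$ for $j<k$. Then $\mathcal N(\sigma_1,\ldots,\sigma_m)=(s_{1,1},\ldots,s_{1,m})$ is the Nikishin system generated by $(\sigma_1,\ldots,\sigma_m)$. (For $m=0$ it is empty, and $\Delta_1$ is read as $\emptyset$.) AT-system: real continuous functions $u_0,\ldots,u_m$ on an interval $\Delta$ form an AT-system on $\Delta$ for $\mathbf n\in\mathbb Z_+^{m+1}$ if for any choice of real polynomials $p_0,\ldots,p_m$, not all identically zero, with $\deg p_k\le n_k-1$, the function $\sum_{k=0}^m p_k(x)u_k(x)$ has at most $|\mathbf n|-1$ zeros on $\Delta$. They form an AT-system on $\Delta$ if this holds for all $\mathbf n\in\mathbb Z_+^{m+1}$. Here $|\mathbf n|=n_0+\cdots+n_m$, $\mathbb Z_+=\{0,1,2,\ldots\}$, and $\deg p\le -1$ means $p\equiv 0$. *)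

theory Defs
  imports "HOL-Complex_Analysis.Complex_Analysis"
begin

text \<open>
  A measure of constant sign on the real line: \<open>Pos \<mu>\<close> stands for \<open>\<mu>\<close> and \<open>Neg \<mu>\<close> for
  \<open>-\<mu>\<close>, where \<open>\<mu>\<close> is an ordinary (nonnegative) measure.
\<close>
datatype csmeasure = Pos (total_variation: "real measure") | Neg (total_variation: "real measure")

fun csintegral ::
  "csmeasure \<Rightarrow> (real \<Rightarrow> 'a) \<Rightarrow> 'a::{banach, second_countable_topology}" where
  "csintegral (Pos \<mu>) f = (LINT x|\<mu>. f x)"
| "csintegral (Neg \<mu>) f = - (LINT x|\<mu>. f x)"

definition csupport :: "csmeasure \<Rightarrow> real set" where
  "csupport s = {x. \<forall>U. open U \<longrightarrow> x \<in> U \<longrightarrow> emeasure (total_variation s) U > 0}"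

definition Co_supp :: "csmeasure \<Rightarrow> real set" where
  "Co_supp s = convex hull (csupport s)"

text \<open>The class \<open>\<M>(\<Delta>)\<close>.\<close>
definition M_class :: "real set \<Rightarrow> csmeasure set" where
  "M_class \<Delta> = {s. sets (total_variation s) = sets borel \<and> finite_measure (total_variation s)
      \<and> compact (csupport s) \<and> infinite (csupport s) \<and> Co_supp s = \<Delta>}"

text \<open>Polymorphic, so that it covers both real and complex arguments.\<close>
definition cauchy_transform ::
  "csmeasure \<Rightarrow> 'a \<Rightarrow> 'a::{real_normed_field, banach, second_countable_topology}" where
  "cauchy_transform s z = csintegral s (\<lambda>x. 1 / (z - of_real x))"

text \<open>
  The measure \<open>h ds\<close>. It is meaningful only for \<open>h\<close> of constant sign almost everywhere
  with respect to \<open>s\<close>; see the lemma below.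
\<close>
fun csdensity :: "csmeasure \<Rightarrow> (real \<Rightarrow> real) \<Rightarrow> csmeasure" where
  "csdensity (Pos \<mu>) h = (if AE x in \<mu>. 0 \<le> h x
     then Pos (density \<mu> (\<lambda>x. ennreal (h x))) else Neg (density \<mu> (\<lambda>x. ennreal (- h x))))"
| "csdensity (Neg \<mu>) h = (if AE x in \<mu>. 0 \<le> h x
     then Neg (density \<mu> (\<lambda>x. ennreal (h x))) else Pos (density \<mu> (\<lambda>x. ennreal (- h x))))"

lemma csintegral_csdensity:
  fixes f :: "real \<Rightarrow> 'a::{banach, second_countable_topology}"
  assumes "h \<in> borel_measurable (total_variation s)" "f \<in> borel_measurable (total_variation s)"
    and "(AE x in total_variation s. 0 \<le> h x) \<or> (AE x in total_variation s. h x \<le> 0)"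
  shows "csintegral (csdensity s h) f = csintegral s (\<lambda>x. h x *\<^sub>R f x)"
proof -
  have neg: "(LINT x|density \<mu> (\<lambda>x. ennreal (- h x)). f x) = - (LINT x|\<mu>. h x *\<^sub>R f x)"
    if "h \<in> borel_measurable \<mu>" "f \<in> borel_measurable \<mu>" "AE x in \<mu>. h x \<le> 0" for \<mu>
  proof -
    have "AE x in \<mu>. 0 \<le> - h x" using that(3) by eventually_elim simp
    with that(1,2) show ?thesis by (subst integral_density) auto
  qed
  show ?thesis
  proof (cases s)
    case (Pos \<mu>)
    show ?thesis using assms unfolding Pos csmeasure.sel
      by (cases "AE x in \<mu>. 0 \<le> h x") (simp_all add: integral_density neg)
  next
    case (Neg \<mu>)
    show ?thesis using assms unfolding Neg csmeasure.sel
      by (cases "AE x in \<mu>. 0 \<le> h x") (simp_all add: integral_density neg)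
  qed
qed

text \<open>
  \<open>\<langle>\<sigma>\<^sub>\<alpha>, \<sigma>\<^sub>\<beta>\<rangle>\<close>. When the intervals spanned by the two supports are disjoint,
  the Cauchy transform of \<open>\<sigma>\<^sub>\<beta>\<close> has constant sign on the support of \<open>\<sigma>\<^sub>\<alpha>\<close>.
\<close>
definition csprod :: "csmeasure \<Rightarrow> csmeasure \<Rightarrow> csmeasure" where
  "csprod \<sigma>\<^sub>\<alpha> \<sigma>\<^sub>\<beta> = csdensity \<sigma>\<^sub>\<alpha> (\<lambda>x. cauchy_transform \<sigma>\<^sub>\<beta> x)"

definition nikishin_generators :: "nat \<Rightarrow> (nat \<Rightarrow> csmeasure) \<Rightarrow> bool" where
  "nikishin_generators m \<sigma> \<longleftrightarrow>
     (\<forall>j\<in>{1..m}. \<sigma> j \<in> M_class (Co_supp (\<sigma> j))) \<and>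
     (\<forall>j. 1 \<le> j \<and> j < m \<longrightarrow> Co_supp (\<sigma> j) \<inter> Co_supp (\<sigma> (j + 1)) = {})"

text \<open>The measure \<open>s\<^sub>j\<^sub>,\<^sub>k\<close>; only the values for \<open>j \<le> k\<close> matter.\<close>
function nikishin :: "(nat \<Rightarrow> csmeasure) \<Rightarrow> nat \<Rightarrow> nat \<Rightarrow> csmeasure" where
  "nikishin \<sigma> j k = (if j < k then csprod (\<sigma> j) (nikishin \<sigma> (j + 1) k) else \<sigma> j)"
  by auto
termination by (relation "Wellfounded.measure (\<lambda>(\<sigma>, j, k). k - j)") auto

declare nikishin.simps [simp del]

text \<open>The interval \<open>\<Delta>\<^sub>1\<close>, read as empty for the empty system.\<close>
definition Delta1 :: "nat \<Rightarrow> (nat \<Rightarrow> csmeasure) \<Rightarrow> real set" where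
  "Delta1 m \<sigma> = (if m = 0 then {} else Co_supp (\<sigma> 1))"

text \<open>
  \<open>deg p\<^sub>k \<le> n\<^sub>k - 1\<close> for all \<open>k \<le> m\<close>, where \<open>deg p \<le> -1\<close> means \<open>p = 0\<close>
  (the library has \<open>degree 0 = 0\<close>), and not all \<open>p\<^sub>k\<close> zero.
\<close>
definition admissible_polys :: "nat \<Rightarrow> (nat \<Rightarrow> nat) \<Rightarrow> (nat \<Rightarrow> real poly) \<Rightarrow> bool" where
  "admissible_polys m n p \<longleftrightarrow>
     (\<forall>k\<le>m. p k = 0 \<or> degree (p k) < n k) \<and> (\<exists>k\<le>m. p k \<noteq> 0)"

definition AT_system_for ::
  "nat \<Rightarrow> (nat \<Rightarrow> real \<Rightarrow> real) \<Rightarrow> real set \<Rightarrow> (nat \<Rightarrow> nat) \<Rightarrow> bool" where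
  "AT_system_for m u \<Delta> n \<longleftrightarrow>
     is_interval \<Delta> \<and> (\<forall>k\<le>m. continuous_on \<Delta> (u k)) \<and>
     (\<forall>p. admissible_polys m n p \<longrightarrow>
        (let Z = {x\<in>\<Delta>. (\<Sum>k\<le>m. poly (p k) x * u k x) = 0}
         in finite Z \<and> int (card Z) \<le> int (\<Sum>k\<le>m. n k) - 1))"

definition AT_system :: "nat \<Rightarrow> (nat \<Rightarrow> real \<Rightarrow> real) \<Rightarrow> real set \<Rightarrow> bool" where
  "AT_system m u \<Delta> \<longleftrightarrow> (\<forall>n. AT_system_for m u \<Delta> n)"

definition nikishin_form ::
  "nat \<Rightarrow> (nat \<Rightarrow> csmeasure) \<Rightarrow> (nat \<Rightarrow> real poly) \<Rightarrow> complex \<Rightarrow> complex" where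
  "nikishin_form m \<sigma> p z = poly (map_poly of_real (p 0)) z
     + (\<Sum>k=1..m. poly (map_poly of_real (p k)) z * cauchy_transform (nikishin \<sigma> 1 k) z)"

text \<open>
  \<open>f\<close>, holomorphic on the open set \<open>S\<close>, has at most \<open>N\<close> zeros in \<open>S\<close>, counting multiplicities.
  The finiteness clause also excludes \<open>f\<close> vanishing identically near a point,
  where \<open>zorder\<close> is unspecified.
\<close>
definition zeros_mult_le :: "(complex \<Rightarrow> complex) \<Rightarrow> complex set \<Rightarrow> int \<Rightarrow> bool" where
  "zeros_mult_le f S N \<longleftrightarrow>
     finite {z\<in>S. f z = 0} \<and> (\<Sum>z\<in>{z\<in>S. f z = 0}. zorder f z) \<le> N"

end

theory Submission
  imports Defs "HOL-Probability.Helly_Selection" "HOL-Real_Asymp.Real_Asymp"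
    "HOL-Computational_Algebra.Fundamental_Theorem_Algebra"
begin

text \<open>
  Let \<open>f k\<close> be the transforms of the system, with \<open>f 0 = 1\<close>, and let \<open>W\<close> be a real polynomial without roots on
  the interval \<open>\<Delta>\<^sub>1\<close> that divides the form \<open>\<Sum> p k * f k\<close> off this interval. All zeros, with multiplicities and in
  conjugate pairs, are roots of a maximal such \<open>W\<close> (\<open>zeros_from_divisor_bound\<close>). So the theorem says that
  the degree of \<open>W\<close> is less than the sum of the \<open>n k\<close>, and the statement about intervals follows because real zeros
  are among the complex ones.

  The classical argument reduces \<open>m\<close>: if \<open>n 0\<close> is maximal, divide the form by \<open>W\<close>, integrate around the cut and obtain
  orthogonality relations for the density on the first interval. This density is a form of the system generated
  by the remaining measures, which by induction has few zeros on the first interval; a polynomial with these zeros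
  contradicts the orthogonality. If another \<open>n j\<close> is maximal, the form is first divided by \<open>f j\<close>, and the difficulty is
  that the ratios \<open>f k / f j\<close> no longer come from an obvious Nikishin system.

  To have an induction in which every choice of \<open>j\<close> is equally good, the claim is proved for a larger family of
  functions: ratios \<open>R S k j\<close> of minors of an upper triangular matrix, in which the rows are the systems generated
  by the tails of the measures, and the columns are \<open>S\<close> together with \<open>k\<close> and with \<open>j\<close> respectively. For
  empty \<open>S\<close> and \<open>j = 0\<close> these are the \<open>f k\<close>. For fixed \<open>S\<close> and \<open>j\<close> the functions \<open>R S k j\<close> are affine functions plus Cauchy
  transforms of weights on one common interval, whose index is one more than that of the last row of the minors, and the ratios of
  these weights are the functions of the family with \<open>j\<close> moved into \<open>S\<close> (\<open>cut_rep\<close>). So the density mentioned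
  above is again a form in the family, with one column less, and \<open>degree_divisor_of_form_less\<close> is the induction.

  The family is built one row at a time (\<open>tower_step\<close>), by Gaussian elimination. Two formulas for Cauchy transforms on
  disjoint cuts describe how the cut moves to the next interval when a column is eliminated and back when a
  quotient is formed. Quotients need two facts. The denominators have no zeros off their cut; this is a sign argument or
  is reduced to one by exchanging two columns (\<open>row_rep_small_nonzero\<close>). And the reciprocal of a Cauchy transform of
  constant sign is, up to an affine function, again one on the same interval (\<open>reciprocal_of_cauchy_int\<close>); this
  is a Herglotz representation theorem for the complement of an interval, obtained from the disc by the
  Joukowski map and Helly selection (\<open>herglotz_interval\<close>).
\<close>

section \<open>Cauchy transforms on a compact set\<close>

text \<open>
  What positivity arguments need is that the part of \<open>\<mu>\<close> on \<open>I\<close> is not carried by finitely many points: then a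
  nonnegative continuous function with finitely many zeros has a positive integral. The condition does not
  mention supports, so that it can also be verified for measures obtained as weak limits.
\<close>
definition heavy_on :: "real set \<Rightarrow> real measure \<Rightarrow> bool" where
  "heavy_on I \<mu> \<longleftrightarrow> sets \<mu> = sets borel \<and> finite_measure \<mu> \<and>
     (\<forall>X. finite X \<longrightarrow> emeasure \<mu> (I - X) \<noteq> 0)"

text \<open>
  The Cauchy transform of the signed measure \<open>d d\<mu>\<close> restricted to \<open>I\<close>. Keeping the weight \<open>d\<close> apart from the positive
  measure \<open>\<mu>\<close> lets several transforms share one measure and be compared through the ratios of their weights.
\<close>
definition cauchy_int :: "real measure \<Rightarrow> real set \<Rightarrow> (real \<Rightarrow> real) \<Rightarrow> complex \<Rightarrow> complex" where
  "cauchy_int \<mu> I d z = (LINT x:I|\<mu>. of_real (d x) / (z - of_real x))"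

abbreviation cset :: "real set \<Rightarrow> complex set" where "cset I \<equiv> complex_of_real ` I"

lemma compact_continuous_norm_bound:
  fixes f :: "'a::topological_space \<Rightarrow> 'b::real_normed_vector"
  assumes "compact I" "continuous_on I f"
  obtains B where "\<And>x. x \<in> I \<Longrightarrow> norm (f x) \<le> B"
  using compact_imp_bounded[OF compact_continuous_image[OF assms(2,1)]] that
  unfolding bounded_iff by auto

lemma set_integrable_continuous_compact:
  fixes f :: "real \<Rightarrow> 'b::{banach, second_countable_topology}"
  assumes "sets \<mu> = sets borel" "finite_measure \<mu>" "compact I" "continuous_on I f"
  shows "set_integrable \<mu> I f"
proof -
  interpret finite_measure \<mu> by fact
  obtain B where B: "\<And>x. x \<in> I \<Longrightarrow> norm (f x) \<le> B"
    using compact_continuous_norm_bound[OF assms(3,4)] by blast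
  have meas: "(\<lambda>x. indicator I x *\<^sub>R f x) \<in> borel_measurable \<mu>"
    using borel_measurable_continuous_on_indicator[of I f] assms
    by (simp add: borel_closed compact_imp_closed cong: measurable_cong_sets)
  show ?thesis unfolding set_integrable_def
    by (rule integrable_const_bound[where B = "max B 0", OF _ meas])
      (auto simp: indicator_def intro!: AE_I2 dest!: B)
qed

lemma set_fubini_continuous:
  fixes K :: "real \<Rightarrow> real \<Rightarrow> complex"
  assumes "sets \<mu> = sets borel" "finite_measure \<mu>" "compact I"
      and "sets \<nu> = sets borel" "finite_measure \<nu>" "compact J"
      and cont: "continuous_on (I \<times> J) (\<lambda>p. K (fst p) (snd p))"
  shows "(LINT x:I|\<mu>. LINT y:J|\<nu>. K x y) = (LINT y:J|\<nu>. LINT x:I|\<mu>. K x y)"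
proof -
  interpret m: finite_measure \<mu> by fact
  interpret n: finite_measure \<nu> by fact
  interpret p: pair_sigma_finite \<mu> \<nu> ..
  interpret pf: finite_measure "\<mu> \<Otimes>\<^sub>M \<nu>"
    using finite_measure_pair_measure[OF assms(5,2)] .
  have seq: "sets (\<mu> \<Otimes>\<^sub>M \<nu>) = sets (borel :: (real \<times> real) measure)"
    using sets_pair_measure_cong[OF assms(1,4)] unfolding borel_prod .
  have "compact (I \<times> J)" using assms by (simp add: compact_Times)
  then obtain B where "\<And>p. p \<in> I \<times> J \<Longrightarrow> norm (K (fst p) (snd p)) \<le> B"
    using compact_continuous_norm_bound[OF _ cont] by blast
  then have B: "\<And>x y. x \<in> I \<Longrightarrow> y \<in> J \<Longrightarrow> norm (K x y) \<le> B" by force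
  let ?g = "\<lambda>p. indicator (I \<times> J) p *\<^sub>R K (fst p) (snd p)"
  have meas: "?g \<in> borel_measurable (\<mu> \<Otimes>\<^sub>M \<nu>)"
    using borel_measurable_continuous_on_indicator[OF _ cont] \<open>compact (I \<times> J)\<close> seq
    by (simp add: borel_closed compact_imp_closed cong: measurable_cong_sets)
  have int: "integrable (\<mu> \<Otimes>\<^sub>M \<nu>) ?g"
    by (rule pf.integrable_const_bound[where B = "max B 0", OF _ meas])
      (auto simp: indicator_def le_max_iff_disj B intro!: AE_I2)
  have "(LINT x|\<mu>. LINT y|\<nu>. indicator I x *\<^sub>R (indicator J y *\<^sub>R K x y))
      = (LINT y|\<nu>. LINT x|\<mu>. indicator I x *\<^sub>R (indicator J y *\<^sub>R K x y))"
  proof (rule p.Fubini_integral[symmetric])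
    have "(\<lambda>(x, y). indicator I x *\<^sub>R (indicator J y *\<^sub>R K x y)) = ?g"
      by (auto simp: fun_eq_iff indicator_def)
    then show "integrable (\<mu> \<Otimes>\<^sub>M \<nu>) (\<lambda>(x, y). indicator I x *\<^sub>R (indicator J y *\<^sub>R K x y))"
      using int by (simp only:)
  qed
  moreover have "(LINT x|\<mu>. indicator I x *\<^sub>R (indicator J y *\<^sub>R K x y)) =
     indicator J y *\<^sub>R (LINT x|\<mu>. indicator I x *\<^sub>R K x y)" for y
    by (subst scaleR_left_commute) (rule integral_scaleR_right)
  ultimately show ?thesis unfolding set_lebesgue_integral_def by (simp del: scaleR_scaleR)
qed

lemma cset_closed: "compact I \<Longrightarrow> closed (cset I)"
  by (simp add: compact_imp_closed compact_continuous_image continuous_on_of_real)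

lemma continuous_on_cauchy_kernel:
  assumes "continuous_on I d" "z \<notin> cset I"
  shows "continuous_on I (\<lambda>x. complex_of_real (d x) / (z - of_real x))"
  using assms by (auto intro!: continuous_intros)

lemma cauchy_int_integrable:
  assumes "sets \<mu> = sets borel" "finite_measure \<mu>" "compact I" "continuous_on I d" "z \<notin> cset I"
  shows "set_integrable \<mu> I (\<lambda>x. complex_of_real (d x) / (z - of_real x))"
  using assms by (intro set_integrable_continuous_compact continuous_on_cauchy_kernel)

lemma norm_set_integral_le:
  fixes f :: "real \<Rightarrow> complex"
  assumes "sets \<mu> = sets borel" "finite_measure \<mu>" "compact I" "continuous_on I f"
    and "\<And>x. x \<in> I \<Longrightarrow> norm (f x) \<le> B"
  shows "norm (LINT x:I|\<mu>. f x) \<le> B * measure \<mu> I"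
proof -
  interpret finite_measure \<mu> by fact
  have [measurable]: "I \<in> sets \<mu>" using assms by (simp add: borel_closed compact_imp_closed)
  have "norm (LINT x:I|\<mu>. f x) \<le> (LINT x:I|\<mu>. norm (f x))"
    using set_integrable_continuous_compact[OF assms(1-4)] by (rule set_integral_norm_bound)
  also have "\<dots> \<le> (LINT x:I|\<mu>. B)"
    using assms by (intro set_integral_mono set_integrable_continuous_compact)
      (auto intro!: continuous_intros)
  also have "\<dots> = B * measure \<mu> I"
    by (simp add: set_integral_const)
  finally show ?thesis .
qed

lemma cauchy_int_diff:
  assumes \<mu>: "sets \<mu> = sets borel" "finite_measure \<mu>" "compact I" "continuous_on I d"
    and "z \<notin> cset I" "w \<notin> cset I"
  shows "cauchy_int \<mu> I d z - cauchy_int \<mu> I d w =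
    - (z - w) * (LINT x:I|\<mu>. of_real (d x) / ((z - of_real x) * (w - of_real x)))"
proof -
  have "cauchy_int \<mu> I d z - cauchy_int \<mu> I d w =
     (LINT x:I|\<mu>. of_real (d x) / (z - of_real x) - of_real (d x) / (w - of_real x))"
    unfolding cauchy_int_def using assms by (intro set_integral_diff(2)[symmetric] cauchy_int_integrable)
  also have "\<dots> = (LINT x:I|\<mu>. - (z - w) * (of_real (d x) / ((z - of_real x) * (w - of_real x))))"
    using assms by (intro set_lebesgue_integral_cong) (auto simp: borel_closed compact_imp_closed divide_simps, auto simp: algebra_simps)
  also have "\<dots> = - (z - w) * (LINT x:I|\<mu>. of_real (d x) / ((z - of_real x) * (w - of_real x)))"
    by (rule set_integral_mult_right)
  finally show ?thesis .
qed

lemma cauchy_int_has_field_derivative: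
  assumes \<mu>: "sets \<mu> = sets borel" "finite_measure \<mu>" "compact I" "continuous_on I d"
    and w: "w \<notin> cset I"
  shows "(cauchy_int \<mu> I d has_field_derivative
     - (LINT x:I|\<mu>. of_real (d x) / (w - of_real x)^2)) (at w)"
proof -
  let ?G = "\<lambda>z. - (LINT x:I|\<mu>. complex_of_real (d x) / ((z - of_real x) * (w - of_real x)))"
  have "open (- cset I)" using cset_closed[OF assms(3)] by (rule open_Compl)
  then obtain e where "e > 0" "ball w e \<subseteq> - cset I"
    using w unfolding open_contains_ball by blast
  then have e: "e > 0" "ball w e \<inter> cset I = {}" by auto
  have ex: "norm (w - of_real x) \<ge> e" if "x \<in> I" for x
    using e that by (force simp: dist_norm disjoint_iff)
  obtain B where B: "\<And>x. x \<in> I \<Longrightarrow> \<bar>d x\<bar> \<le> B"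
    using compact_continuous_norm_bound[OF assms(3,4)] by auto
  have lim: "?G \<midarrow>w\<rightarrow> ?G w"
  proof (rule Lim_null_comparison[of _ _ _, THEN Lim_null[THEN iffD2]])
    show "((\<lambda>z. norm (z - w) * (2 / (e*e*e) * \<bar>B\<bar> * measure \<mu> I)) \<longlongrightarrow> 0) (at w)"
      by (rule tendsto_mult_left_zero[OF tendsto_norm_zero[OF LIM_zero[OF tendsto_ident_at]]])
    show "\<forall>\<^sub>F z in at w. norm (?G z - ?G w) \<le> norm (z - w) * (2 / (e*e*e) * \<bar>B\<bar> * measure \<mu> I)"
      unfolding eventually_at
    proof (intro exI[of _ "e/2"] conjI ballI impI)
      fix z assume z: "z \<noteq> w \<and> dist z w < e / 2"
      have zx: "norm (z - of_real x) \<ge> e/2" if "x \<in> I" for x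
      proof -
        have "norm (w - of_real x) \<le> norm (w - z) + norm (z - of_real x)"
          using norm_triangle_ineq[of "w - z" "z - of_real x"] by simp
        then show ?thesis using ex[OF that] z by (simp add: dist_norm norm_minus_commute)
      qed
      have z0: "z \<notin> cset I"
      proof
        assume "z \<in> cset I"
        then obtain x where "x \<in> I" "z = of_real x" by auto
        with zx[of x] e(1) show False by simp
      qed
      have nz: "z - of_real x \<noteq> 0" "w - of_real x \<noteq> 0" if "x \<in> I" for x using z0 w that by auto
      have "?G z - ?G w = (LINT x:I|\<mu>. of_real (d x) / ((w - of_real x) * (w - of_real x)))
          - (LINT x:I|\<mu>. complex_of_real (d x) / ((z - of_real x) * (w - of_real x)))" by simp
      also have "\<dots> = (LINT x:I|\<mu>. of_real (d x) / ((w - of_real x) * (w - of_real x)) - complex_of_real (d x) / ((z - of_real x) * (w - of_real x)))"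
        using assms z0 by (intro set_integral_diff(2)[symmetric] set_integrable_continuous_compact continuous_intros) auto
      also have "norm \<dots> \<le> norm (z - w) * (2 / (e*e*e) * \<bar>B\<bar>) * measure \<mu> I"
      proof (rule norm_set_integral_le[OF assms(1-3)])
        show "continuous_on I (\<lambda>x. of_real (d x) / ((w - of_real x) * (w - of_real x)) - complex_of_real (d x) / ((z - of_real x) * (w - of_real x)))"
          using assms z0 by (intro continuous_intros) auto
        fix x assume x: "x \<in> I"
        have "complex_of_real (d x) / ((w - of_real x) * (w - of_real x)) - of_real (d x) / ((z - of_real x) * (w - of_real x)) =
          of_real (d x) * (z - w) / ((w - of_real x) * (w - of_real x) * (z - of_real x))"
          using nz[OF x] by (simp add: divide_simps) (simp add: algebra_simps)
        also have "norm \<dots> = \<bar>d x\<bar> * norm (z - w) / (norm (w - of_real x) * norm (w - of_real x) * norm (z - of_real x))"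
          by (simp add: norm_mult norm_divide)
        also have "\<dots> \<le> \<bar>B\<bar> * norm (z - w) / (e * e * (e/2))"
          using e ex[OF x] zx[OF x] B[OF x] by (intro frac_le mult_mono) auto
        also have "\<dots> = norm (z - w) * (2 / (e*e*e) * \<bar>B\<bar>)" by simp
        finally show "norm (complex_of_real (d x) / ((w - of_real x) * (w - of_real x)) - of_real (d x) / ((z - of_real x) * (w - of_real x)))
           \<le> norm (z - w) * (2 / (e*e*e) * \<bar>B\<bar>)" .
      qed
      finally show "norm (?G z - ?G w) \<le> norm (z - w) * (2 / (e*e*e) * \<bar>B\<bar> * measure \<mu> I)"
        by (simp add: mult.assoc)
    qed (use e in auto)
  qed
  have "((\<lambda>z. (cauchy_int \<mu> I d z - cauchy_int \<mu> I d w) / (z - w)) \<longlongrightarrow> ?G w) (at w)"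
  proof (rule Lim_transform_within[OF lim e(1)])
    fix z assume z: "0 < dist z w" "dist z w < e"
    then have "z \<notin> cset I" using e by (auto simp: disjoint_iff dist_commute)
    then show "?G z = (cauchy_int \<mu> I d z - cauchy_int \<mu> I d w) / (z - w)"
      using cauchy_int_diff[OF \<mu> _ w, of z] z by (simp add: divide_simps) (simp add: algebra_simps)
  qed
  then show ?thesis by (simp add: has_field_derivative_iff power2_eq_square)
qed

lemma cauchy_int_holomorphic:
  assumes "sets \<mu> = sets borel" "finite_measure \<mu>" "compact I" "continuous_on I d"
  shows "cauchy_int \<mu> I d holomorphic_on - cset I"
  using cauchy_int_has_field_derivative[OF assms] cset_closed[OF assms(3)]
  by (metis ComplD holomorphic_on_def field_differentiable_at_within field_differentiable_def)

lemma cauchy_int_cnj: "cauchy_int \<mu> I d (cnj z) = cnj (cauchy_int \<mu> I d z)"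
  unfolding cauchy_int_def set_lebesgue_integral_def
  by (subst Bochner_Integration.integral_cnj[symmetric]) (simp add: scaleR_conv_of_real)

lemma cauchy_int_of_real:
  "cauchy_int \<mu> I d (of_real x) = of_real (LINT t:I|\<mu>. d t / (x - t))"
proof -
  have "cauchy_int \<mu> I d (of_real x) = (LINT t|\<mu>. of_real (indicator I t *\<^sub>R (d t / (x - t))))"
    unfolding cauchy_int_def set_lebesgue_integral_def by (simp add: scaleR_conv_of_real)
  then show ?thesis unfolding set_lebesgue_integral_def by (simp only: integral_complex_of_real)
qed

lemma connected_const_sign:
  fixes g :: "real \<Rightarrow> real"
  assumes "connected I" "continuous_on I g" "\<And>x. x \<in> I \<Longrightarrow> g x \<noteq> 0"
  shows "(\<forall>x\<in>I. g x > 0) \<or> (\<forall>x\<in>I. g x < 0)"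
proof (rule ccontr)
  assume "\<not> ?thesis"
  then obtain x y where xy: "x \<in> I" "y \<in> I" "g x < 0" "g y > 0"
    using assms(3) by (metis linorder_neqE_linordered_idom)
  have "connected (g ` I)" using assms by (simp add: connected_continuous_image)
  then have "0 \<in> g ` I" using xy unfolding connected_iff_interval by (meson image_eqI less_imp_le)
  then show False using assms(3) by auto
qed

text \<open>
  If the integral vanished, the integrand would vanish almost everywhere on \<open>I\<close>, so its finitely many zeros would
  carry \<open>\<mu>\<close> on \<open>I\<close>.
\<close>
lemma heavy_on_integral_pos:
  fixes g :: "real \<Rightarrow> real"
  assumes h: "heavy_on I \<mu>" "compact I" "continuous_on I g" "\<And>x. x \<in> I \<Longrightarrow> g x \<ge> 0"
    and fin: "finite {x\<in>I. g x = 0}"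
  shows "(LINT x:I|\<mu>. g x) > 0"
proof -
  have m: "sets \<mu> = sets borel" "finite_measure \<mu>" using h(1) by (auto simp: heavy_on_def)
  interpret finite_measure \<mu> by fact
  have I: "I \<in> sets \<mu>" using h m by (simp add: borel_closed compact_imp_closed)
  have int: "set_integrable \<mu> I g" using m h by (intro set_integrable_continuous_compact)
  have "(LINT x:I|\<mu>. g x) \<ge> 0" unfolding set_lebesgue_integral_def
    by (intro integral_nonneg_AE AE_I2) (auto simp: indicator_def h)
  moreover have "(LINT x:I|\<mu>. g x) \<noteq> 0"
  proof
    assume "(LINT x:I|\<mu>. g x) = 0"
    then have "AE x in \<mu>. indicator I x *\<^sub>R g x = 0"
      using integral_nonneg_eq_0_iff_AE[of \<mu> "\<lambda>x. indicator I x *\<^sub>R g x"] int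
      unfolding set_lebesgue_integral_def set_integrable_def
      by (auto simp: indicator_def h)
    then have "AE x in \<mu>. x \<notin> I - {x\<in>I. g x = 0}"
      by eventually_elim (auto simp: indicator_def)
    moreover have "I - {x\<in>I. g x = 0} \<in> sets \<mu>"
      using I fin m by (auto intro!: sets.Diff simp: finite_imp_closed borel_closed)
    ultimately have "emeasure \<mu> (I - {x\<in>I. g x = 0}) = 0"
      using AE_iff_measurable[of "I - {x\<in>I. g x = 0}" \<mu> "\<lambda>x. x \<notin> I - {x\<in>I. g x = 0}"] 
        sets.sets_into_space[of _ \<mu>] by (auto simp: subset_eq)
    then show False using h(1) fin by (auto simp: heavy_on_def)
  qed
  ultimately show ?thesis by simp
qed

lemma set_integral_of_real_complex:
  "(LINT x:I|\<mu>. complex_of_real (f x)) = of_real (LINT x:I|\<mu>. f x)"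
proof -
  have "(\<lambda>x. indicat_real I x *\<^sub>R complex_of_real (f x)) = (\<lambda>x. complex_of_real (indicator I x *\<^sub>R f x))"
    by (auto simp: scaleR_conv_of_real)
  then show ?thesis unfolding set_lebesgue_integral_def by (simp only: integral_complex_of_real)
qed

lemma Im_set_integral:
  assumes "set_integrable \<mu> I f"
  shows "Im (LINT x:I|\<mu>. f x) = (LINT x:I|\<mu>. Im (f x))"
  using assms unfolding set_lebesgue_integral_def set_integrable_def
  by (subst Bochner_Integration.integral_Im[symmetric]) auto

lemma Im_cauchy_int:
  assumes "sets \<mu> = sets borel" "finite_measure \<mu>" "compact I" "continuous_on I d" "z \<notin> cset I"
  shows "Im (cauchy_int \<mu> I d z) = - Im z * (LINT x:I|\<mu>. d x / (norm (z - of_real x))\<^sup>2)"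
proof -
  have "Im (cauchy_int \<mu> I d z) = (LINT x:I|\<mu>. Im (of_real (d x) / (z - of_real x)))"
    unfolding cauchy_int_def using assms by (intro Im_set_integral cauchy_int_integrable)
  also have "\<dots> = (LINT x:I|\<mu>. - Im z * (d x / (norm (z - of_real x))\<^sup>2))"
  proof -
    have "Im (of_real (d x) / (z - of_real x)) = - Im z * (d x / (norm (z - of_real x))\<^sup>2)" for x
      unfolding cmod_power2 by (simp add: Im_divide)
    then show ?thesis by simp
  qed
  also have "\<dots> = - Im z * (LINT x:I|\<mu>. d x / (norm (z - of_real x))\<^sup>2)"
    by (rule set_integral_mult_right)
  finally show ?thesis .
qed

text \<open>
  At a real point off \<open>I\<close> the kernel \<open>1/(z - x)\<close> does not vanish on the connected set \<open>I\<close>, so it has constant sign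
  there, and so has \<open>d\<close>; at a nonreal point the imaginary part is an integral of \<open>d\<close> against a positive kernel.
\<close>
lemma cauchy_int_nonzero:
  assumes h: "heavy_on I \<mu>" "compact I" "connected I" "continuous_on I d" "\<And>x. x \<in> I \<Longrightarrow> d x \<noteq> 0"
    and z: "z \<notin> cset I"
  shows "cauchy_int \<mu> I d z \<noteq> 0"
proof -
  have m: "sets \<mu> = sets borel" "finite_measure \<mu>" using h(1) by (auto simp: heavy_on_def)
  have gen: "(LINT x:I|\<mu>. g x) \<noteq> 0" if g: "continuous_on I g" "\<And>x. x \<in> I \<Longrightarrow> g x \<noteq> 0" for g :: "real \<Rightarrow> real"
  proof -
    have "(\<forall>x\<in>I. 0 < g x) \<or> (\<forall>x\<in>I. g x < 0)" using connected_const_sign[OF h(3)] g by blast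
    then show ?thesis
  proof
    assume "\<forall>x\<in>I. 0 < g x"
    then have "0 < (LINT x:I|\<mu>. g x)"
      using g by (intro heavy_on_integral_pos h) (auto simp: less_imp_le cong: conj_cong)
    then show ?thesis by simp
  next
    assume "\<forall>x\<in>I. g x < 0"
    then have "0 < (LINT x:I|\<mu>. - g x)"
      using g by (intro heavy_on_integral_pos h continuous_intros) (auto simp: less_imp_le cong: conj_cong)
    then show ?thesis by (simp add: set_integral_uminus[OF set_integrable_continuous_compact] m h g)
  qed qed
  show ?thesis
  proof (cases "Im z = 0")
    case True
    then have zr: "z = of_real (Re z)" by (simp add: complex_eq_iff)
    with z have "Re z \<notin> I" by (metis image_eqI)
    then have "(LINT t:I|\<mu>. d t / (Re z - t)) \<noteq> 0"
      using h by (intro gen continuous_intros) auto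
    then show ?thesis by (subst zr) (simp add: cauchy_int_of_real)
  next
    case False
    have nz: "z \<noteq> of_real x" for x using False by auto
    have "(LINT x:I|\<mu>. d x / (norm (z - of_real x))\<^sup>2) \<noteq> 0"
      using h nz by (intro gen continuous_intros) auto
    then have "Im (cauchy_int \<mu> I d z) \<noteq> 0"
      using False by (simp add: Im_cauchy_int[OF m h(2,4) z])
    then show ?thesis by auto
  qed
qed

lemma set_integral_cong_on:
  assumes "\<And>x. x \<in> I \<Longrightarrow> f x = g x"
  shows "(LINT x:I|\<mu>. f x) = (LINT x:I|\<mu>. g x)"
  unfolding set_lebesgue_integral_def using assms
  by (intro Bochner_Integration.integral_cong) (auto simp: indicator_def)

lemma cauchy_int_cong:
  "(\<And>x. x \<in> I \<Longrightarrow> d x = d' x) \<Longrightarrow> cauchy_int \<mu> I d z = cauchy_int \<mu> I d' z"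
  unfolding cauchy_int_def by (rule set_integral_cong_on) simp

lemma cauchy_int_bound:
  assumes m: "sets \<mu> = sets borel" "finite_measure \<mu>" "compact I" "continuous_on I d"
  obtains C \<rho> where "\<rho> > 0" "\<And>z. norm z > \<rho> \<Longrightarrow> z \<notin> cset I \<and> norm (cauchy_int \<mu> I d z) \<le> C / norm z"
proof -
  obtain B where B: "\<And>x. x \<in> I \<Longrightarrow> \<bar>d x\<bar> \<le> B"
    using compact_continuous_norm_bound[OF m(3,4)] by auto
  obtain M where M: "\<And>x. x \<in> I \<Longrightarrow> \<bar>x\<bar> \<le> M"
    using compact_continuous_norm_bound[OF m(3), of "\<lambda>x. x"] by auto
  show ?thesis
  proof (rule that[of "2 * \<bar>M\<bar> + 1" "2 * \<bar>B\<bar> * measure \<mu> I"])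
    fix z :: complex assume z: "norm z > 2 * \<bar>M\<bar> + 1"
    have zx: "norm (z - of_real x) \<ge> norm z / 2" if "x \<in> I" for x
      using norm_triangle_ineq2[of z "of_real x"] M[OF that] z by simp
    have z0: "z \<notin> cset I"
    proof
      assume "z \<in> cset I"
      then obtain x where "x \<in> I" "z = of_real x" by auto
      with zx[of x] z show False by simp
    qed
    have "norm (cauchy_int \<mu> I d z) \<le> (\<bar>B\<bar> / (norm z / 2)) * measure \<mu> I"
      unfolding cauchy_int_def
    proof (rule norm_set_integral_le[OF m(1-3) continuous_on_cauchy_kernel[OF m(4) z0]])
      fix x assume x: "x \<in> I"
      show "norm (complex_of_real (d x) / (z - of_real x)) \<le> \<bar>B\<bar> / (norm z / 2)"
        unfolding norm_divide using zx[OF x] B[OF x] z by (intro frac_le) auto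
    qed
    then show "z \<notin> cset I \<and> norm (cauchy_int \<mu> I d z) \<le> 2 * \<bar>B\<bar> * measure \<mu> I / norm z"
      using z0 by (simp add: mult_ac)
  qed auto
qed

lemma cauchy_int_tendsto_0:
  assumes m: "sets \<mu> = sets borel" "finite_measure \<mu>" "compact I" "continuous_on I d"
  shows "(cauchy_int \<mu> I d \<longlongrightarrow> 0) at_infinity"
proof -
  obtain C \<rho> where C: "\<And>z. norm z > \<rho> \<Longrightarrow> norm (cauchy_int \<mu> I d z) \<le> C / norm z"
    using cauchy_int_bound[OF m] by metis
  show ?thesis
  proof (rule Lim_null_comparison)
    show "\<forall>\<^sub>F z in at_infinity. norm (cauchy_int \<mu> I d z) \<le> C / norm z"
      unfolding eventually_at_infinity using C by (intro exI[of _ "\<rho> + 1"]) auto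
    show "((\<lambda>z. C / norm (z::complex)) \<longlongrightarrow> 0) at_infinity"
      by (intro tendsto_divide_0[OF tendsto_const] filterlim_at_top_imp_at_infinity filterlim_norm_at_top)
  qed
qed

lemma cauchy_int_mult_z:
  assumes m: "sets \<mu> = sets borel" "finite_measure \<mu>" "compact I" "continuous_on I d" "z \<notin> cset I"
  shows "z * cauchy_int \<mu> I d z = of_real (LINT x:I|\<mu>. d x) + cauchy_int \<mu> I (\<lambda>x. x * d x) z"
proof -
  have nz: "z - of_real x \<noteq> 0" if "x \<in> I" for x using m(5) that by auto
  have "z * cauchy_int \<mu> I d z = (LINT x:I|\<mu>. z * (of_real (d x) / (z - of_real x)))"
    unfolding cauchy_int_def by (rule set_integral_mult_right[symmetric])
  also have "\<dots> = (LINT x:I|\<mu>. complex_of_real (d x) + of_real (x * d x) / (z - of_real x))"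
    using nz by (intro set_integral_cong_on) (simp add: divide_simps, simp add: algebra_simps)
  also have "\<dots> = (LINT x:I|\<mu>. complex_of_real (d x)) + (LINT x:I|\<mu>. of_real (x * d x) / (z - of_real x))"
    using m by (intro set_integral_add(2) set_integrable_continuous_compact continuous_intros) auto
  finally show ?thesis by (simp add: cauchy_int_def set_integral_of_real_complex)
qed

text \<open>
  The coefficient of \<open>1/z\<close> at infinity is the total mass; all later comparisons of orders at infinity use this.
\<close>
lemma cauchy_int_mult_z_tendsto:
  assumes m: "sets \<mu> = sets borel" "finite_measure \<mu>" "compact I" "continuous_on I d"
  shows "((\<lambda>z. z * cauchy_int \<mu> I d z) \<longlongrightarrow> of_real (LINT x:I|\<mu>. d x)) at_infinity"
proof -
  have "((\<lambda>z. of_real (LINT x:I|\<mu>. d x) + cauchy_int \<mu> I (\<lambda>x. x * d x) z) \<longlongrightarrow> of_real (LINT x:I|\<mu>. d x) + 0) at_infinity"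
    by (intro tendsto_intros cauchy_int_tendsto_0 m continuous_intros)
  moreover obtain C \<rho> where C: "\<And>z. norm z > \<rho> \<Longrightarrow> z \<notin> cset I"
    using cauchy_int_bound[OF m] by metis
  have "\<forall>\<^sub>F z in at_infinity. of_real (LINT x:I|\<mu>. d x) + cauchy_int \<mu> I (\<lambda>x. x * d x) z = z * cauchy_int \<mu> I d z"
    unfolding eventually_at_infinity using C cauchy_int_mult_z[OF m] by (intro exI[of _ "\<rho> + 1"]) auto
  ultimately show ?thesis by (simp add: tendsto_cong)
qed

section \<open>Herglotz representation off an interval\<close>
lemma Cauchy_formula_unit_circle:
  assumes "f holomorphic_on ball 0 R" "R > 1" "norm w < 1"
  shows "((\<lambda>t. f (cis (2*pi*t)) * cis (2*pi*t) / (cis (2*pi*t) - w)) has_integral f w) {0..1}"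
proof -
  have "f holomorphic_on cball 0 1" using assms by (auto intro: holomorphic_on_subset)
  then have "((\<lambda>u. f u / (u - w)) has_contour_integral (2 * of_real pi * \<i> * f w)) (circlepath 0 1)"
    using Cauchy_integral_circlepath_simple[of f 0 1 w] assms by simp
  then have "((\<lambda>t. f (circlepath 0 1 t) / (circlepath 0 1 t - w) * (2 * of_real pi * \<i> * exp (2 * of_real pi * \<i> * of_real t)))
       has_integral (2 * of_real pi * \<i> * f w)) {0..1}"
    unfolding has_contour_integral
    by (rule has_integral_eq[rotated]) (simp add: vector_derivative_circlepath)
  then have "((\<lambda>t. 1 / (2 * of_real pi * \<i>) * (f (circlepath 0 1 t) / (circlepath 0 1 t - w) * (2 * of_real pi * \<i> * exp (2 * of_real pi * \<i> * of_real t))))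
       has_integral 1 / (2 * of_real pi * \<i>) * (2 * of_real pi * \<i> * f w)) {0..1}"
    by (rule has_integral_mult_right)
  moreover have "circlepath 0 1 t = cis (2*pi*t)" "exp (2 * of_real pi * \<i> * of_real t) = cis (2*pi*t)" for t
    by (simp_all add: circlepath cis_conv_exp mult_ac)
  ultimately show ?thesis by (simp add: field_simps)
qed

lemma circle_mean_value:
  assumes "f holomorphic_on ball 0 R" "R > 1"
  shows "((\<lambda>t. f (cis (2*pi*t))) has_integral f 0) {0..1}"
  using Cauchy_formula_unit_circle[OF assms, of 0] by simp

lemma typically_real_kernel:
  fixes w \<zeta> :: complex
  assumes z: "norm \<zeta> = 1" and w: "norm w < 1"
  shows "(\<zeta> / (1 - w * \<zeta>) - cnj \<zeta> / (1 - w * cnj \<zeta>)) / (2 * \<i>) = of_real (Im \<zeta>) / (1 - 2 * w * of_real (Re \<zeta>) + w\<^sup>2)"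
    and "1 - 2 * w * of_real (Re \<zeta>) + w\<^sup>2 \<noteq> 0"
proof -
  have zz: "\<zeta> * cnj \<zeta> = 1" using z by (simp add: complex_norm_square[symmetric])
  have "norm (w * \<zeta>) < 1" "norm (w * cnj \<zeta>) < 1" using z w by (simp_all add: norm_mult)
  then have nz: "1 - w * \<zeta> \<noteq> 0" "1 - w * cnj \<zeta> \<noteq> 0"
    by (metis eq_iff_diff_eq_0 less_irrefl norm_one)+
  have s: "\<zeta> + cnj \<zeta> = 2 * of_real (Re \<zeta>)" by (simp add: complex_add_cnj)
  have d: "\<zeta> - cnj \<zeta> = 2 * \<i> * of_real (Im \<zeta>)" by (simp add: complex_diff_cnj)
  have p: "(1 - w * \<zeta>) * (1 - w * cnj \<zeta>) = 1 - 2 * w * of_real (Re \<zeta>) + w\<^sup>2"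
  proof -
    have "(1 - w * \<zeta>) * (1 - w * cnj \<zeta>) = 1 - w * (\<zeta> + cnj \<zeta>) + w^2 * (\<zeta> * cnj \<zeta>)"
      by (simp add: algebra_simps power2_eq_square)
    then show ?thesis by (simp add: zz s mult_ac)
  qed
  show "1 - 2 * w * of_real (Re \<zeta>) + w\<^sup>2 \<noteq> 0" using nz p by (metis mult_eq_0_iff)
  have "\<zeta> / (1 - w * \<zeta>) - cnj \<zeta> / (1 - w * cnj \<zeta>) = (\<zeta> - cnj \<zeta>) / ((1 - w * \<zeta>) * (1 - w * cnj \<zeta>))"
    using nz by (simp add: divide_simps) (simp add: algebra_simps)
  then show "(\<zeta> / (1 - w * \<zeta>) - cnj \<zeta> / (1 - w * cnj \<zeta>)) / (2 * \<i>) = of_real (Im \<zeta>) / (1 - 2 * w * of_real (Re \<zeta>) + w\<^sup>2)"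
    by (simp only: d p) (simp only: times_divide_eq_left[symmetric] divide_divide_eq_left, simp)
qed

text \<open>
  A Poisson-type formula for functions that are real on the real diameter. On the circle of radius \<open>\<rho>\<close> only the
  boundary values of \<open>Im G\<close> enter, weighted with \<open>sin\<close>. If \<open>Im G\<close> and \<open>Im w\<close> have the same sign, the density on the
  left is nonnegative, and this is where the positive measure of the Herglotz representation comes from.
\<close>
lemma typically_real_formula:
  fixes G :: "complex \<Rightarrow> complex" and w :: complex and \<rho> :: real
  assumes G: "G holomorphic_on ball 0 1" "G 0 = 0" and sym: "\<And>w. norm w < 1 \<Longrightarrow> G (cnj w) = cnj (G w)"
    and \<rho>: "0 < \<rho>" "\<rho> < 1" and w: "norm w < 1"
  defines "H \<equiv> (\<lambda>w::complex. if w = 0 then deriv G 0 else G w / w)"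
  shows "((\<lambda>t. 2 * of_real (Im (G (of_real \<rho> * cis (2*pi*t))) * sin (2*pi*t)) /
      (1 - 2 * w * of_real (cos (2*pi*t)) + w\<^sup>2)) has_integral of_real \<rho> * H (of_real \<rho> * w)) {0..1}"
proof -
  have "(\<lambda>z. if z = 0 then deriv G 0 else (G z - G 0) / (z - 0)) holomorphic_on ball 0 1"
    using G by (intro pole_lemma) auto
  moreover have "(\<lambda>z. if z = 0 then deriv G 0 else (G z - G 0) / (z - 0)) = H"
    by (auto simp: H_def G(2) fun_eq_iff)
  ultimately have H: "H holomorphic_on ball 0 1" by (simp only:)
  have GH: "G u = u * H u" for u using G(2) by (simp add: H_def)
  define R where "R = 1 / \<rho>"
  have R: "R > 1" using \<rho> by (simp add: R_def)
  have sub: "(\<lambda>u::complex. of_real \<rho> * u) ` ball 0 R \<subseteq> ball 0 1"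
    using \<rho> by (auto simp: R_def dist_norm norm_mult field_simps)
  have cc: "cnj (cis x) = inverse (cis x)" for x by (simp add: cis_cnj)
  have nz: "1 - v * cis x \<noteq> 0" if "norm v < 1" for v x
  proof
    assume "1 - v * cis x = 0"
    then have "norm (v * cis x) = 1" by simp
    with that show False by (simp add: norm_mult)
  qed
  have E1: "((\<lambda>t. G (of_real \<rho> * cis (2*pi*t)) * (cis (2*pi*t) / (1 - v * cis (2*pi*t)))) has_integral 0) {0..1}"
    if v: "norm v < 1" for v
  proof -
    (* R' keeps u inside the disc where the pole 1/v of the kernel is avoided. *)
    define R' where "R' = min R (if v = 0 then R else 1 / norm v)"
    have R': "R' > 1" "R' \<le> R" using R v by (auto simp: R'_def)
    have nv: "1 - v * u \<noteq> 0" if "u \<in> ball 0 R'" for u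
    proof (cases "v = 0")
      case False
      then have "norm u < 1 / norm v" using that by (auto simp: R'_def)
      then have "norm (v * u) < 1" using False by (simp add: norm_mult field_simps)
      then show ?thesis by (metis eq_iff_diff_eq_0 less_irrefl norm_one)
    qed simp
    have "(G \<circ> (\<lambda>u. of_real \<rho> * u)) holomorphic_on ball 0 R'"
    proof (rule holomorphic_on_compose_gen[OF _ G(1)])
      have "ball 0 R' \<subseteq> (ball 0 R :: complex set)" using R' by auto
      from order_trans[OF image_mono[OF this] sub]
      show "(\<lambda>u::complex. of_real \<rho> * u) ` ball 0 R' \<subseteq> ball 0 1" .
    qed (intro holomorphic_intros)
    then have "(\<lambda>u. G (of_real \<rho> * u) * (u / (1 - v * u))) holomorphic_on ball 0 R'"
      using nv by (intro holomorphic_intros) (auto simp: o_def)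
    from circle_mean_value[OF this R'(1)] show ?thesis by simp
  qed
  (* On the unit circle the conjugate is the inverse, so the second half of the kernel is a Cauchy kernel. *)
  have E2: "((\<lambda>t. G (of_real \<rho> * cis (2*pi*t)) * (cnj (cis (2*pi*t)) / (1 - v * cnj (cis (2*pi*t))))) has_integral of_real \<rho> * H (of_real \<rho> * v)) {0..1}"
    if v: "norm v < 1" for v
  proof -
    have "(H \<circ> (\<lambda>u. of_real \<rho> * u)) holomorphic_on ball 0 R"
      using sub by (intro holomorphic_on_compose_gen[OF _ H] holomorphic_intros) auto
    then have "(\<lambda>u. of_real \<rho> * H (of_real \<rho> * u)) holomorphic_on ball 0 R"
      by (intro holomorphic_intros) (auto simp: o_def)
    from Cauchy_formula_unit_circle[OF this R v]
    show ?thesis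
    proof (rule has_integral_eq[rotated])
      fix t
      have "cis (2*pi*t) - v \<noteq> 0" using v by (metis eq_iff_diff_eq_0 less_irrefl norm_cis)
      then show "\<rho> * H (\<rho> * cis (2*pi*t)) * cis (2*pi*t) / (cis (2*pi*t) - v) = G (of_real \<rho> * cis (2*pi*t)) * (cnj (cis (2*pi*t)) / (1 - v * cnj (cis (2*pi*t))))"
        unfolding GH cc by (simp add: field_simps)
    qed
  qed
  let ?g = "\<lambda>t. G (of_real \<rho> * cis (2*pi*t))"
  let ?z = "\<lambda>t. cis (2*pi*t)"
  have cw: "norm (cnj w) < 1" using w by simp
  have lt: "norm (of_real \<rho> * v) < 1" if "norm v < 1" for v :: complex
  proof -
    have "\<rho> * norm v \<le> 1 * norm v" using \<rho> by (intro mult_right_mono) auto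
    then show ?thesis using that \<rho> by (simp add: norm_mult)
  qed
  (* The symmetry of G passes to the quotient H, at the origin by continuity. *)
  have Hs: "H (\<rho> * cnj w) = cnj (H (\<rho> * w))"
  proof (cases "w = 0")
    case True
    have l1: "((\<lambda>x::real. H (of_real (\<rho> * x))) \<longlongrightarrow> H 0) (at 0)"
    proof -
      have "isCont H 0" using holomorphic_on_imp_continuous_on[OF H] by (simp add: continuous_on_eq_continuous_at)
      then show ?thesis
        by (rule isCont_tendsto_compose) (auto intro!: tendsto_eq_intros)
    qed
    have l2: "((\<lambda>x::real. cnj (H (of_real (\<rho> * x)))) \<longlongrightarrow> cnj (H 0)) (at 0)"
      using l1 by (rule tendsto_cnj)
    have "\<forall>\<^sub>F x in at 0. cnj (H (of_real (\<rho> * x))) = H (of_real (\<rho> * x))"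
      unfolding eventually_at
    proof (intro exI[of _ 1] conjI ballI impI)
      fix x :: real assume x: "x \<noteq> 0 \<and> dist x 0 < 1"
      then have "norm (complex_of_real (\<rho> * x)) < 1" using lt[of "of_real x"] by simp
      from sym[OF this] show "cnj (H (of_real (\<rho> * x))) = H (of_real (\<rho> * x))" using x \<rho> by (simp add: H_def)
    qed simp
    then have "((\<lambda>x::real. H (of_real (\<rho> * x))) \<longlongrightarrow> cnj (H 0)) (at 0)"
      by (rule Lim_transform_eventually[OF l2])
    from tendsto_unique[OF trivial_limit_at l1 this] show ?thesis using True by simp
  next
    case False
    have "norm (\<rho> * w) < 1" using lt[OF w] .
    then show ?thesis using False \<rho> sym[of "\<rho> * w"] by (simp add: H_def)
  qed
  (* Conjugating both integrals replaces G by its conjugate; the difference contains only Im G. *)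
  have C1: "((\<lambda>t. cnj (?g t) * (cnj (?z t) / (1 - w * cnj (?z t)))) has_integral 0) {0..1}"
    using has_integral_cnj[THEN iffD2, OF E1[OF cw]] by (simp add: o_def)
  have C2: "((\<lambda>t. cnj (?g t) * (?z t / (1 - w * ?z t))) has_integral of_real \<rho> * H (of_real \<rho> * w)) {0..1}"
    using has_integral_cnj[THEN iffD2, OF E2[OF cw]] by (simp add: o_def Hs)
  have "((\<lambda>t. (- 1/2) * ((?g t * (?z t / (1 - w * ?z t)) - ?g t * (cnj (?z t) / (1 - w * cnj (?z t))))
      - (cnj (?g t) * (?z t / (1 - w * ?z t)) - cnj (?g t) * (cnj (?z t) / (1 - w * cnj (?z t))))))
      has_integral (- 1/2) * ((0 - \<rho> * H (\<rho> * w)) - (\<rho> * H (\<rho> * w) - 0))) {0..1}"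
    by (intro has_integral_mult_right has_integral_diff E1 E2 C1 C2 w)
  then show ?thesis
  proof (rule has_integral_eq_rhs[OF has_integral_eq[rotated]])
    fix t :: real
    have k: "?z t / (1 - w * ?z t) - cnj (?z t) / (1 - w * cnj (?z t)) = 2 * \<i> * (of_real (sin (2*pi*t)) / (1 - 2 * w * of_real (cos (2*pi*t)) + w\<^sup>2))"
      using typically_real_kernel(1)[of "?z t" w] w by (simp add: field_simps)
    have "(- 1/2) * ((?g t * (?z t / (1 - w * ?z t)) - ?g t * (cnj (?z t) / (1 - w * cnj (?z t))))
      - (cnj (?g t) * (?z t / (1 - w * ?z t)) - cnj (?g t) * (cnj (?z t) / (1 - w * cnj (?z t)))))
      = (- 1/2) * ((?g t - cnj (?g t)) * (?z t / (1 - w * ?z t) - cnj (?z t) / (1 - w * cnj (?z t))))"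
      by (simp add: algebra_simps)
    also have "\<dots> = 2 * of_real (Im (?g t) * sin (2*pi*t)) / (1 - 2 * w * of_real (cos (2*pi*t)) + w\<^sup>2)"
      unfolding k complex_diff_cnj by (simp add: field_simps)
    finally show "(- 1/2) * ((?g t * (?z t / (1 - w * ?z t)) - ?g t * (cnj (?z t) / (1 - w * cnj (?z t))))
      - (cnj (?g t) * (?z t / (1 - w * ?z t)) - cnj (?g t) * (cnj (?z t) / (1 - w * cnj (?z t)))))
      = 2 * of_real (Im (?g t) * sin (2*pi*t)) / (1 - 2 * w * of_real (cos (2*pi*t)) + w\<^sup>2)" .
  qed simp
qed

text \<open>
  The Joukowski map \<open>w \<mapsto> \<gamma> + (h/2)(w + 1/w)\<close> takes the punctured unit disc onto the part of the plane off the
  interval with centre \<open>\<gamma>\<close> and half-length \<open>h\<close>. These two lemmas say that it does not meet the interval and that it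
  reaches every point off it.
\<close>
lemma joukowski_notin:
  fixes w :: complex
  assumes "w \<noteq> 0" "norm w < 1" "h > 0"
  shows "of_real \<gamma> + of_real (h/2) * (w + 1/w) \<notin> cset {\<gamma> - h..\<gamma> + h}"
proof
  assume "of_real \<gamma> + of_real (h/2) * (w + 1/w) \<in> cset {\<gamma> - h..\<gamma> + h}"
  then obtain x where x: "x \<in> {\<gamma> - h..\<gamma> + h}" "of_real \<gamma> + of_real (h/2) * (w + 1/w) = of_real x" by auto
  define c where "c = (x - \<gamma>) / h"
  have c: "\<bar>c\<bar> \<le> 1" using x(1) assms(3) by (auto simp: c_def abs_le_iff field_simps)
  have "of_real (h/2) * (w + 1/w) = complex_of_real (x - \<gamma>)" using x(2) by (simp add: algebra_simps)
  then have "w + 1/w = 2 * of_real c" using assms(3) by (simp add: c_def field_simps)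
  then have e: "w\<^sup>2 - 2 * of_real c * w + 1 = 0" using assms(1) by (simp add: field_simps power2_eq_square)
  define r s where "r = Re w" and "s = Im w"
  have w: "w = Complex r s" by (simp add: r_def s_def)
  have re: "r\<^sup>2 - s\<^sup>2 - 2 * c * r + 1 = 0" and im: "2 * r * s - 2 * c * s = 0"
    using arg_cong[OF e, of Re] arg_cong[OF e, of Im] by (simp_all add: w power2_eq_square algebra_simps)
  have n: "r\<^sup>2 + s\<^sup>2 < 1" using assms(2) by (simp add: w cmod_def)
  show False
  proof (cases "s = 0")
    case True
    then have "(r - c)\<^sup>2 = c\<^sup>2 - 1" using re by (simp add: power2_eq_square algebra_simps)
    moreover have "c\<^sup>2 \<le> 1" using c by (simp add: abs_square_le_1)
    moreover have "(r - c)\<^sup>2 \<ge> 0" by simp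
    ultimately have "c\<^sup>2 = 1" "r = c" by auto
    then show False using n True by simp
  next
    case False
    then have "r = c" using im by simp
    then show False using re n by (simp add: power2_eq_square)
  qed
qed

lemma joukowski_surj:
  fixes z :: complex
  assumes "z \<notin> cset {\<gamma> - h..\<gamma> + h}" "h > 0"
  obtains w where "w \<noteq> 0" "norm w < 1" "of_real \<gamma> + of_real (h/2) * (w + 1/w) = z"
proof -
  define c where "c = (z - of_real \<gamma>) / of_real h"
  have zc: "z = of_real \<gamma> + of_real h * c" using assms(2) by (simp add: c_def)
  define q where "q = csqrt (c\<^sup>2 - 1)"
  have q: "q * q = c * c - 1" by (metis q_def power2_csqrt power2_eq_square)
  define w1 w2 where "w1 = c + q" and "w2 = c - q"
  have p: "w1 * w2 = 1" using q by (simp add: w1_def w2_def algebra_simps)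
  have s: "w1 + w2 = 2 * c" by (simp add: w1_def w2_def)
  have nz: "w1 \<noteq> 0" "w2 \<noteq> 0" using p by auto
  have i: "1 / w1 = w2" "1 / w2 = w1" using p nz by (auto simp: field_simps)
  have n1: "norm w1 \<noteq> 1"
  proof
    assume a: "norm w1 = 1"
    then have "w2 = cnj w1" using i(1) by (simp add: divide_conv_cnj)
    then have "2 * c = of_real (2 * Re w1)" using s by (simp add: complex_add_cnj)
    then have "c = of_real (Re w1)" by simp
    moreover have "\<bar>Re w1\<bar> \<le> 1" using abs_Re_le_cmod[of w1] a by simp
    then have "\<bar>h * Re w1\<bar> \<le> h" using assms(2) mult_left_mono[of "\<bar>Re w1\<bar>" 1 h] by (simp add: abs_mult)
    then have "\<gamma> + h * Re w1 \<in> {\<gamma> - h..\<gamma> + h}" by (simp add: abs_le_iff)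
    moreover have "z = of_real (\<gamma> + h * Re w1)" using zc \<open>c = of_real (Re w1)\<close> by simp
    ultimately show False using assms(1) by blast
  qed
  have "norm w1 * norm w2 = 1" using p by (metis norm_mult norm_one)
  moreover have "norm w1 * norm w2 \<ge> 1 * norm w2" if "norm w1 \<ge> 1" using that by (intro mult_right_mono) auto
  moreover have "norm w2 \<noteq> 1" using calculation(1) n1 by auto
  ultimately consider "norm w1 < 1" | "norm w2 < 1" by fastforce
  then show ?thesis
  proof cases
    case 1 then show ?thesis using that[of w1] nz i s zc by (simp add: field_simps)
  next
    case 2 then show ?thesis using that[of w2] nz i s zc by (simp add: field_simps)
  qed
qed

text \<open>
  Pulled back by the Joukowski map, \<open>g\<close> becomes a function \<open>G\<close> on the disc to which \<open>typically_real_formula\<close> applies,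
  and the denominator there is \<open>2w/h\<close> times the difference of \<open>z\<close>, the image of \<open>w\<close>, and the point \<open>\<gamma> + h cos(2\<pi>t)\<close>
  of the interval. So for every \<open>\<rho> < 1\<close> the function \<open>G(\<rho>w)\<close>, as a function of \<open>z\<close>, is the Cauchy transform of a
  positive measure on the interval. The masses of these measures are bounded, and by Helly selection a subsequence
  for \<open>\<rho>\<close> tending to one converges weakly to the representing measure.
\<close>
lemma herglotz_interval:
  fixes g :: "complex \<Rightarrow> complex" and \<alpha> \<beta> :: real
  assumes ab: "\<alpha> < \<beta>" and hol: "g holomorphic_on - cset {\<alpha>..\<beta>}"
    and sym: "\<And>z. z \<notin> cset {\<alpha>..\<beta>} \<Longrightarrow> g (cnj z) = cnj (g z)"
    and pos: "\<And>z. Im z > 0 \<Longrightarrow> Im (g z) \<le> 0"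
    and inf: "(g \<longlongrightarrow> 0) at_infinity"
  obtains \<tau> where "sets \<tau> = sets borel" "finite_measure \<tau>"
    "\<And>z. z \<notin> cset {\<alpha>..\<beta>} \<Longrightarrow> g z = cauchy_int \<tau> {\<alpha>..\<beta>} (\<lambda>_. 1) z"
proof -
  define \<gamma> h where "\<gamma> = (\<alpha> + \<beta>) / 2" and "h = (\<beta> - \<alpha>) / 2"
  have h: "h > 0" and I: "{\<alpha>..\<beta>} = {\<gamma> - h..\<gamma> + h}"
    using ab by (simp_all add: \<gamma>_def h_def field_simps)
  let ?I = "{\<alpha>..\<beta>}"
  define J :: "complex \<Rightarrow> complex" where "J w = of_real \<gamma> + of_real (h/2) * (w + 1/w)" for w
  have Jn: "J w \<notin> cset ?I" if "w \<noteq> 0" "norm w < 1" for w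
    unfolding J_def I using joukowski_notin[OF that h] .
  define G where "G w = (if w = 0 then 0 else g (J w))" for w
  have Jinf: "filterlim J at_infinity (at 0)"
  proof -
    have "filterlim (\<lambda>w::complex. w + 1/w) at_infinity (at 0)"
      by (intro tendsto_add_filterlim_at_infinity[OF tendsto_ident_at])
        (simp add: divide_inverse filterlim_inverse_at_infinity)
    then have "filterlim (\<lambda>w::complex. of_real (h/2) * (w + 1/w)) at_infinity (at 0)"
      using h by (intro tendsto_mult_filterlim_at_infinity[OF tendsto_const]) auto
    then show ?thesis unfolding J_def by (intro tendsto_add_filterlim_at_infinity[OF tendsto_const])
  qed
  have "(g \<circ> J) holomorphic_on (ball 0 1 - {0})"
  proof (rule holomorphic_on_compose_gen[OF _ hol])
    show "J holomorphic_on ball 0 1 - {0}" unfolding J_def by (intro holomorphic_intros) auto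
    show "J ` (ball 0 1 - {0}) \<subseteq> - cset ?I"
    proof (rule image_subsetI)
      fix w :: complex assume "w \<in> ball 0 1 - {0}"
      then have "J w \<notin> cset ?I" by (intro Jn) auto
      then show "J w \<in> - cset ?I" by (simp only: Compl_iff not_False_eq_True)
    qed
  qed
  then have Gh0: "G holomorphic_on (ball 0 1 - {0})"
    by (rule holomorphic_transform) (auto simp: G_def)
  have "isCont G 0"
    unfolding isCont_def
  proof (rule Lim_transform_eventually[OF filterlim_compose[OF inf Jinf], of G, THEN tendsto_eq_rhs])
    show "\<forall>\<^sub>F x in at 0. g (J x) = G x" unfolding eventually_at by (intro exI[of _ 1]) (auto simp: G_def)
  qed (simp add: G_def)
  moreover have "continuous_on (ball 0 1 - {0}) G" using Gh0 holomorphic_on_imp_continuous_on by blast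
  ultimately have "continuous_on (ball 0 1) G"
    by (metis (no_types, lifting) DiffI continuous_at_imp_continuous_at_within continuous_on_eq_continuous_at
        continuous_on_eq_continuous_within open_ball open_delete singletonD)
  then have Gh: "G holomorphic_on ball 0 1"
    by (rule no_isolated_singularity[OF _ Gh0]) auto
  have G0: "G 0 = 0" by (simp add: G_def)
  have Jc: "J (cnj w) = cnj (J w)" for w by (simp add: J_def)
  have Gs: "G (cnj w) = cnj (G w)" if "norm w < 1" for w
    using sym Jn[of w] that by (simp add: G_def Jc)
  have ImJ: "Im (J w) = (h/2) * Im w * (1 - 1 / (norm w)\<^sup>2)" if "w \<noteq> 0" for w
  proof -
    have "Im (1 / w) = - (Im w / (norm w)\<^sup>2)" by (simp add: Im_divide cmod_power2)
    then have "Im (J w) = (h/2) * (Im w - Im w / (norm w)\<^sup>2)" by (simp add: J_def)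
    then show ?thesis by (simp add: algebra_simps)
  qed
  have Gpos: "Im (G w) * Im w \<ge> 0" if "norm w < 1" for w
  proof -
    have up: "Im (G w) \<le> 0" if "Im w < 0" "norm w < 1" for w
    proof -
      have w0: "w \<noteq> 0" using that by auto
      then have "1 - 1 / (norm w)\<^sup>2 < 0" using that(2) by (simp add: power_less_one_iff abs_square_less_1)
      then have "Im (J w) > 0" unfolding ImJ[OF w0] using that(1) h
        by (intro mult_neg_neg) (auto simp: mult_pos_neg)
      then show ?thesis using pos w0 by (simp add: G_def)
    qed
    consider "Im w = 0" | "Im w < 0" | "Im w > 0" by linarith
    then show ?thesis
    proof cases
      case 2 then show ?thesis using up[of w] that by (simp add: mult_nonpos_nonpos)
    next
      case 3 then have "Im (G (cnj w)) \<le> 0" using up[of "cnj w"] that by simp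
      then show ?thesis using 3 that by (simp add: Gs)
    qed simp
  qed
  define H where "H = (\<lambda>w::complex. if w = 0 then deriv G 0 else G w / w)"
  (* q is the density of the measure on the circle of radius \<rho>, and X projects the circle to the interval. *)
  define q where "q \<rho> t = 2 * Im (G (of_real \<rho> * cis (2*pi*t))) * sin (2*pi*t)" for \<rho> t :: real
  define X where "X t = \<gamma> + h * cos (2*pi*t)" for t :: real
  have XI: "X t \<in> ?I" for t
  proof -
    have "\<bar>h * cos (2*pi*t)\<bar> \<le> h" using h mult_left_mono[OF abs_cos_le_one, of h] by (simp add: abs_mult)
    then show ?thesis unfolding I by (simp add: X_def abs_le_iff)
  qed
  have qpos: "q \<rho> t \<ge> 0" if "0 < \<rho>" "\<rho> < 1" for \<rho> t
  proof -
    have "Im (G (of_real \<rho> * cis (2*pi*t))) * Im (of_real \<rho> * cis (2*pi*t)) \<ge> 0"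
      using that by (intro Gpos) (simp add: norm_mult)
    then have "\<rho> * (Im (G (of_real \<rho> * cis (2*pi*t))) * sin (2*pi*t)) \<ge> 0" by (simp add: mult_ac)
    then show ?thesis using that by (simp add: q_def zero_le_mult_iff)
  qed
  have qcont: "continuous_on {0..1} (q \<rho>)" if "0 < \<rho>" "\<rho> < 1" for \<rho>
  proof -
    have "continuous_on {0..1} (G \<circ> (\<lambda>t. of_real \<rho> * cis (2*pi*t)))"
    proof (rule continuous_on_compose)
      show "continuous_on ((\<lambda>t. of_real \<rho> * cis (2*pi*t)) ` {0..1}) G"
        using holomorphic_on_imp_continuous_on[OF Gh] by (rule continuous_on_subset) (use that in \<open>auto simp: norm_mult\<close>)
    qed (intro continuous_intros)
    then show ?thesis unfolding q_def by (intro continuous_intros) (simp add: o_def)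
  qed
  have formula: "((\<lambda>t. of_real (q \<rho> t) / (1 - 2 * w * of_real (cos (2*pi*t)) + w\<^sup>2)) has_integral of_real \<rho> * H (of_real \<rho> * w)) {0..1}"
    if "0 < \<rho>" "\<rho> < 1" "norm w < 1" for \<rho> w
    using typically_real_formula[OF Gh G0 Gs that] unfolding H_def q_def by (simp add: mult_ac)
  have mass: "((\<lambda>t. of_real (q \<rho> t)) has_integral of_real \<rho> * H 0) {0..1}" if "0 < \<rho>" "\<rho> < 1" for \<rho>
    using formula[OF that, of 0] by simp
  define C where "C = Re (H 0)"
  have massC: "(q \<rho> has_integral \<rho> * C) {0..1}" if "0 < \<rho>" "\<rho> < 1" for \<rho>
    using has_integral_Re[OF mass[OF that]] by (simp add: C_def)
  have C0: "C \<ge> 0" using has_integral_nonneg[OF massC[of "1/2"]] qpos[of "1/2"] by simp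
  (* The Cauchy kernel, made bounded and continuous on the whole line by clamping its argument to the
     interval, as weak convergence is tested on such functions. *)
  define ker where "ker z x = 1 / (z - complex_of_real (max \<alpha> (min \<beta> x)))" for z x
  have ker_I: "ker z x = 1 / (z - of_real x)" if "x \<in> ?I" for z x using that by (simp add: ker_def)
  have rep: "((\<lambda>t. of_real (q \<rho> t) * ker (J w) (X t)) has_integral of_real (2/h) * G (of_real \<rho> * w)) {0..1}"
    if "0 < \<rho>" "\<rho> < 1" "norm w < 1" "w \<noteq> 0" for \<rho> w
  proof -
    have "((\<lambda>t. (of_real (2/h) * w) * (of_real (q \<rho> t) / (1 - 2 * w * of_real (cos (2*pi*t)) + w\<^sup>2))) has_integral (of_real (2/h) * w) * (of_real \<rho> * H (of_real \<rho> * w))) {0..1}"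
      by (intro has_integral_mult_right formula that)
    moreover have "(of_real (2/h) * w) * (of_real \<rho> * H (of_real \<rho> * w)) = of_real (2/h) * G (of_real \<rho> * w)"
      using that by (simp add: H_def)
    moreover have "(of_real (2/h) * w) * (of_real (q \<rho> t) / (1 - 2 * w * of_real (cos (2*pi*t)) + w\<^sup>2)) = of_real (q \<rho> t) * ker (J w) (X t)" for t
    proof -
      define D where "D = 1 - 2 * w * of_real (cos (2*pi*t)) + w\<^sup>2"
      have nz: "D \<noteq> 0" unfolding D_def
        using typically_real_kernel(2)[of "cis (2*pi*t)" w] that by simp
      have "J w - of_real (X t) = of_real (h/2) * D / w" unfolding D_def
        using that h by (simp add: J_def X_def field_simps power2_eq_square)
      then show ?thesis unfolding ker_I[OF XI] D_def[symmetric] using nz h that by simp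
    qed
    ultimately show ?thesis by (simp only:)
  qed
  show ?thesis
  proof (cases "C = 0")
    case True
    have G0w: "G w' = 0" if w': "norm w' < 1" "w' \<noteq> 0" for w'
    proof -
      define \<rho> where "\<rho> = (1 + norm w') / 2"
      have \<rho>: "0 < \<rho>" "\<rho> < 1" "norm w' < \<rho>" using w' by (simp_all add: \<rho>_def add_pos_nonneg)
      define w where "w = w' / of_real \<rho>"
      have w: "norm w < 1" "w \<noteq> 0" "of_real \<rho> * w = w'" using \<rho> w' by (simp_all add: w_def norm_divide)
      have qz: "q \<rho> t = 0" if "t \<in> {0..1}" for t
      proof (rule has_integral_0_cbox_imp_0[of 0 1 "q \<rho>"])
        show "(q \<rho> has_integral 0) (cbox 0 1)" using massC[OF \<rho>(1,2)] True by simp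
      qed (use that qcont[OF \<rho>(1,2)] qpos[OF \<rho>(1,2)] in auto)
      have "((\<lambda>t::real. 0) has_integral of_real (2/h) * G (of_real \<rho> * w)) {0..1}"
        by (rule has_integral_eq[rotated, OF rep[OF \<rho>(1,2) w(1,2)]]) (simp add: qz)
      then have "of_real (2/h) * G (of_real \<rho> * w) = 0" by (metis has_integral_0 has_integral_unique)
      then show ?thesis using h w by simp
    qed
    have z0: "g z = 0" if z: "z \<notin> cset ?I" for z
    proof -
      obtain w where w: "w \<noteq> 0" "norm w < 1" "J w = z"
        using joukowski_surj[of z \<gamma> h] z h unfolding I[symmetric] J_def by blast
      then show ?thesis using G0w[of w] by (simp add: G_def)
    qed
    have "finite_measure (null_measure (borel :: real measure))" by (rule finite_measureI) simp
    then show ?thesis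
      by (intro that[of "null_measure borel"]) (auto simp: z0 cauchy_int_def set_lebesgue_integral_def integral_null_measure)
  next
    case False
    then have Cp: "C > 0" using C0 by simp
    (* Probability measures M n: normalise q to mass one and push it forward to the interval. *)
    define \<rho> where "\<rho> n = 1 - 1 / (real n + 2)" for n
    have \<rho>: "0 < \<rho> n" "\<rho> n < 1" for n by (simp_all add: \<rho>_def field_simps)
    have \<rho>lim: "\<rho> \<longlonglongrightarrow> 1" unfolding \<rho>_def by real_asymp
    define p where "p n t = q (\<rho> n) t / (\<rho> n * C)" for n t
    have p0: "p n t \<ge> 0" for n t using qpos \<rho>[of n] Cp by (simp add: p_def)
    have pcont: "continuous_on {0..1} (p n)" for n
      unfolding p_def using \<rho>[of n] Cp by (intro continuous_intros qcont) auto
    define N where "N n = density lborel (\<lambda>t. ennreal (indicator {0..1} t * p n t))" for n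
    have pm: "(\<lambda>t. indicator {0..1} t * p n t) \<in> borel_measurable borel" for n
      using borel_measurable_continuous_on_indicator[OF _ pcont, of n] by simp
    have Xm: "X \<in> borel_measurable borel" unfolding X_def by measurable
    have Xc: "continuous_on A X" for A unfolding X_def by (intro continuous_intros)
    define M where "M n = distr (N n) borel X" for n
    have Nprob: "prob_space (N n)" for n
    proof (rule prob_spaceI)
      have "(p n has_integral 1) {0..1}"
        using has_integral_divide[OF massC[OF \<rho>(1)[of n] \<rho>(2)], of "\<rho> n * C"] \<rho>[of n] Cp by (simp add: p_def[abs_def])
      moreover have "(\<lambda>t. indicator {0..1} t * p n t) = (\<lambda>t. if t \<in> {0..1} then p n t else 0)"
        by (auto simp: indicator_def)
      ultimately have "((\<lambda>t. indicator {0..1} t * p n t) has_integral 1) UNIV"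
        by (simp only: has_integral_restrict_UNIV)
      from nn_integral_has_integral_lborel[OF _ _ this] pm p0
      show "emeasure (N n) (space (N n)) = 1"
        by (simp add: N_def emeasure_density)
    qed
    have Mprob: "prob_space (M n)" for n
      unfolding M_def by (rule prob_space.prob_space_distr[OF Nprob]) (simp add: N_def Xm)
    have Mdist: "real_distribution (M n)" for n
      using Mprob[of n] by (simp add: real_distribution_def real_distribution_axioms_def M_def)
    have int: "(LINT x|M n. F x) = v"
      if F: "continuous_on UNIV F" and v: "((\<lambda>t. p n t *\<^sub>R F (X t)) has_integral v) {0..1}"
      for F :: "real \<Rightarrow> complex" and n v
    proof -
      have Fm: "F \<in> borel_measurable borel" using F by (rule borel_measurable_continuous_onI)
      have "(LINT x|M n. F x) = (LINT t|N n. F (X t))"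
        unfolding M_def by (rule integral_distr) (simp_all add: N_def Xm Fm)
      also have "\<dots> = (LINT t|lborel. (indicator {0..1} t * p n t) *\<^sub>R F (X t))"
        unfolding N_def using pm p0 Fm Xm
        by (intro integral_density) (auto intro!: AE_I2 measurable_compose[OF Xm Fm])
      also have "\<dots> = (LINT t:{0..1}|lborel. p n t *\<^sub>R F (X t))"
        by (simp add: set_lebesgue_integral_def)
      also have "\<dots> = integral {0..1} (\<lambda>t. p n t *\<^sub>R F (X t))"
      proof (rule set_borel_integral_eq_integral(2), rule borel_integrable_atLeastAtMost')
        have "continuous_on {0..1} (F \<circ> X)" by (intro continuous_on_compose Xc continuous_on_subset[OF F]) auto
        then show "continuous_on {0..1} (\<lambda>t. p n t *\<^sub>R F (X t))"
          by (intro continuous_intros pcont) (simp add: o_def)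
      qed
      finally show ?thesis using v by (simp add: integral_unique)
    qed
    have mM: "measure (M n) {\<alpha> - 1<..\<beta>} = 1" for n
    proof -
      have "measure (M n) {\<alpha> - 1<..\<beta>} = measure (N n) (X -` {\<alpha> - 1<..\<beta>} \<inter> space (N n))"
        unfolding M_def by (rule measure_distr) (simp_all add: N_def Xm)
      also have "X -` {\<alpha> - 1<..\<beta>} \<inter> space (N n) = space (N n)"
      proof -
        have "X t \<in> {\<alpha> - 1<..\<beta>}" for t using XI[of t] by simp
        then show ?thesis by auto
      qed
      finally show ?thesis using prob_space.prob_space[OF Nprob, of n] by simp
    qed
    have "tight M"
      unfolding tight_def
    proof (intro conjI allI impI Mdist)
      fix \<epsilon> :: real assume "\<epsilon> > 0"
      then show "\<exists>a b. a < b \<and> (\<forall>n. 1 - \<epsilon> < measure (M n) {a<..b})"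
        using mM ab by (intro exI[of _ "\<alpha> - 1"] exI[of _ \<beta>]) simp
    qed
    from tight_imp_convergent_subsubsequence[OF this strict_mono_id]
    obtain r L where r: "strict_mono (r :: nat \<Rightarrow> nat)" and L: "real_distribution L"
      and conv: "weak_conv_m (M \<circ> id \<circ> r) L" by blast
    interpret L: real_distribution L by fact
    have Lm: "F \<in> borel_measurable L" if "F \<in> borel_measurable borel" for F :: "real \<Rightarrow> 'b::topological_space"
      using that by (simp cong: measurable_cong_sets)
    have conv_int: "(\<lambda>n. LINT x|M (r n). F x) \<longlonglongrightarrow> (LINT x|L. F x)"
      if "continuous_on UNIV F" "\<And>x. norm (F x) \<le> B" for F :: "real \<Rightarrow> complex" and B
      using weak_conv_imp_integral_bdd_continuous_conv[OF _ L conv, of F B] Mdist that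
      by (simp add: o_def continuous_on_eq_continuous_at)
    have supp: "AE x in L. x \<in> ?I"
    proof -
      (* F is continuous, bounded, and zero exactly on the interval. *)
      define F where "F x = min 1 (max 0 (\<alpha> - x) + max 0 (x - \<beta>))" for x
      have Fc: "continuous_on UNIV F" unfolding F_def by (intro continuous_intros)
      have F0: "F x \<ge> 0" "F x \<le> 1" for x by (auto simp: F_def)
      have F1: "F x = 0 \<longleftrightarrow> x \<in> ?I" for x by (auto simp: F_def min_def max_def)
      have "(\<lambda>n. LINT x|M (r n). complex_of_real (F x)) \<longlonglongrightarrow> (LINT x|L. complex_of_real (F x))"
        by (rule conv_int[of "\<lambda>x. complex_of_real (F x)" 1])
          (use F0 in \<open>simp_all add: continuous_on_of_real Fc\<close>)
      moreover have "(LINT x|M (r n). complex_of_real (F x)) = 0" for n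
      proof (rule int)
        have "F (X t) = 0" for t using F1[of "X t"] XI[of t] by simp
        then show "((\<lambda>t. p (r n) t *\<^sub>R complex_of_real (F (X t))) has_integral 0) {0..1}" by simp
      qed (simp add: continuous_on_of_real Fc)
      ultimately have "(LINT x|L. complex_of_real (F x)) = 0" by (simp add: LIMSEQ_const_iff)
      then have "(LINT x|L. F x) = 0" by simp
      moreover have "integrable L F"
        using F0 Lm[OF borel_measurable_continuous_onI[OF Fc]] by (intro L.integrable_const_bound[where B = 1]) auto
      ultimately have "AE x in L. F x = 0"
        using integral_nonneg_eq_0_iff_AE[of L F] F0 by simp
      then show ?thesis by (simp add: F1)
    qed
    (* This undoes the factor 2/h of the kernel and the normalisation by C. *)
    define c where "c = h * C / 2"
    have c: "c > 0" using h Cp by (simp add: c_def)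
    define \<tau> where "\<tau> = density L (\<lambda>_. ennreal c)"
    show ?thesis
    proof (rule that[of \<tau>])
      show "sets \<tau> = sets borel" by (simp add: \<tau>_def)
      show "finite_measure \<tau>"
        by (rule finite_measureI) (simp add: \<tau>_def emeasure_density nn_integral_cmult L.emeasure_space_1[unfolded L.space_eq_univ] ennreal_mult_eq_top_iff)
      fix z assume z: "z \<notin> cset ?I"
      obtain w where w: "w \<noteq> 0" "norm w < 1" "J w = z"
        using joukowski_surj[of z \<gamma> h] z h unfolding I[symmetric] J_def by blast
      have cl: "max \<alpha> (min \<beta> x) \<in> ?I" for x using ab by auto
      then have nz: "z - complex_of_real (max \<alpha> (min \<beta> x)) \<noteq> 0" for x using z by fastforce
      have kc: "continuous_on UNIV (ker z)" unfolding ker_def using nz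
        by (intro continuous_intros) auto
      have "continuous_on ?I (\<lambda>x. 1 / (z - complex_of_real x))" using z by (intro continuous_intros) auto
      then obtain B where B: "\<And>x. x \<in> ?I \<Longrightarrow> norm (1 / (z - complex_of_real x)) \<le> B"
        using compact_continuous_norm_bound[OF compact_Icc] by blast
      have "norm (ker z x) \<le> B" for x unfolding ker_def by (rule B[OF cl])
      then have A: "(\<lambda>n. LINT x|M (r n). ker z x) \<longlonglongrightarrow> (LINT x|L. ker z x)"
        by (rule conv_int[OF kc])
      have Bn: "(LINT x|M n. ker z x) = of_real (1 / (\<rho> n * C)) * (of_real (2/h) * G (of_real (\<rho> n) * w))" for n
      proof (rule int[OF kc])
        have "((\<lambda>t. of_real (1 / (\<rho> n * C)) * (of_real (q (\<rho> n) t) * ker (J w) (X t))) has_integral of_real (1 / (\<rho> n * C)) * (of_real (2/h) * G (of_real (\<rho> n) * w))) {0..1}"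
          by (intro has_integral_mult_right rep \<rho> w)
        then show "((\<lambda>t. p n t *\<^sub>R ker z (X t)) has_integral of_real (1 / (\<rho> n * C)) * (of_real (2/h) * G (of_real (\<rho> n) * w))) {0..1}"
          by (simp add: p_def w scaleR_conv_of_real)
      qed
      have "(\<lambda>n. of_real (1 / (\<rho> n * C)) * (of_real (2/h) * G (of_real (\<rho> n) * w))) \<longlonglongrightarrow>
          of_real (1 / (1 * C)) * (of_real (2/h) * G (of_real 1 * w))"
      proof (intro tendsto_intros \<rho>lim isCont_tendsto_compose[where g = G])
        show "isCont G (of_real 1 * w)" using holomorphic_on_imp_continuous_on[OF Gh] w
          by (simp add: continuous_on_eq_continuous_at)
      qed (use Cp in auto)
      from LIMSEQ_subseq_LIMSEQ[OF this r]
      have "(\<lambda>n. LINT x|M (r n). ker z x) \<longlonglongrightarrow> of_real (1 / (1 * C)) * (of_real (2/h) * G (of_real 1 * w))"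
        by (simp only: Bn o_def)
      from LIMSEQ_unique[OF A this]
      have eq: "of_real c * (LINT x|L. ker z x) = g z"
        using w h Cp by (simp add: c_def G_def)
      have im: "(\<lambda>x. indicator ?I x *\<^sub>R (1 / (z - of_real x))) \<in> borel_measurable L"
        using z by (intro Lm borel_measurable_continuous_on_indicator continuous_intros) auto
      have "cauchy_int \<tau> ?I (\<lambda>_. 1) z = (LINT x|\<tau>. indicator ?I x *\<^sub>R (1 / (z - of_real x)))"
        unfolding cauchy_int_def set_lebesgue_integral_def by simp
      also have "\<dots> = (LINT x|L. c *\<^sub>R (indicator ?I x *\<^sub>R (1 / (z - of_real x))))"
        unfolding \<tau>_def using c im by (intro integral_density) auto
      also have "\<dots> = (LINT x|L. c *\<^sub>R ker z x)"
      proof (rule integral_cong_AE)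
        show "AE x in L. c *\<^sub>R (indicator ?I x *\<^sub>R (1 / (z - of_real x))) = c *\<^sub>R ker z x"
          using supp by eventually_elim (simp add: ker_I)
      qed (use im Lm[OF borel_measurable_continuous_onI[OF kc]] in auto)
      also have "\<dots> = g z" using eq by (simp add: scaleR_conv_of_real)
      finally show "g z = cauchy_int \<tau> ?I (\<lambda>_. 1) z" by simp
    qed
  qed
qed

section \<open>Polynomial multiples and reciprocals of Cauchy transforms\<close>
abbreviation cpoly :: "real poly \<Rightarrow> complex poly" where "cpoly p \<equiv> map_poly complex_of_real p"

lemma cpoly_pCons: "cpoly (pCons a p) = pCons (of_real a) (cpoly p)"
  by (rule map_poly_pCons) simp

lemma poly_cpoly_of_real: "poly (cpoly p) (of_real x) = of_real (poly p x)"
  by (induction p) (simp_all add: cpoly_pCons)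

lemma poly_cpoly_cnj: "poly (cpoly p) (cnj z) = cnj (poly (cpoly p) z)"
  by (induction p) (simp_all add: cpoly_pCons)

lemma cpoly_add: "cpoly (p + q) = cpoly p + cpoly q"
  by (rule poly_eqI) (simp add: coeff_map_poly)

lemma cpoly_smult: "cpoly (smult a p) = smult (of_real a) (cpoly p)"
  by (rule poly_eqI) (simp add: coeff_map_poly)

lemma cpoly_mult: "cpoly (p * q) = cpoly p * cpoly q"
  by (induction p) (simp_all add: cpoly_pCons cpoly_add cpoly_smult)

lemma cpoly_diff: "cpoly (p - q) = cpoly p - cpoly q"
  by (rule poly_eqI) (simp add: coeff_map_poly)

lemma cpoly_sum: "cpoly (sum f A) = (\<Sum>x\<in>A. cpoly (f x))"
  by (induction A rule: infinite_finite_induct) (simp_all add: cpoly_add)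

lemma cpoly_prod: "cpoly (prod f A) = (\<Prod>x\<in>A. cpoly (f x))"
  by (induction A rule: infinite_finite_induct) (simp_all add: cpoly_mult)

lemma degree_cpoly: "degree (cpoly p) = degree p"
  by (rule degree_map_poly) simp

lemma cpoly_eq_0_iff: "cpoly p = 0 \<longleftrightarrow> p = 0"
  by (metis degree_cpoly leading_coeff_0_iff coeff_map_poly of_real_0 of_real_eq_0_iff map_poly_0)

lemma poly_tendsto_0_imp_0:
  fixes F :: "complex poly"
  assumes "(poly F \<longlongrightarrow> 0) at_infinity"
  shows "F = 0"
proof -
  obtain a q where F: "F = pCons a q" by (cases F)
  have "eventually (\<lambda>z. norm (poly F z) < 1) at_infinity"
    using assms by (auto dest: tendstoD[where e = 1])
  then obtain b where b: "\<And>z. norm z \<ge> b \<Longrightarrow> norm (poly F z) < 1" by (auto simp: eventually_at_infinity)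
  have "q = 0"
  proof (rule ccontr)
    assume "q \<noteq> 0"
    from poly_infinity[OF this, of 1 a] obtain r where r: "\<And>z. norm z \<ge> r \<Longrightarrow> 1 \<le> norm (poly F z)"
      unfolding F by blast
    define M where "M = \<bar>b\<bar> + \<bar>r\<bar>"
    have "norm (complex_of_real M) \<ge> b" "norm (complex_of_real M) \<ge> r" unfolding M_def by (simp_all del: of_real_add)
    from b[OF this(1)] r[OF this(2)] show False by simp
  qed
  then have "poly F = (\<lambda>_. a)" by (simp add: F fun_eq_iff)
  then have "(poly F \<longlongrightarrow> a) at_infinity" by simp
  from tendsto_unique[OF _ this assms] have "a = 0" by (simp add: trivial_limit_at_infinity)
  then show ?thesis using F \<open>q = 0\<close> by simp
qed

lemma heavy_onD: "heavy_on I \<mu> \<Longrightarrow> sets \<mu> = sets borel" "heavy_on I \<mu> \<Longrightarrow> finite_measure \<mu>"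
  by (auto simp: heavy_on_def)

text \<open>
  Since \<open>(p(z) - p(x))/(z - x)\<close> is a polynomial in \<open>z\<close> of degree less than that of \<open>p\<close>, a polynomial factor can be
  moved inside the integral at the cost of a polynomial of smaller degree.
\<close>
lemma poly_mult_cauchy_int:
  assumes m: "sets \<mu> = sets borel" "finite_measure \<mu>" "compact I" "continuous_on I d"
  obtains E where "E = 0 \<or> degree E < degree p"
    "\<And>z. z \<notin> cset I \<Longrightarrow> poly (cpoly p) z * cauchy_int \<mu> I d z = cauchy_int \<mu> I (\<lambda>x. poly p x * d x) z + poly (cpoly E) z"
proof -
  have "\<exists>E. (E = 0 \<or> degree E < degree p) \<and>
    (\<forall>z. z \<notin> cset I \<longrightarrow> poly (cpoly p) z * cauchy_int \<mu> I d z = cauchy_int \<mu> I (\<lambda>x. poly p x * d x) z + poly (cpoly E) z)"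
  proof (induction p)
    case 0
    show ?case by (intro exI[of _ 0]) (simp add: cauchy_int_def set_lebesgue_integral_def)
  next
    case (pCons a q)
    then obtain E where E: "E = 0 \<or> degree E < degree q"
      "\<And>z. z \<notin> cset I \<Longrightarrow> poly (cpoly q) z * cauchy_int \<mu> I d z = cauchy_int \<mu> I (\<lambda>x. poly q x * d x) z + poly (cpoly E) z"
      by blast
    define M where "M = (LINT x:I|\<mu>. poly q x * d x)"
    have qd: "continuous_on I (\<lambda>x. poly q x * d x)" using m by (intro continuous_intros)
    show ?case
    proof (intro exI[of _ "pCons M E"] conjI allI impI)
      show "pCons M E = 0 \<or> degree (pCons M E) < degree (pCons a q)"
      proof (cases "q = 0")
        case True
        then have "M = 0" "E = 0" using E(1) by (auto simp: M_def set_lebesgue_integral_def)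
        then show ?thesis by simp
      next
        case False
        then show ?thesis using E(1) by auto
      qed
      fix z assume z: "z \<notin> cset I"
      have "poly (cpoly (pCons a q)) z * cauchy_int \<mu> I d z = of_real a * cauchy_int \<mu> I d z + z * (poly (cpoly q) z * cauchy_int \<mu> I d z)"
        by (simp add: cpoly_pCons algebra_simps)
      also have "poly (cpoly q) z * cauchy_int \<mu> I d z = cauchy_int \<mu> I (\<lambda>x. poly q x * d x) z + poly (cpoly E) z" by (rule E(2)[OF z])
      also have "of_real a * cauchy_int \<mu> I d z + z * (cauchy_int \<mu> I (\<lambda>x. poly q x * d x) z + poly (cpoly E) z)
        = of_real a * cauchy_int \<mu> I d z + cauchy_int \<mu> I (\<lambda>x. x * (poly q x * d x)) z + poly (cpoly (pCons M E)) z"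
        using cauchy_int_mult_z[OF m(1-3) qd z] by (simp add: cpoly_pCons M_def algebra_simps)
      also have "of_real a * cauchy_int \<mu> I d z + cauchy_int \<mu> I (\<lambda>x. x * (poly q x * d x)) z = cauchy_int \<mu> I (\<lambda>x. poly (pCons a q) x * d x) z"
      proof -
        have "of_real a * cauchy_int \<mu> I d z + cauchy_int \<mu> I (\<lambda>x. x * (poly q x * d x)) z =
          (LINT x:I|\<mu>. of_real a * (of_real (d x) / (z - of_real x)) + of_real (x * (poly q x * d x)) / (z - of_real x))"
          unfolding cauchy_int_def using m z
          by (subst set_integral_mult_right[symmetric], intro set_integral_add(2)[symmetric] set_integrable_continuous_compact continuous_intros) auto
        also have "\<dots> = cauchy_int \<mu> I (\<lambda>x. poly (pCons a q) x * d x) z"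
          unfolding cauchy_int_def by (intro set_integral_cong_on) (simp add: algebra_simps add_divide_distrib)
        finally show ?thesis .
      qed
      finally show "poly (cpoly (pCons a q)) z * cauchy_int \<mu> I d z = cauchy_int \<mu> I (\<lambda>x. poly (pCons a q) x * d x) z + poly (cpoly (pCons M E)) z" .
    qed
  qed
  then show ?thesis using that by blast
qed

lemma eventually_notin_cset:
  assumes "compact I" shows "\<forall>\<^sub>F z in at_infinity. z \<notin> cset I"
proof -
  obtain M where M: "\<And>x. x \<in> I \<Longrightarrow> \<bar>x\<bar> \<le> M"
    using compact_continuous_norm_bound[OF assms, of "\<lambda>x. x"] by auto
  show ?thesis unfolding eventually_at_infinity
    by (intro exI[of _ "M + 1"]) (use M in force)
qed

lemma cauchy_int_eq_poly:
  assumes m: "sets \<mu> = sets borel" "finite_measure \<mu>" "compact I" "continuous_on I d"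
    and F: "\<And>z. z \<notin> cset I \<Longrightarrow> cauchy_int \<mu> I d z = poly F z"
  shows "F = 0"
proof (rule poly_tendsto_0_imp_0)
  have "\<forall>\<^sub>F z in at_infinity. cauchy_int \<mu> I d z = poly F z"
    using eventually_notin_cset[OF m(3)] by eventually_elim (rule F)
  from Lim_transform_eventually[OF cauchy_int_tendsto_0[OF m] this]
  show "(poly F \<longlongrightarrow> 0) at_infinity" .
qed

lemma const_sign_integral_nonzero:
  assumes h: "heavy_on I \<mu>" "compact I" "connected I" "continuous_on I d" "\<And>x. x \<in> I \<Longrightarrow> d x \<noteq> 0"
    and g: "continuous_on I g" "\<And>x. x \<in> I \<Longrightarrow> g x \<ge> 0" "finite {x\<in>I. g x = 0}"
  shows "(LINT x:I|\<mu>. g x * d x) \<noteq> (0::real)"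
proof -
  have "(\<forall>x\<in>I. 0 < d x) \<or> (\<forall>x\<in>I. d x < 0)" using connected_const_sign[OF h(3,4)] h(5) by blast
  then show ?thesis
  proof
    assume d: "\<forall>x\<in>I. 0 < d x"
    have "{x\<in>I. g x * d x = 0} = {x\<in>I. g x = 0}" using h(5) by auto
    then have "0 < (LINT x:I|\<mu>. g x * d x)"
      using h g d by (intro heavy_on_integral_pos continuous_intros) (auto simp: less_imp_le)
    then show ?thesis by simp
  next
    assume d: "\<forall>x\<in>I. d x < 0"
    have "{x\<in>I. g x * - d x = 0} = {x\<in>I. g x = 0}" using h(5) by auto
    then have "0 < (LINT x:I|\<mu>. g x * - d x)"
      using h g d by (intro heavy_on_integral_pos continuous_intros) (auto intro!: mult_nonneg_nonpos simp: less_imp_le)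
    then have "0 < - (LINT x:I|\<mu>. g x * d x)"
      using h g by (subst set_integral_uminus[symmetric]) (auto intro!: set_integrable_continuous_compact continuous_intros dest: heavy_onD)
    then show ?thesis by simp
  qed
qed

lemma const_sign_mass_nonzero:
  assumes "heavy_on I \<mu>" "compact I" "connected I" "continuous_on I d" "\<And>x. x \<in> I \<Longrightarrow> d x \<noteq> 0"
  shows "(LINT x:I|\<mu>. d x) \<noteq> (0::real)"
  using const_sign_integral_nonzero[OF assms, of "\<lambda>_. 1"] by simp

text \<open>
  Suppose \<open>C\<close> times the transform is a polynomial. Moving \<open>C\<close> inside the integral gives a transform that is a
  polynomial, hence zero because it vanishes at infinity. Moving \<open>C\<close> inside once more shows that the measure with
  weight \<open>C\<^sup>2 d\<close> has total mass zero, which its constant sign allows only for \<open>C = 0\<close>.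
\<close>
lemma cauchy_int_not_rational:
  assumes h: "heavy_on I \<mu>" "compact I" "connected I" "continuous_on I d" "\<And>x. x \<in> I \<Longrightarrow> d x \<noteq> 0"
    and eq: "\<And>z. z \<notin> cset I \<Longrightarrow> poly (cpoly C) z * cauchy_int \<mu> I d z = poly B z"
  shows "C = 0"
proof (rule ccontr)
  assume C: "C \<noteq> 0"
  note m = heavy_onD[OF h(1)] h(2,4)
  have Cd: "continuous_on I (\<lambda>x. poly C x * d x)" using h by (intro continuous_intros)
  have CCd: "continuous_on I (\<lambda>x. poly C x * (poly C x * d x))" using h by (intro continuous_intros)
  obtain E where E: "\<And>z. z \<notin> cset I \<Longrightarrow> poly (cpoly C) z * cauchy_int \<mu> I d z = cauchy_int \<mu> I (\<lambda>x. poly C x * d x) z + poly (cpoly E) z"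
    using poly_mult_cauchy_int[OF m, of C] by metis
  have e1: "cauchy_int \<mu> I (\<lambda>x. poly C x * d x) z = poly (B - cpoly E) z" if "z \<notin> cset I" for z
    using E[OF that] eq[OF that] by (simp add: algebra_simps)
  have "B - cpoly E = 0" by (rule cauchy_int_eq_poly[OF m(1-3) Cd e1])
  then have z1: "cauchy_int \<mu> I (\<lambda>x. poly C x * d x) z = 0" if "z \<notin> cset I" for z using e1[OF that] by simp
  obtain E' where E': "\<And>z. z \<notin> cset I \<Longrightarrow> poly (cpoly C) z * cauchy_int \<mu> I (\<lambda>x. poly C x * d x) z = cauchy_int \<mu> I (\<lambda>x. poly C x * (poly C x * d x)) z + poly (cpoly E') z"
    using poly_mult_cauchy_int[OF m(1-3) Cd, of C] by metis
  have e2: "cauchy_int \<mu> I (\<lambda>x. poly C x * (poly C x * d x)) z = poly (- cpoly E') z" if "z \<notin> cset I" for z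
    using E'[OF that] z1[OF that] by (simp add: algebra_simps eq_neg_iff_add_eq_0)
  have "- cpoly E' = 0" by (rule cauchy_int_eq_poly[OF m(1-3) CCd e2])
  then have z2: "cauchy_int \<mu> I (\<lambda>x. poly C x * (poly C x * d x)) z = 0" if "z \<notin> cset I" for z using e2[OF that] by simp
  have "((\<lambda>z. z * cauchy_int \<mu> I (\<lambda>x. poly C x * (poly C x * d x)) z) \<longlongrightarrow> 0) at_infinity"
    by (rule tendsto_eventually) (use eventually_notin_cset[OF m(3)] z2 in \<open>auto elim: eventually_mono\<close>)
  with cauchy_int_mult_z_tendsto[OF m(1-3) CCd] have "(LINT x:I|\<mu>. poly C x * (poly C x * d x)) = 0"
    using tendsto_unique[of at_infinity] by (metis (no_types, lifting) of_real_eq_0_iff trivial_limit_at_infinity)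
  moreover have "(LINT x:I|\<mu>. (poly C x)\<^sup>2 * d x) \<noteq> 0"
  proof (rule const_sign_integral_nonzero[OF h])
    have "{x \<in> I. (poly C x)\<^sup>2 = 0} \<subseteq> {x. poly C x = 0}" by auto
    then show "finite {x \<in> I. (poly C x)\<^sup>2 = 0}" using poly_roots_finite[OF C] by (rule finite_subset)
  qed (auto intro!: continuous_intros)
  ultimately show False by (simp add: power2_eq_square mult.assoc)
qed

lemma heavy_on_interval:
  assumes "heavy_on I \<mu>" "compact I" "connected I"
  obtains \<alpha> \<beta> where "\<alpha> < \<beta>" "I = {\<alpha>..\<beta>}"
proof -
  obtain a b where I: "I = {a..b}" using assms connected_compact_interval_1 by blast
  have "a < b"
  proof (rule ccontr)
    assume "\<not> a < b"
    then have "finite I" unfolding I by (cases "a = b") auto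
    then have "emeasure \<mu> (I - I) \<noteq> 0" using assms(1) by (auto simp: heavy_on_def)
    then show False by simp
  qed
  then show ?thesis using that I by blast
qed

text \<open>
  Cauchy-Schwarz for the probability measure proportional to \<open>d d\<mu>\<close>, in the form that the variance of the kernel
  \<open>1/(z - x)\<close> is nonnegative.
\<close>
lemma norm_cauchy_int_square_le:
  assumes m: "sets \<mu> = sets borel" "finite_measure \<mu>" "compact I" "continuous_on I d" "z \<notin> cset I"
    and d: "\<And>x. x \<in> I \<Longrightarrow> d x \<ge> 0" and m0: "(LINT x:I|\<mu>. d x) > 0"
  shows "(norm (cauchy_int \<mu> I d z))\<^sup>2 \<le> (LINT x:I|\<mu>. d x) * (LINT x:I|\<mu>. d x / (norm (z - of_real x))\<^sup>2)"
proof -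
  define M A where "M = (LINT x:I|\<mu>. d x)" and "A = (LINT x:I|\<mu>. d x / (norm (z - of_real x))\<^sup>2)"
  define u v where "u x = Re (1 / (z - of_real x))" and "v x = Im (1 / (z - of_real x))" for x
  have nz: "z - of_real x \<noteq> 0" if "x \<in> I" for x using m(5) that by auto
  have cu: "continuous_on I u" "continuous_on I v" unfolding u_def v_def using nz
    by (auto intro!: continuous_intros)
  have si: "set_integrable \<mu> I f" if "continuous_on I f" for f :: "real \<Rightarrow> real"
    using that m by (intro set_integrable_continuous_compact)
  define U V where "U = (LINT x:I|\<mu>. d x * u x)" and "V = (LINT x:I|\<mu>. d x * v x)"
  have ci: "set_integrable \<mu> I (\<lambda>x. complex_of_real (d x) / (z - of_real x))" using m by (intro cauchy_int_integrable)
  have "Re (cauchy_int \<mu> I d z) = (LINT x:I|\<mu>. Re (complex_of_real (d x) / (z - of_real x)))"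
    unfolding cauchy_int_def set_lebesgue_integral_def using ci unfolding set_integrable_def
    by (subst Bochner_Integration.integral_Re[symmetric]) auto
  then have U: "Re (cauchy_int \<mu> I d z) = U" unfolding U_def u_def by (simp add: divide_inverse)
  have "Im (cauchy_int \<mu> I d z) = (LINT x:I|\<mu>. Im (complex_of_real (d x) / (z - of_real x)))"
    unfolding cauchy_int_def by (intro Im_set_integral ci)
  then have V: "Im (cauchy_int \<mu> I d z) = V" unfolding V_def v_def by (simp add: divide_inverse)
  have uv: "(u x)\<^sup>2 + (v x)\<^sup>2 = 1 / (norm (z - of_real x))\<^sup>2" for x
    unfolding u_def v_def cmod_power2[symmetric] by (simp add: norm_divide power_divide)
  have "0 \<le> (LINT x:I|\<mu>. d x * ((u x - U / M)\<^sup>2 + (v x - V / M)\<^sup>2))"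
    unfolding set_lebesgue_integral_def by (intro integral_nonneg_AE AE_I2) (auto simp: indicator_def d)
  also have "\<dots> = (LINT x:I|\<mu>. d x / (norm (z - of_real x))\<^sup>2 + ((- 2 * (U/M)) * (d x * u x) + ((- 2 * (V/M)) * (d x * v x) + ((U/M)\<^sup>2 + (V/M)\<^sup>2) * d x)))"
  proof (rule set_integral_cong_on)
    fix x
    have "d x / (norm (z - of_real x))\<^sup>2 = d x * ((u x)\<^sup>2 + (v x)\<^sup>2)" by (simp add: uv)
    then show "d x * ((u x - U / M)\<^sup>2 + (v x - V / M)\<^sup>2) = d x / (norm (z - of_real x))\<^sup>2 + ((- 2 * (U/M)) * (d x * u x) + ((- 2 * (V/M)) * (d x * v x) + ((U/M)\<^sup>2 + (V/M)\<^sup>2) * d x))"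
      by (simp add: power2_eq_square algebra_simps)
  qed
  also have "\<dots> = A + ((- 2 * (U/M)) * U + ((- 2 * (V/M)) * V + ((U/M)\<^sup>2 + (V/M)\<^sup>2) * M))"
  proof -
    have i: "set_integrable \<mu> I (\<lambda>x. d x / (norm (z - of_real x))\<^sup>2)"
      using m nz by (intro si continuous_intros) auto
    have i2: "set_integrable \<mu> I (\<lambda>x. a * (d x * u x))" "set_integrable \<mu> I (\<lambda>x. a * (d x * v x))"
      "set_integrable \<mu> I (\<lambda>x. a * d x)" for a
      using m cu by (auto intro!: si continuous_intros)
    have "(LINT x:I|\<mu>. d x / (norm (z - of_real x))\<^sup>2 + ((- 2 * (U/M)) * (d x * u x) + ((- 2 * (V/M)) * (d x * v x) + ((U/M)\<^sup>2 + (V/M)\<^sup>2) * d x)))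
      = (LINT x:I|\<mu>. d x / (norm (z - of_real x))\<^sup>2) + ((LINT x:I|\<mu>. (- 2 * (U/M)) * (d x * u x)) + ((LINT x:I|\<mu>. (- 2 * (V/M)) * (d x * v x)) + (LINT x:I|\<mu>. ((U/M)\<^sup>2 + (V/M)\<^sup>2) * d x)))"
      by (simp only: set_integral_add i i2)
    then show ?thesis unfolding A_def U_def V_def M_def by (simp only: set_integral_mult_right)
  qed
  also have "\<dots> = A - (U\<^sup>2 + V\<^sup>2) / M"
    using m0 unfolding M_def[symmetric] by (simp add: power2_eq_square field_simps)
  finally have "U\<^sup>2 + V\<^sup>2 \<le> M * A" using m0 unfolding M_def[symmetric] by (simp add: field_simps)
  then show ?thesis by (simp add: cmod_power2 U V M_def A_def)
qed

text \<open>
  The reciprocal of \<open>c\<close> plus a Cauchy transform is again a Cauchy transform on the same interval, up to an affine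
  function: constant if \<open>c \<noteq> 0\<close>, of degree one if \<open>c = 0\<close>. The affine function is the polynomial part at infinity.
  After subtracting it, the difference has an imaginary part of one sign in the upper half plane (for \<open>c = 0\<close> by the
  Cauchy-Schwarz bound), so it has a Herglotz representation. If its measure were carried by finitely many points,
  the reciprocal would be rational, contrary to \<open>cauchy_int_not_rational\<close>.
\<close>
lemma reciprocal_of_cauchy_int:
  fixes c :: real
  assumes h: "heavy_on I \<mu>" "compact I" "connected I" "continuous_on I d" "\<And>x. x \<in> I \<Longrightarrow> d x \<noteq> 0"
    and nz: "\<And>z. z \<notin> cset I \<Longrightarrow> of_real c + cauchy_int \<mu> I d z \<noteq> 0"
  obtains \<tau> l0 l1 e where "heavy_on I \<tau>" "e \<noteq> (0::real)" "c \<noteq> 0 \<Longrightarrow> l1 = 0"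
    "\<And>z. z \<notin> cset I \<Longrightarrow> 1 / (of_real c + cauchy_int \<mu> I d z) = of_real l0 + of_real l1 * z + cauchy_int \<tau> I (\<lambda>_. e) z"
proof -
  note m = heavy_onD[OF h(1)] h(2,4)
  obtain \<alpha> \<beta> where ab: "\<alpha> < \<beta>" "I = {\<alpha>..\<beta>}" using heavy_on_interval[OF h(1-3)] .
  define \<phi> where "\<phi> z = of_real c + cauchy_int \<mu> I d z" for z
  have \<phi>nz: "\<phi> z \<noteq> 0" if "z \<notin> cset I" for z using nz that by (simp add: \<phi>_def)
  define m0 m1 where "m0 = (LINT x:I|\<mu>. d x)" and "m1 = (LINT x:I|\<mu>. x * d x)"
  have m0: "m0 \<noteq> 0" unfolding m0_def by (rule const_sign_mass_nonzero[OF h])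
  (* From \<phi> = c + m0/z + m1/z^2 + ...: these are the first two coefficients of 1/\<phi> at infinity. *)
  define l0 l1 where "l0 = (if c = 0 then - m1 / m0\<^sup>2 else 1 / c)" and "l1 = (if c = 0 then 1 / m0 else 0)"
  define s :: real where "s = (if m0 > 0 then 1 else -1)"
  have s: "s = 1 \<or> s = -1" "s * s = 1" by (auto simp: s_def)
  have sd: "s * d x > 0" if "x \<in> I" for x
  proof -
    have "(\<forall>x\<in>I. 0 < d x) \<or> (\<forall>x\<in>I. d x < 0)" using connected_const_sign[OF h(3,4)] h(5) by blast
    then show ?thesis
    proof
      assume d: "\<forall>x\<in>I. 0 < d x"
      then have "m0 \<ge> 0" unfolding m0_def set_lebesgue_integral_def
        by (intro integral_nonneg_AE AE_I2) (auto simp: indicator_def less_imp_le)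
      then show ?thesis using d that m0 by (simp add: s_def)
    next
      assume d: "\<forall>x\<in>I. d x < 0"
      then have "(LINT x:I|\<mu>. - d x) \<ge> 0" unfolding set_lebesgue_integral_def
        by (intro integral_nonneg_AE AE_I2) (auto simp: indicator_def less_imp_le)
      then have "m0 \<le> 0" unfolding m0_def
        by (subst (asm) set_integral_uminus) (auto intro!: set_integrable_continuous_compact m)
      then show ?thesis using d that m0 by (simp add: s_def)
    qed
  qed
  define g where "g z = of_real s * (of_real l0 + of_real l1 * z - 1 / \<phi> z)" for z
  have \<phi>hol: "\<phi> holomorphic_on - cset I" unfolding \<phi>_def
    by (intro holomorphic_intros cauchy_int_holomorphic[OF m])
  have ghol: "g holomorphic_on - cset I" unfolding g_def
    by (intro holomorphic_intros \<phi>hol) (use \<phi>nz in auto)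
  have gsym: "g (cnj z) = cnj (g z)" for z
    by (simp add: g_def \<phi>_def cauchy_int_cnj)
  have gpos: "Im (g z) \<le> 0" if z: "Im z > 0" for z
  proof -
    have zI: "z \<notin> cset I" using z by auto
    define A where "A = (LINT x:I|\<mu>. d x / (norm (z - of_real x))\<^sup>2)"
    have im: "Im (\<phi> z) = - Im z * A" using Im_cauchy_int[OF m zI] by (simp add: \<phi>_def A_def)
    have n0: "norm (\<phi> z) > 0" using \<phi>nz[OF zI] by simp
    have "Im (1 / \<phi> z) = - Im (\<phi> z) / (norm (\<phi> z))\<^sup>2" by (simp add: Im_divide cmod_power2)
    then have g: "Im (g z) = s * (l1 * Im z - Im z * A / (norm (\<phi> z))\<^sup>2)" by (simp add: g_def im)
    have sm: "(LINT x:I|\<mu>. s * d x) = s * m0" by (simp add: m0_def)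
    have sA: "(LINT x:I|\<mu>. s * d x / (norm (z - of_real x))\<^sup>2) = s * A"
      unfolding A_def by (simp only: set_integral_mult_right[symmetric] times_divide_eq_right)
    have smp: "s * m0 > 0" using m0 by (auto simp: s_def)
    have sAp: "s * A \<ge> 0" unfolding sA[symmetric] set_lebesgue_integral_def
      using sd by (intro integral_nonneg_AE AE_I2) (auto simp: indicator_def less_imp_le)
    show ?thesis
    proof (cases "c = 0")
      case False
      then show ?thesis using g z sAp n0 by (simp add: l1_def) (metis less_imp_le mult.commute mult.left_commute mult_nonneg_nonneg divide_nonneg_nonneg zero_le_power2)
    next
      case True
      have "(norm (cauchy_int \<mu> I (\<lambda>x. s * d x) z))\<^sup>2 \<le> (s * m0) * (s * A)"
        using norm_cauchy_int_square_le[of \<mu> I "\<lambda>x. s * d x" z] m zI sd smp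
        by (simp add: m0_def[symmetric] sA less_imp_le continuous_intros)
      moreover have "cauchy_int \<mu> I (\<lambda>x. s * d x) z = of_real s * \<phi> z"
        using True by (simp add: cauchy_int_def \<phi>_def mult.assoc flip: set_integral_mult_right)
      ultimately have "(norm (\<phi> z))\<^sup>2 \<le> (s * m0) * (s * A)"
        using s by (auto simp: norm_mult)
      then have "1 / (s * m0) \<le> s * A / (norm (\<phi> z))\<^sup>2" using smp n0 by (simp add: field_simps)
      moreover have "s * l1 = 1 / (s * m0)" using True s by (auto simp: l1_def)
      ultimately have "s * l1 - s * A / (norm (\<phi> z))\<^sup>2 \<le> 0" by simp
      then have "Im z * (s * l1 - s * A / (norm (\<phi> z))\<^sup>2) \<le> 0" using z by (simp add: mult_nonneg_nonpos)
      then show ?thesis using g by (simp add: algebra_simps)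
    qed
  qed
  have ginf: "(g \<longlongrightarrow> 0) at_infinity"
  proof (cases "c = 0")
    case False
    have "(g \<longlongrightarrow> of_real s * (of_real l0 + 0 - 1 / (of_real c + 0))) at_infinity"
      unfolding g_def \<phi>_def using False
      by (intro tendsto_intros cauchy_int_tendsto_0[OF m]) (auto simp: l1_def)
    then show ?thesis using False by (simp add: l0_def)
  next
    case True
    define r where "r = cauchy_int \<mu> I (\<lambda>x. x * d x)"
    have xd: "continuous_on I (\<lambda>x. x * d x)" using m by (intro continuous_intros)
    have r0: "(r \<longlongrightarrow> 0) at_infinity" unfolding r_def by (rule cauchy_int_tendsto_0[OF m(1-3) xd])
    have r1: "((\<lambda>z. z * r z) \<longlongrightarrow> of_real m1) at_infinity" unfolding r_def m1_def
      by (rule cauchy_int_mult_z_tendsto[OF m(1-3) xd])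
    have "((\<lambda>z. of_real s * (of_real l0 + z * r z / (of_real m0 * (of_real m0 + r z)))) \<longlongrightarrow> of_real s * (of_real l0 + of_real m1 / (of_real m0 * (of_real m0 + 0)))) at_infinity"
      using m0 by (intro tendsto_intros r0 r1) auto
    also have "of_real s * (of_real l0 + of_real m1 / (of_real m0 * (of_real m0 + 0))) = (0::complex)"
      using True m0 by (simp add: l0_def power2_eq_square)
    finally show ?thesis
    proof (rule Lim_transform_eventually)
      have "\<forall>\<^sub>F z::complex in at_infinity. norm z > 0" unfolding eventually_at_infinity by (intro exI[of _ 1]) auto
      with eventually_notin_cset[OF h(2)]
      show "\<forall>\<^sub>F z in at_infinity. of_real s * (of_real l0 + z * r z / (of_real m0 * (of_real m0 + r z))) = g z"
      proof eventually_elim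
        case (elim z)
        have e: "z * \<phi> z = of_real m0 + r z" using cauchy_int_mult_z[OF m elim(1)] True by (simp add: \<phi>_def m0_def r_def)
        have n: "of_real m0 + r z \<noteq> 0" using e \<phi>nz[OF elim(1)] elim(2) by (metis mult_eq_0_iff norm_zero less_irrefl)
        have "1 / \<phi> z = z / (of_real m0 + r z)" using e[symmetric] n elim \<phi>nz[OF elim(1)] by simp
        moreover have "z * r z / (of_real m0 * (of_real m0 + r z)) = of_real (1 / m0) * z - z / (of_real m0 + r z)"
          using n m0 by (simp add: divide_simps) (simp add: algebra_simps)
        ultimately show ?case using True by (simp add: g_def l1_def)
      qed
    qed
  qed
  obtain \<tau> where t: "sets \<tau> = sets borel" "finite_measure \<tau>" "\<And>z. z \<notin> cset I \<Longrightarrow> g z = cauchy_int \<tau> I (\<lambda>_. 1) z"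
    using herglotz_interval[OF ab(1), folded ab(2), OF ghol gsym gpos ginf] by blast
  have rep: "1 / \<phi> z = of_real l0 + of_real l1 * z + cauchy_int \<tau> I (\<lambda>_. - s) z" if z: "z \<notin> cset I" for z
  proof -
    have "cauchy_int \<tau> I (\<lambda>_. - s) z = (- of_real s) * cauchy_int \<tau> I (\<lambda>_. 1) z"
      unfolding cauchy_int_def set_integral_mult_right[symmetric] by simp
    also have "\<dots> = - (of_real (s * s) * (of_real l0 + of_real l1 * z - 1 / \<phi> z))"
      using t(3)[OF z] by (simp add: g_def)
    finally show ?thesis by (simp add: s)
  qed
  have "emeasure \<tau> (I - X) \<noteq> 0" if X: "finite X" for X
  proof
    assume null: "emeasure \<tau> (I - X) = 0"
    (* B kills the measure carried by X, so B/\<phi> is a polynomial C. *)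
    define B where "B = (\<Prod>x\<in>X. [:- x, 1:])"
    have B0: "B \<noteq> 0" using X by (auto simp: B_def prod_zero_iff)
    have Bx: "poly B x = 0" if "x \<in> X" for x using X that by (auto simp: B_def poly_prod prod_zero_iff)
    have cc: "continuous_on I (\<lambda>_. - s)" by (rule continuous_on_const)
    obtain E where E: "\<And>z. z \<notin> cset I \<Longrightarrow> poly (cpoly B) z * cauchy_int \<tau> I (\<lambda>_. - s) z = cauchy_int \<tau> I (\<lambda>x. poly B x * - s) z + poly (cpoly E) z"
      using poly_mult_cauchy_int[OF t(1,2) h(2) cc] by metis
    have Z: "cauchy_int \<tau> I (\<lambda>x. poly B x * - s) z = 0" for z
    proof -
      have "I - X \<in> sets \<tau>" using X h(2) t(1) by (auto intro!: sets.Diff simp: borel_closed compact_imp_closed finite_imp_closed)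
      then have "AE x in \<tau>. x \<notin> I - X" using null by (intro AE_not_in) (auto simp: null_sets_def)
      then have "AE x in \<tau>. indicator I x *\<^sub>R (of_real (poly B x * - s) / (z - of_real x)) = 0"
        by eventually_elim (auto simp: indicator_def Bx)
      then show ?thesis unfolding cauchy_int_def set_lebesgue_integral_def by (rule integral_eq_zero_AE)
    qed
    define C where "C = B * [:l0, l1:] + E"
    have C: "poly (cpoly B) z = poly (cpoly C) z * \<phi> z" if "z \<notin> cset I" for z
    proof -
      have "poly (cpoly B) z * (1 / \<phi> z) = poly (cpoly C) z"
        unfolding rep[OF that] using E[OF that] Z
        by (simp add: C_def cpoly_add cpoly_mult cpoly_smult cpoly_pCons algebra_simps)
      then show ?thesis using \<phi>nz[OF that] by (simp add: field_simps)
    qed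
    have "C = 0"
    proof (rule cauchy_int_not_rational[OF h])
      fix z assume "z \<notin> cset I"
      then show "poly (cpoly C) z * cauchy_int \<mu> I d z = poly (cpoly (B - smult c C)) z"
        using C by (simp add: \<phi>_def cpoly_diff cpoly_smult algebra_simps)
    qed
    moreover have "\<i> \<notin> cset I" by (auto simp: complex_eq_iff)
    ultimately have "poly (cpoly B) \<i> = 0" using C[of \<i>] by simp
    moreover have "poly (cpoly B) \<i> \<noteq> 0"
    proof -
      have "cpoly B = (\<Prod>x\<in>X. cpoly [:- x, 1:])" unfolding B_def by (rule cpoly_prod)
      moreover have "\<i> - complex_of_real x \<noteq> 0" for x
      proof
        assume "\<i> - complex_of_real x = 0"
        then have "Im (\<i> - complex_of_real x) = 0" by (simp only: zero_complex.sel)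
        then show False by simp
      qed
      ultimately show ?thesis using X by (simp add: poly_prod cpoly_pCons)
    qed
    ultimately show False by simp
  qed
  then have "heavy_on I \<tau>" using t by (simp add: heavy_on_def)
  then show ?thesis using that[of \<tau> "- s" l1 l0] rep s by (auto simp: \<phi>_def l1_def)
qed

section \<open>Cauchy transforms on disjoint cuts\<close>
definition real_cauchy_int :: "real measure \<Rightarrow> real set \<Rightarrow> (real \<Rightarrow> real) \<Rightarrow> real \<Rightarrow> real" where
  "real_cauchy_int \<mu> I d x = Re (cauchy_int \<mu> I d (of_real x))"

lemma cauchy_int_eq_real_cauchy_int: "cauchy_int \<mu> I d (of_real x) = of_real (real_cauchy_int \<mu> I d x)"
  by (simp add: real_cauchy_int_def cauchy_int_of_real)

lemma continuous_on_real_cauchy_int: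
  assumes m: "sets \<mu> = sets borel" "finite_measure \<mu>" "compact I" "continuous_on I d" and J: "J \<inter> I = {}"
  shows "continuous_on J (real_cauchy_int \<mu> I d)"
proof -
  have "continuous_on J (cauchy_int \<mu> I d \<circ> complex_of_real)"
  proof (intro continuous_on_compose continuous_on_of_real_id)
    have "cset J \<subseteq> - cset I" using J by auto
    then show "continuous_on (cset J) (cauchy_int \<mu> I d)"
      by (rule continuous_on_subset[OF holomorphic_on_imp_continuous_on[OF cauchy_int_holomorphic[OF m]]])
  qed
  then show ?thesis unfolding real_cauchy_int_def[abs_def] by (intro continuous_intros) (simp add: o_def)
qed

lemma cauchy_int_add:
  assumes m: "sets \<mu> = sets borel" "finite_measure \<mu>" "compact I" "continuous_on I d" "continuous_on I d'" "z \<notin> cset I"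
  shows "cauchy_int \<mu> I (\<lambda>x. d x + d' x) z = cauchy_int \<mu> I d z + cauchy_int \<mu> I d' z"
  unfolding cauchy_int_def using m
  by (subst set_integral_add(2)[symmetric]) (auto intro!: cauchy_int_integrable simp: add_divide_distrib)

lemma cauchy_int_cmult: "cauchy_int \<mu> I (\<lambda>x. c * d x) z = of_real c * cauchy_int \<mu> I d z"
  unfolding cauchy_int_def by (subst set_integral_mult_right[symmetric]) (simp add: mult.assoc)

lemma cauchy_int_lincomb:
  fixes a b c :: real
  assumes m: "sets \<mu> = sets borel" "finite_measure \<mu>" "compact I"
    and "continuous_on I d" "continuous_on I d'" "continuous_on I d''" "z \<notin> cset I"
  shows "cauchy_int \<mu> I (\<lambda>x. a * d x + b * d' x + c * d'' x) z =
    of_real a * cauchy_int \<mu> I d z + of_real b * cauchy_int \<mu> I d' z + of_real c * cauchy_int \<mu> I d'' z"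
proof -
  have c: "continuous_on I (\<lambda>x. a * d x)" "continuous_on I (\<lambda>x. b * d' x)" "continuous_on I (\<lambda>x. c * d'' x)"
    "continuous_on I (\<lambda>x. a * d x + b * d' x)"
    using assms by (auto intro!: continuous_intros)
  show ?thesis
    by (simp only: cauchy_int_add[OF m c(4,3) assms(7)] cauchy_int_add[OF m c(1,2) assms(7)] cauchy_int_cmult)
qed

text \<open>
  Partial fractions, \<open>1/((z-x)(z-y)) = 1/((z-x)(x-y)) + 1/((z-y)(y-x))\<close>, split the product of transforms on disjoint
  cuts into a sum of transforms on the two cuts, each weighted with the other transform.
\<close>
lemma cauchy_int_product:
  assumes m: "sets \<mu> = sets borel" "finite_measure \<mu>" "compact I" "continuous_on I d"
    and n: "sets \<nu> = sets borel" "finite_measure \<nu>" "compact J" "continuous_on J w"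
    and IJ: "I \<inter> J = {}" and z: "z \<notin> cset I" "z \<notin> cset J"
  shows "cauchy_int \<mu> I d z * cauchy_int \<nu> J w z =
    cauchy_int \<mu> I (\<lambda>x. d x * real_cauchy_int \<nu> J w x) z + cauchy_int \<nu> J (\<lambda>y. w y * real_cauchy_int \<mu> I d y) z"
proof -
  have nz: "x - y \<noteq> 0" "complex_of_real x - of_real y \<noteq> 0" if "x \<in> I" "y \<in> J" for x y using that IJ by auto
  have zx: "z - of_real x \<noteq> 0" if "x \<in> I" for x using z that by auto
  have zy: "z - of_real x \<noteq> 0" if "x \<in> J" for x using z that by auto
  have dw: "continuous_on (I \<times> J) (\<lambda>p. complex_of_real (d (fst p)))" "continuous_on (I \<times> J) (\<lambda>p. complex_of_real (w (snd p)))"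
    by (auto intro!: continuous_intros continuous_on_compose2[OF m(4)] continuous_on_compose2[OF n(4)])
  define A where "A x y = of_real (d x) / (z - of_real x) * (of_real (w y) / (of_real x - of_real y))" for x y
  define B where "B x y = of_real (w y) / (z - of_real y) * (of_real (d x) / (of_real y - of_real x))" for x y
  have nz': "complex_of_real y - of_real x \<noteq> 0" if "x \<in> I" "y \<in> J" for x y using nz(2)[OF that] by auto
  have cB: "continuous_on (I \<times> J) (\<lambda>p. B (fst p) (snd p))"
    unfolding B_def using dw nz' zy by (intro continuous_intros) auto
  have sy: "set_integrable \<nu> J f" if "continuous_on J f" for f :: "real \<Rightarrow> complex"
    using that n by (intro set_integrable_continuous_compact)
  have sx: "set_integrable \<mu> I f" if "continuous_on I f" for f :: "real \<Rightarrow> complex"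
    using that m by (intro set_integrable_continuous_compact)
  have Ay: "(LINT y:J|\<nu>. A x y) = of_real (d x * real_cauchy_int \<nu> J w x) / (z - of_real x)" for x
    unfolding A_def by (subst set_integral_mult_right) (simp add: cauchy_int_eq_real_cauchy_int[symmetric] cauchy_int_def)
  have Bx: "(LINT x:I|\<mu>. B x y) = of_real (w y * real_cauchy_int \<mu> I d y) / (z - of_real y)" for y
    unfolding B_def by (subst set_integral_mult_right) (simp add: cauchy_int_eq_real_cauchy_int[symmetric] cauchy_int_def)
  have cAx: "continuous_on J (A x)" if "x \<in> I" for x unfolding A_def using nz[OF that] n(4)
    by (intro continuous_intros) auto
  have cBx: "continuous_on J (B x)" if "x \<in> I" for x unfolding B_def using nz'[OF that] n(4) zy
    by (intro continuous_intros) auto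
  have cBy: "continuous_on I (\<lambda>x. (LINT y:J|\<nu>. B x y))"
  proof -
    have eq: "(LINT y:J|\<nu>. B x y) = of_real (d x) / (z - of_real x) * (cauchy_int \<nu> J w z - of_real (real_cauchy_int \<nu> J w x))" if x: "x \<in> I" for x
    proof -
      have xJ: "complex_of_real x \<notin> cset J" using x IJ by auto
      define L where "L = (LINT y:J|\<nu>. of_real (w y) / ((z - of_real y) * (of_real x - of_real y)))"
      have 1: "cauchy_int \<nu> J w z - of_real (real_cauchy_int \<nu> J w x) = - (z - of_real x) * L"
        unfolding L_def cauchy_int_eq_real_cauchy_int[symmetric] by (rule cauchy_int_diff[OF n z(2) xJ])
      have "(LINT y:J|\<nu>. B x y) = (LINT y:J|\<nu>. - of_real (d x) * (of_real (w y) / ((z - of_real y) * (of_real x - of_real y))))"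
        using nz(2)[OF x] nz'[OF x] zy by (intro set_integral_cong_on) (simp add: B_def divide_simps, simp add: algebra_simps)
      also have "\<dots> = - of_real (d x) * L" unfolding L_def by (rule set_integral_mult_right)
      finally show ?thesis unfolding 1 using zx[OF x] by (simp add: divide_simps) (simp add: algebra_simps)
    qed
    have "continuous_on I (\<lambda>x. of_real (d x) / (z - of_real x) * (cauchy_int \<nu> J w z - of_real (real_cauchy_int \<nu> J w x)))"
      using continuous_on_real_cauchy_int[OF n IJ] m(4) zx by (intro continuous_intros) auto
    then show ?thesis by (rule continuous_on_eq) (simp add: eq)
  qed
  have "cauchy_int \<mu> I d z * cauchy_int \<nu> J w z = (LINT x:I|\<mu>. of_real (d x) / (z - of_real x) * cauchy_int \<nu> J w z)"
    unfolding cauchy_int_def[of \<mu> I d z] by (rule set_integral_mult_left[symmetric])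
  also have "\<dots> = (LINT x:I|\<mu>. (LINT y:J|\<nu>. A x y) + (LINT y:J|\<nu>. B x y))"
  proof (rule set_integral_cong_on)
    fix x assume x: "x \<in> I"
    have "of_real (d x) / (z - of_real x) * cauchy_int \<nu> J w z = (LINT y:J|\<nu>. of_real (d x) / (z - of_real x) * (of_real (w y) / (z - of_real y)))"
      unfolding cauchy_int_def by (rule set_integral_mult_right[symmetric])
    also have "\<dots> = (LINT y:J|\<nu>. A x y + B x y)"
    proof (rule set_integral_cong_on)
      fix y assume y: "y \<in> J"
      have id: "1 / ((z - of_real x) * (z - of_real y)) = 1 / ((z - of_real x) * (of_real x - of_real y)) + 1 / ((z - of_real y) * (of_real y - complex_of_real x))"
        using zx[OF x] zy[OF y] nz(2)[OF x y] nz'[OF x y] by (simp add: divide_simps) (simp add: algebra_simps)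
      have "of_real (d x) / (z - of_real x) * (of_real (w y) / (z - of_real y)) = of_real (d x) * of_real (w y) * (1 / ((z - of_real x) * (z - of_real y)))" by simp
      also have "\<dots> = A x y + B x y" unfolding id A_def B_def by (simp add: algebra_simps)
      finally show "of_real (d x) / (z - of_real x) * (of_real (w y) / (z - of_real y)) = A x y + B x y" .
    qed
    also have "\<dots> = (LINT y:J|\<nu>. A x y) + (LINT y:J|\<nu>. B x y)"
      by (intro set_integral_add(2) sy cAx cBx x)
    finally show "of_real (d x) / (z - of_real x) * cauchy_int \<nu> J w z = (LINT y:J|\<nu>. A x y) + (LINT y:J|\<nu>. B x y)" .
  qed
  also have "\<dots> = (LINT x:I|\<mu>. LINT y:J|\<nu>. A x y) + (LINT x:I|\<mu>. LINT y:J|\<nu>. B x y)"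
  proof (intro set_integral_add(2) sx cBy)
    show "continuous_on I (\<lambda>x. LINT y:J|\<nu>. A x y)" unfolding Ay
      using continuous_on_real_cauchy_int[OF n IJ] m(4) zx by (intro continuous_intros) auto
  qed
  also have "(LINT x:I|\<mu>. LINT y:J|\<nu>. B x y) = (LINT y:J|\<nu>. LINT x:I|\<mu>. B x y)"
    by (rule set_fubini_continuous[OF m(1-3) n(1-3) cB])
  finally show ?thesis unfolding Ay Bx cauchy_int_def .
qed

text \<open>
  If the weights \<open>dk\<close> and \<open>dj\<close> on \<open>I\<close> have as ratio the boundary values of a function \<open>r\<close> that is holomorphic across \<open>I\<close>,
  then subtracting \<open>r\<close> times the transform of \<open>dj\<close> from that of \<open>dk\<close> removes the singularities on \<open>I\<close>. What remains
  lives on the cut \<open>J\<close> of \<open>r\<close>. This is one step of Gaussian elimination.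
\<close>
lemma eliminate_first_cut:
  fixes pk pj q0 q1 :: real
  assumes m: "sets \<mu> = sets borel" "finite_measure \<mu>" "compact I" "continuous_on I dj" "continuous_on I dk"
    and n: "sets \<nu> = sets borel" "finite_measure \<nu>" "compact J" "continuous_on J w"
    and IJ: "I \<inter> J = {}" and z: "z \<notin> cset I" "z \<notin> cset J"
    and dk: "\<And>x. x \<in> I \<Longrightarrow> dk x = dj x * (q0 + q1 * x + real_cauchy_int \<nu> J w x)"
  shows "(of_real pk + cauchy_int \<mu> I dk z) - (of_real pj + cauchy_int \<mu> I dj z) * (of_real q0 + of_real q1 * z + cauchy_int \<nu> J w z)
    = of_real (pk - pj * q0 - q1 * (LINT x:I|\<mu>. dj x)) - of_real (pj * q1) * z
       + cauchy_int \<nu> J (\<lambda>y. - w y * (pj + real_cauchy_int \<mu> I dj y)) z"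
proof -
  note m' = m(1-4)
  have cw: "continuous_on I (real_cauchy_int \<nu> J w)" by (rule continuous_on_real_cauchy_int[OF n IJ])
  have cd: "continuous_on J (real_cauchy_int \<mu> I dj)" using IJ by (intro continuous_on_real_cauchy_int[OF m']) auto
  have c: "continuous_on I (\<lambda>x. x * dj x)" "continuous_on I (\<lambda>x. dj x * real_cauchy_int \<nu> J w x)"
    "continuous_on J (\<lambda>y. w y * real_cauchy_int \<mu> I dj y)"
    using m n cw cd by (auto intro!: continuous_intros)
  have "cauchy_int \<mu> I dk z = cauchy_int \<mu> I (\<lambda>x. q0 * dj x + q1 * (x * dj x) + 1 * (dj x * real_cauchy_int \<nu> J w x)) z"
    by (rule cauchy_int_cong) (simp add: dk algebra_simps)
  also have "\<dots> = of_real q0 * cauchy_int \<mu> I dj z + of_real q1 * cauchy_int \<mu> I (\<lambda>x. x * dj x) z + of_real 1 * cauchy_int \<mu> I (\<lambda>x. dj x * real_cauchy_int \<nu> J w x) z"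
    by (rule cauchy_int_lincomb[OF m(1-4) c(1,2) z(1)])
  finally have 1: "cauchy_int \<mu> I dk z = of_real q0 * cauchy_int \<mu> I dj z + of_real q1 * cauchy_int \<mu> I (\<lambda>x. x * dj x) z + cauchy_int \<mu> I (\<lambda>x. dj x * real_cauchy_int \<nu> J w x) z"
    by simp
  have "cauchy_int \<nu> J (\<lambda>y. - w y * (pj + real_cauchy_int \<mu> I dj y)) z = cauchy_int \<nu> J (\<lambda>y. (- pj) * w y + 0 * w y + (- 1) * (w y * real_cauchy_int \<mu> I dj y)) z"
    by (rule cauchy_int_cong) (simp add: algebra_simps)
  also have "\<dots> = of_real (- pj) * cauchy_int \<nu> J w z + of_real 0 * cauchy_int \<nu> J w z + of_real (- 1) * cauchy_int \<nu> J (\<lambda>y. w y * real_cauchy_int \<mu> I dj y) z"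
    by (rule cauchy_int_lincomb[OF n n(4) c(3) z(2)])
  finally have 2: "cauchy_int \<nu> J (\<lambda>y. - w y * (pj + real_cauchy_int \<mu> I dj y)) z = - of_real pj * cauchy_int \<nu> J w z - cauchy_int \<nu> J (\<lambda>y. w y * real_cauchy_int \<mu> I dj y) z"
    by simp
  let ?a = "cauchy_int \<mu> I dj z" and ?b = "cauchy_int \<nu> J w z"
  have p: "?a * ?b = cauchy_int \<mu> I (\<lambda>x. dj x * real_cauchy_int \<nu> J w x) z + cauchy_int \<nu> J (\<lambda>y. w y * real_cauchy_int \<mu> I dj y) z"
    by (rule cauchy_int_product[OF m' n IJ z])
  have q: "cauchy_int \<mu> I (\<lambda>x. x * dj x) z = z * ?a - of_real (LINT x:I|\<mu>. dj x)"
    using cauchy_int_mult_z[OF m' z(1)] by simp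
  have "(of_real pj + ?a) * (of_real q0 + of_real q1 * z + ?b) = of_real pj * (of_real q0 + of_real q1 * z + ?b) + of_real q0 * ?a + of_real q1 * (z * ?a) + ?a * ?b"
    by (simp add: algebra_simps)
  then show ?thesis unfolding 1 2 p q by (simp add: algebra_simps)
qed

text \<open>
  The companion for quotients: here a function with weight \<open>w\<close> on the cut \<open>J\<close> is added to the product of a function with weight
  \<open>u\<close> on \<open>J\<close> and one with cut \<open>I\<close>. When the product has the weight \<open>-w\<close> on \<open>J\<close>, only the cut \<open>I\<close> remains.
\<close>
lemma eliminate_second_cut:
  fixes P q0 q1 l0 l1 e :: real
  assumes t: "sets \<tau> = sets borel" "finite_measure \<tau>" "compact I"
    and n: "sets \<nu> = sets borel" "finite_measure \<nu>" "compact J" "continuous_on J w" "continuous_on J u"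
    and IJ: "I \<inter> J = {}" and z: "z \<notin> cset I" "z \<notin> cset J"
    and u: "\<And>y. y \<in> J \<Longrightarrow> u y * (l0 + l1 * y + real_cauchy_int \<tau> I (\<lambda>_. e) y) = - w y"
  shows "of_real q0 + of_real q1 * z + cauchy_int \<nu> J w z + (of_real P + cauchy_int \<nu> J u z) * (of_real l0 + of_real l1 * z + cauchy_int \<tau> I (\<lambda>_. e) z)
    = of_real (q0 + P * l0 + l1 * (LINT y:J|\<nu>. u y)) + of_real (q1 + P * l1) * z
       + cauchy_int \<tau> I (\<lambda>x. e * (P + real_cauchy_int \<nu> J u x)) z"
proof -
  have JI: "J \<inter> I = {}" using IJ by auto
  have ec: "continuous_on I (\<lambda>_. e)" by (rule continuous_on_const)
  have cu: "continuous_on I (real_cauchy_int \<nu> J u)" by (rule continuous_on_real_cauchy_int[OF n(1-3,5) IJ])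
  have ce: "continuous_on J (real_cauchy_int \<tau> I (\<lambda>_. e))" by (rule continuous_on_real_cauchy_int[OF t ec JI])
  have c: "continuous_on J (\<lambda>y. y * u y)" "continuous_on J (\<lambda>y. u y * real_cauchy_int \<tau> I (\<lambda>_. e) y)"
    "continuous_on I (\<lambda>x. e * real_cauchy_int \<nu> J u x)"
    using n ce cu by (auto intro!: continuous_intros)
  have "cauchy_int \<nu> J w z = cauchy_int \<nu> J (\<lambda>y. (- l0) * u y + (- l1) * (y * u y) + (- 1) * (u y * real_cauchy_int \<tau> I (\<lambda>_. e) y)) z"
    by (rule cauchy_int_cong) (use u in \<open>force simp: algebra_simps\<close>)
  also have "\<dots> = of_real (- l0) * cauchy_int \<nu> J u z + of_real (- l1) * cauchy_int \<nu> J (\<lambda>y. y * u y) z + of_real (- 1) * cauchy_int \<nu> J (\<lambda>y. u y * real_cauchy_int \<tau> I (\<lambda>_. e) y) z"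
    by (rule cauchy_int_lincomb[OF n(1-3,5) c(1,2) z(2)])
  finally have 1: "cauchy_int \<nu> J w z = - of_real l0 * cauchy_int \<nu> J u z - of_real l1 * cauchy_int \<nu> J (\<lambda>y. y * u y) z - cauchy_int \<nu> J (\<lambda>y. u y * real_cauchy_int \<tau> I (\<lambda>_. e) y) z"
    by simp
  have "cauchy_int \<tau> I (\<lambda>x. e * (P + real_cauchy_int \<nu> J u x)) z = cauchy_int \<tau> I (\<lambda>x. P * e + 0 * e + 1 * (e * real_cauchy_int \<nu> J u x)) z"
    by (rule cauchy_int_cong) (simp add: algebra_simps)
  also have "\<dots> = of_real P * cauchy_int \<tau> I (\<lambda>_. e) z + of_real 0 * cauchy_int \<tau> I (\<lambda>_. e) z + of_real 1 * cauchy_int \<tau> I (\<lambda>x. e * real_cauchy_int \<nu> J u x) z"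
    by (rule cauchy_int_lincomb[OF t ec ec c(3) z(1)])
  finally have 2: "cauchy_int \<tau> I (\<lambda>x. e * (P + real_cauchy_int \<nu> J u x)) z = of_real P * cauchy_int \<tau> I (\<lambda>_. e) z + cauchy_int \<tau> I (\<lambda>x. e * real_cauchy_int \<nu> J u x) z"
    by simp
  let ?a = "cauchy_int \<nu> J u z" and ?b = "cauchy_int \<tau> I (\<lambda>_. e) z"
  have p: "?a * ?b = cauchy_int \<nu> J (\<lambda>y. u y * real_cauchy_int \<tau> I (\<lambda>_. e) y) z + cauchy_int \<tau> I (\<lambda>x. e * real_cauchy_int \<nu> J u x) z"
    by (rule cauchy_int_product[OF n(1-3,5) t ec JI z(2,1)])
  have q: "cauchy_int \<nu> J (\<lambda>y. y * u y) z = z * ?a - of_real (LINT y:J|\<nu>. u y)"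
    using cauchy_int_mult_z[OF n(1-3,5) z(2)] by simp
  have "(of_real P + ?a) * (of_real l0 + of_real l1 * z + ?b) = of_real P * (of_real l0 + of_real l1 * z + ?b) + of_real l0 * ?a + of_real l1 * (z * ?a) + ?a * ?b"
    by (simp add: algebra_simps)
  then show ?thesis unfolding 1 2 p q by (simp add: algebra_simps)
qed

section \<open>Ratios of minors\<close>
lemma nonreal_notin: "Im z \<noteq> 0 \<Longrightarrow> z \<notin> cset I"
  by auto

lemma nonreal_within_nontrivial: "at z within {w. Im w \<noteq> 0} \<noteq> bot"
proof -
  have "z islimpt {w. Im w \<noteq> 0}"
  proof (rule islimpt_approachable[THEN iffD2], intro allI impI)
    fix e :: real assume e: "e > 0"
    define s where "s = (if Im z \<ge> 0 then 1 else - 1 :: real)"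
    have "z + of_real (s * e / 2) * \<i> \<in> {w. Im w \<noteq> 0}" "z + of_real (s * e / 2) * \<i> \<noteq> z"
      "dist (z + of_real (s * e / 2) * \<i>) z < e"
      using e by (auto simp: s_def dist_norm norm_mult complex_eq_iff)
    then show "\<exists>x'\<in>{w. Im w \<noteq> 0}. x' \<noteq> z \<and> dist x' z < e" by blast
  qed
  then show ?thesis by (simp add: trivial_limit_within)
qed

lemma nonreal_isCont_eq:
  fixes f g :: "complex \<Rightarrow> complex"
  assumes "isCont f z" "isCont g z" and eq: "\<And>w. Im w \<noteq> 0 \<Longrightarrow> f w = g w"
  shows "f z = g z"
proof -
  let ?F = "at z within {w. Im w \<noteq> 0}"
  have f: "(f \<longlongrightarrow> f z) ?F" and g: "(g \<longlongrightarrow> g z) ?F"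
    using assms(1,2) unfolding isCont_def by (auto intro: tendsto_within_subset)
  have "(f \<longlongrightarrow> g z) ?F"
    by (rule Lim_transform_eventually[OF g]) (auto simp: eventually_at_filter eq)
  with f show ?thesis using tendsto_unique nonreal_within_nontrivial by blast
qed

text \<open>
  Identities between minors are available first at nonreal points, where all functions are defined. The value at a
  real point off the cut is the limit from nonreal points, so that representations extend there automatically.
\<close>
definition real_ext :: "(complex \<Rightarrow> complex) \<Rightarrow> complex \<Rightarrow> complex" where
  "real_ext f z = (if Im z \<noteq> 0 then f z else Lim (at z within {w. Im w \<noteq> 0}) f)"

lemma real_ext_eq:
  assumes "isCont g z" and eq: "\<And>w. Im w \<noteq> 0 \<Longrightarrow> f w = g w"
  shows "real_ext f z = g z"
proof (cases "Im z = 0")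
  case True
  let ?F = "at z within {w. Im w \<noteq> 0}"
  have g: "(g \<longlongrightarrow> g z) ?F"
    using assms(1) unfolding isCont_def by (auto intro: tendsto_within_subset)
  have "(f \<longlongrightarrow> g z) ?F"
    by (rule Lim_transform_eventually[OF g]) (auto simp: eventually_at_filter eq)
  then show ?thesis using True nonreal_within_nontrivial by (simp add: real_ext_def tendsto_Lim)
qed (simp add: real_ext_def eq)

lemma isCont_cauchy_int:
  assumes "sets \<mu> = sets borel" "finite_measure \<mu>" "compact I" "continuous_on I d" "z \<notin> cset I"
  shows "isCont (cauchy_int \<mu> I d) z"
  using cauchy_int_has_field_derivative[OF assms] by (rule DERIV_isCont)

text \<open>
  The analytic description of the functions \<open>R S k j\<close> for fixed \<open>S\<close> and \<open>j\<close>. They share a cut, the interval with index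
  \<open>a + card S + 1\<close>, and a measure \<open>\<mu>\<close> on it. Call an index small if it is at most \<open>a + card S\<close> and large otherwise.
  The functions grow at infinity like the determinants they stand for: a large index over a small one gives a
  pure Cauchy transform, a small one over a large one has an affine part, and two indices of the same kind
  give a bounded function. The last clause says that the weights on the cut are in the ratio of the functions
  with \<open>j\<close> added to the set of columns, which are themselves holomorphic across this cut; it is what makes
  inductions over the columns possible.
\<close>
definition cut_rep ::
  "(nat \<Rightarrow> real set) \<Rightarrow> nat \<Rightarrow> nat \<Rightarrow> (nat set \<Rightarrow> nat \<Rightarrow> nat \<Rightarrow> complex \<Rightarrow> complex) \<Rightarrow> nat set \<Rightarrow> nat \<Rightarrow>
    real measure \<Rightarrow> (nat \<Rightarrow> real \<Rightarrow> real) \<Rightarrow> (nat \<Rightarrow> real) \<Rightarrow> (nat \<Rightarrow> real) \<Rightarrow> bool" where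
  "cut_rep I a m R S j \<mu> d p0 p1 \<longleftrightarrow> heavy_on (I (Suc (a + card S))) \<mu> \<and>
    (\<forall>k\<in>{a..m} - insert j S.
       continuous_on (I (Suc (a + card S))) (d k) \<and> (\<forall>x\<in>I (Suc (a + card S)). d k x \<noteq> 0) \<and>
       (\<forall>z. z \<notin> cset (I (Suc (a + card S))) \<longrightarrow>
          R S k j z = of_real (p0 k) + of_real (p1 k) * z + cauchy_int \<mu> (I (Suc (a + card S))) (d k) z) \<and>
       (j \<le> a + card S \<longrightarrow> a + card S < k \<longrightarrow> p0 k = 0 \<and> p1 k = 0) \<and>
       ((k \<le> a + card S \<longrightarrow> j \<le> a + card S) \<longrightarrow> p1 k = 0) \<and>
       (\<forall>l\<in>{a..m} - insert j S. \<forall>x\<in>I (Suc (a + card S)).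
          R (insert j S) k l (of_real x) = of_real (d k x / d l x)))"

text \<open>
  Let \<open>T S\<close> be the determinant of rows \<open>a, \<dots>, a + card S - 1\<close> and columns \<open>S\<close> of the matrix whose row \<open>i\<close> is zero before
  column \<open>i\<close>, one in column \<open>i\<close>, and has the entries \<open>s\<close>-hat with indices \<open>i+1, k\<close> in the columns \<open>k > i\<close>. Up to sign,
  \<open>R S k j\<close> stands for \<open>T (S \<union> {k}) / T (S \<union> {j})\<close>. Only these quotients matter, and the two algebraic clauses
  (quotients compose, and the three-term Pluecker relation) characterise them well enough that
  no determinant has to be written down.
\<close>
definition minor_family ::
  "(nat \<Rightarrow> real set) \<Rightarrow> nat \<Rightarrow> nat \<Rightarrow> (nat set \<Rightarrow> nat \<Rightarrow> nat \<Rightarrow> complex \<Rightarrow> complex) \<Rightarrow> bool" where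
  "minor_family I a m R \<longleftrightarrow>
    (\<forall>S k z. R S k k z = 1) \<and>
    (\<forall>S k j i z. S \<subseteq> {a..m} \<and> k \<in> {a..m} - S \<and> j \<in> {a..m} - S \<and> i \<in> {a..m} - S \<and> Im z \<noteq> 0 \<longrightarrow>
       R S k j z * R S j i z = R S k i z) \<and>
    (\<forall>S k j i z. S \<subseteq> {a..m} \<and> k \<in> {a..m} - S \<and> j \<in> {a..m} - S \<and> i \<in> {a..m} - S \<and>
       k \<noteq> j \<and> j \<noteq> i \<and> k \<noteq> i \<and> Im z \<noteq> 0 \<longrightarrow>
       R S k j z = R S i j z * R (insert j S) k i z + R (insert i S) k j z) \<and>
    (\<forall>S j. S \<subseteq> {a..m} \<and> j \<in> {a..m} - S \<and> {a..m} - insert j S \<noteq> {} \<longrightarrow>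
       (\<exists>\<mu> d p0 p1. cut_rep I a m R S j \<mu> d p0 p1))"

lemma affine_plus_vanishing_limit:
  fixes c0 c1 :: real and g :: "complex \<Rightarrow> complex" and L :: complex
  assumes g: "(g \<longlongrightarrow> 0) at_infinity" and "((\<lambda>z. of_real c0 + of_real c1 * z + g z) \<longlongrightarrow> L) at_infinity"
  shows "c1 = 0" "of_real c0 = L"
proof -
  have "((\<lambda>z. of_real c0 + of_real c1 * z + g z - g z - L) \<longlongrightarrow> L - 0 - L) at_infinity"
    by (intro tendsto_intros assms)
  moreover have "poly [:of_real c0 - L, of_real c1:] = (\<lambda>z. of_real c0 + of_real c1 * z + g z - g z - L)"
    by (simp add: fun_eq_iff algebra_simps)
  ultimately have "(poly [:of_real c0 - L, of_real c1:] \<longlongrightarrow> 0) at_infinity" by simp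
  from poly_tendsto_0_imp_0[OF this] show "c1 = 0" "of_real c0 = L" by auto
qed

section \<open>Elimination of one row\<close>

text \<open>
  One step of the induction over the rows of the matrix, from the bottom up: \<open>R\<close> belongs to rows \<open>a+1, \<dots>, m\<close>, and the
  row \<open>a\<close> to be added has the entry one in column \<open>a\<close> and the transforms of \<open>w k d\<mu>0\<close> on the interval with index \<open>a+1\<close>
  in the columns \<open>k > a\<close>. The Nikishin structure enters through the last assumption: the ratios of the weights are
  the ratios of the entries of the row below.
\<close>
locale tower_step =
  fixes I :: "nat \<Rightarrow> real set" and a m :: nat
    and R :: "nat set \<Rightarrow> nat \<Rightarrow> nat \<Rightarrow> complex \<Rightarrow> complex"
    and w :: "nat \<Rightarrow> real \<Rightarrow> real" and \<mu>0 :: "real measure"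
  assumes am: "a < m"
    and I: "\<And>i. a < i \<Longrightarrow> i \<le> m \<Longrightarrow> compact (I i)" "\<And>i. a < i \<Longrightarrow> i \<le> m \<Longrightarrow> connected (I i)"
    and disj: "\<And>i. a < i \<Longrightarrow> i < m \<Longrightarrow> I i \<inter> I (Suc i) = {}"
    and tail: "minor_family I (Suc a) m R"
    and \<mu>0: "heavy_on (I (Suc a)) \<mu>0"
    and w: "\<And>k. k \<in> {Suc a..m} \<Longrightarrow> continuous_on (I (Suc a)) (w k)"
      "\<And>k x. k \<in> {Suc a..m} \<Longrightarrow> x \<in> I (Suc a) \<Longrightarrow> w k x \<noteq> 0"
      "\<And>k l x. k \<in> {Suc a..m} \<Longrightarrow> l \<in> {Suc a..m} \<Longrightarrow> x \<in> I (Suc a) \<Longrightarrow>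
         R {} k l (of_real x) = of_real (w k x / w l x)"
begin

abbreviation b :: nat where "b \<equiv> Suc a"

text \<open>
  The entry of row \<open>a\<close> in column \<open>k\<close> after column \<open>k\<close> has been reduced by the columns in \<open>S\<close> so that its entries in the
  \<open>card S\<close> rows below vanish;
  by Cramer's rule the coefficients are ratios of minors of those rows. Up to sign and a factor
  independent of \<open>k\<close>, it is the minor with columns \<open>S \<union> {k}\<close>.
\<close>
definition row :: "nat set \<Rightarrow> nat \<Rightarrow> complex \<Rightarrow> complex" where
  "row S k z = (if k = a then 1 else cauchy_int \<mu>0 (I b) (w k) z -
     (\<Sum>i\<in>S. cauchy_int \<mu>0 (I b) (w i) z * R (S - {i}) k i z))"

lemma tail_one: "R S k k z = 1"
  using tail by (simp add: minor_family_def)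

lemma tail_trans:
  assumes "S \<subseteq> {b..m}" "k \<in> {b..m} - S" "j \<in> {b..m} - S" "i \<in> {b..m} - S" "Im z \<noteq> 0"
  shows "R S k j z * R S j i z = R S k i z"
  by (rule tail[unfolded minor_family_def, THEN conjunct2, THEN conjunct1, rule_format])
    (intro conjI assms)

lemma tail_pluecker:
  assumes "S \<subseteq> {b..m}" "k \<in> {b..m} - S" "j \<in> {b..m} - S" "i \<in> {b..m} - S" "k \<noteq> j" "j \<noteq> i" "k \<noteq> i" "Im z \<noteq> 0"
  shows "R S k j z = R S i j z * R (insert j S) k i z + R (insert i S) k j z"
  by (rule tail[unfolded minor_family_def, THEN conjunct2, THEN conjunct2, THEN conjunct1, rule_format])
    (intro conjI assms)

lemma tail_rep:
  assumes "S \<subseteq> {b..m}" "j \<in> {b..m} - S" "{b..m} - insert j S \<noteq> {}"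
  obtains \<mu> d p0 p1 where "cut_rep I b m R S j \<mu> d p0 p1"
proof -
  have "\<exists>\<mu> d p0 p1. cut_rep I b m R S j \<mu> d p0 p1"
    by (rule tail[unfolded minor_family_def, THEN conjunct2, THEN conjunct2, THEN conjunct2, rule_format])
      (intro conjI assms)
  then show ?thesis using that by blast
qed

text \<open>
  Eliminating one more column subtracts a multiple of the entry in that column; for the sums in the definition this is
  the Pluecker relation of the tail.
\<close>
lemma row_insert:
  assumes S: "S \<subseteq> {b..m}" and j: "j \<in> {b..m} - S" and k: "k \<in> {b..m} - S" "k \<noteq> j" and z: "Im z \<noteq> 0"
  shows "row (insert j S) k z = row S k z - row S j z * R S k j z"
proof -
  have fin: "finite S" using S finite_subset by blast
  let ?f = "\<lambda>k. cauchy_int \<mu>0 (I b) (w k) z"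
  have ka: "k \<noteq> a" "j \<noteq> a" using j k by auto
  have "(\<Sum>i\<in>insert j S. ?f i * R (insert j S - {i}) k i z) =
      ?f j * R S k j z + (\<Sum>i\<in>S. ?f i * R (insert j S - {i}) k i z)"
    using j fin by simp
  also have "(\<Sum>i\<in>S. ?f i * R (insert j S - {i}) k i z) =
     (\<Sum>i\<in>S. ?f i * R (S - {i}) k i z - ?f i * R (S - {i}) j i z * R S k j z)"
  proof (rule sum.cong[OF refl])
    fix i assume i: "i \<in> S"
    have "R (S - {i}) k i z = R (S - {i}) j i z * R (insert i (S - {i})) k j z + R (insert j (S - {i})) k i z"
      using S i j k z by (intro tail_pluecker) auto
    moreover have "insert i (S - {i}) = S" "insert j (S - {i}) = insert j S - {i}" using i j by auto
    ultimately show "?f i * R (insert j S - {i}) k i z = ?f i * R (S - {i}) k i z - ?f i * R (S - {i}) j i z * R S k j z"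
      by (simp add: algebra_simps)
  qed
  also have "\<dots> = (\<Sum>i\<in>S. ?f i * R (S - {i}) k i z) - (\<Sum>i\<in>S. ?f i * R (S - {i}) j i z) * R S k j z"
    by (simp add: sum_subtractf sum_distrib_right)
  finally show ?thesis using ka by (simp add: row_def algebra_simps)
qed

text \<open>
  The analogue of \<open>cut_rep\<close> for the reduced rows: adding a column to \<open>S\<close> moves the cut to the next interval, and only
  the columns with small index carry a constant at infinity.
\<close>
definition row_rep :: "nat set \<Rightarrow> real measure \<Rightarrow> (nat \<Rightarrow> real \<Rightarrow> real) \<Rightarrow> (nat \<Rightarrow> real) \<Rightarrow> bool" where
  "row_rep S \<mu> d p \<longleftrightarrow> heavy_on (I (b + card S)) \<mu> \<and>
    (\<forall>k\<in>{b..m} - S.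
      continuous_on (I (b + card S)) (d k) \<and> (\<forall>x\<in>I (b + card S). d k x \<noteq> 0) \<and>
      (\<forall>z. Im z \<noteq> 0 \<longrightarrow> row S k z = of_real (p k) + cauchy_int \<mu> (I (b + card S)) (d k) z) \<and>
      (a + card S < k \<longrightarrow> p k = 0) \<and>
      (\<forall>l\<in>{b..m} - S. \<forall>x\<in>I (b + card S). R S k l (of_real x) = of_real (d k x / d l x)))"

lemma card_less:
  assumes "S \<subseteq> {b..m}" "{b..m} - S \<noteq> {}"
  shows "b + card S \<le> m"
proof -
  have "S \<subset> {b..m}" using assms by auto
  then have "card S < card {b..m}" by (intro psubset_card_mono) auto
  then show ?thesis using am by auto
qed

lemma cut_ok:
  assumes "S \<subseteq> {b..m}" "{b..m} - S \<noteq> {}"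
  shows "compact (I (b + card S))" "connected (I (b + card S))"
  using I card_less[OF assms] by auto

text \<open>
  Induction step: on the present cut the ratio of the weights in the columns \<open>k\<close> and \<open>j\<close> is \<open>R S k j\<close>, so eliminating column
  \<open>j\<close> removes this cut and leaves the next one, on which \<open>R S k j\<close> has its singularities. The new weights do not
  vanish because the reduced entry in column \<open>j\<close> has no zeros off the present cut.
\<close>
lemma row_rep_insert:
  assumes S: "S \<subseteq> {b..m}" and j: "j \<in> {b..m} - S" and ne: "{b..m} - insert j S \<noteq> {}"
    and rr: "row_rep S \<mu> d p" and cr: "cut_rep I b m R S j \<nu> v q0 q1"
    and nz: "\<And>z. z \<notin> cset (I (b + card S)) \<Longrightarrow> of_real (p j) + cauchy_int \<mu> (I (b + card S)) (d j) z \<noteq> 0"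
  shows "row_rep (insert j S) \<nu> (\<lambda>k y. - v k y * (p j + real_cauchy_int \<mu> (I (b + card S)) (d j) y))
     (\<lambda>k. p k - p j * q0 k - q1 k * (LINT x:I (b + card S)|\<mu>. d j x))"
proof -
  define J J' where "J = I (b + card S)" and "J' = I (Suc (b + card S))"
  have fin: "finite S" using S finite_subset by blast
  have ci: "card (insert j S) = Suc (card S)" using j fin by simp
  have Sj: "insert j S \<subseteq> {b..m}" using S j by auto
  have le: "b + card S < m" using card_less[OF Sj ne] ci by simp
  have J: "compact J" "connected J" and J': "compact J'" "connected J'" and JJ: "J \<inter> J' = {}"
    using I le disj[of "b + card S"] by (auto simp: J_def J'_def)
  have m: "sets \<mu> = sets borel" "finite_measure \<mu>" using rr by (auto simp: row_rep_def heavy_on_def)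
  have n: "sets \<nu> = sets borel" "finite_measure \<nu>" and hn: "heavy_on J' \<nu>" using cr by (auto simp: cut_rep_def heavy_on_def J'_def)
  have rk: "continuous_on J (d k)" "\<And>x. x \<in> J \<Longrightarrow> d k x \<noteq> 0"
    "\<And>z. Im z \<noteq> 0 \<Longrightarrow> row S k z = of_real (p k) + cauchy_int \<mu> J (d k) z"
    "a + card S < k \<Longrightarrow> p k = 0"
    "\<And>l x. l \<in> {b..m} - S \<Longrightarrow> x \<in> J \<Longrightarrow> R S k l (of_real x) = of_real (d k x / d l x)"
    if "k \<in> {b..m} - S" for k
    using rr that by (auto simp: row_rep_def J_def)
  have ck: "continuous_on J' (v k)" "\<And>x. x \<in> J' \<Longrightarrow> v k x \<noteq> 0"
    "\<And>z. z \<notin> cset J' \<Longrightarrow> R S k j z = of_real (q0 k) + of_real (q1 k) * z + cauchy_int \<nu> J' (v k) z"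
    "j \<le> b + card S \<Longrightarrow> b + card S < k \<Longrightarrow> q0 k = 0 \<and> q1 k = 0"
    "(k \<le> b + card S \<Longrightarrow> j \<le> b + card S) \<Longrightarrow> q1 k = 0"
    "\<And>l x. l \<in> {b..m} - insert j S \<Longrightarrow> x \<in> J' \<Longrightarrow> R (insert j S) k l (of_real x) = of_real (v k x / v l x)"
    if "k \<in> {b..m} - insert j S" for k
    using cr that by (auto simp: cut_rep_def J'_def)
  define \<psi> where "\<psi> y = p j + real_cauchy_int \<mu> J (d j) y" for y
  have \<psi>c: "continuous_on J' \<psi>" unfolding \<psi>_def using JJ
    by (intro continuous_intros continuous_on_real_cauchy_int[OF m J(1) rk(1)[OF j]]) auto
  have \<psi>nz: "\<psi> y \<noteq> 0" if "y \<in> J'" for y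
  proof -
    have "complex_of_real y \<notin> cset J" using that JJ by auto
    from nz[folded J_def, OF this] show ?thesis
      unfolding cauchy_int_eq_real_cauchy_int \<psi>_def of_real_add[symmetric] by (simp only: of_real_eq_0_iff not_False_eq_True)
  qed
  have main: "row (insert j S) k z = of_real (p k - p j * q0 k - q1 k * (LINT x:J|\<mu>. d j x)) +
      cauchy_int \<nu> J' (\<lambda>y. - v k y * \<psi> y) z" if k: "k \<in> {b..m} - insert j S" and z: "Im z \<noteq> 0" for k z
  proof -
    have kS: "k \<in> {b..m} - S" "k \<noteq> j" using k by auto
    have zJ: "z \<notin> cset J" "z \<notin> cset J'" using z by (auto intro: nonreal_notin)
    have dk: "d k x = d j x * (q0 k + q1 k * x + real_cauchy_int \<nu> J' (v k) x)" if x: "x \<in> J" for x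
    proof -
      have "complex_of_real x \<notin> cset J'" using x JJ by auto
      from ck(3)[OF k this] rk(5)[OF kS(1) j x]
      have "of_real (d k x / d j x) = complex_of_real (q0 k + q1 k * x + real_cauchy_int \<nu> J' (v k) x)"
        by (simp add: cauchy_int_eq_real_cauchy_int)
      then have "d k x / d j x = q0 k + q1 k * x + real_cauchy_int \<nu> J' (v k) x" by (simp only: of_real_eq_iff)
      then show ?thesis using rk(2)[OF j x] by (simp add: field_simps)
    qed
    (* A linear term in the ratio occurs only for large j, and then column j has no constant at infinity. *)
    have pq: "p j * q1 k = 0"
    proof (cases "q1 k = 0")
      case False
      then have "\<not> (k \<le> b + card S \<longrightarrow> j \<le> b + card S)" using ck(5)[OF k] by blast
      then show ?thesis using rk(4)[OF j] by simp
    qed simp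
    have "row (insert j S) k z = row S k z - row S j z * R S k j z"
      by (rule row_insert[OF S j kS z])
    also have "\<dots> = (of_real (p k) + cauchy_int \<mu> J (d k) z) - (of_real (p j) + cauchy_int \<mu> J (d j) z) *
        (of_real (q0 k) + of_real (q1 k) * z + cauchy_int \<nu> J' (v k) z)"
      using rk(3)[OF kS(1) z] rk(3)[OF j z] ck(3)[OF k zJ(2)] by simp
    also have "\<dots> = of_real (p k - p j * q0 k - q1 k * (LINT x:J|\<mu>. d j x)) - of_real (p j * q1 k) * z
       + cauchy_int \<nu> J' (\<lambda>y. - v k y * (p j + real_cauchy_int \<mu> J (d j) y)) z"
      by (rule eliminate_first_cut[OF m J(1) rk(1)[OF j] rk(1)[OF kS(1)] n J'(1) ck(1)[OF k] JJ zJ dk])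
    finally show ?thesis using pq by (simp add: \<psi>_def)
  qed
  show ?thesis
    unfolding row_rep_def ci J_def[symmetric]
  proof (intro conjI ballI allI impI; (unfold add_Suc_right)?; (fold J'_def \<psi>_def)?)
    show "heavy_on J' \<nu>" by (rule hn)
    fix k assume k: "k \<in> {b..m} - insert j S"
    then have kS: "k \<in> {b..m} - S" by auto
    show "continuous_on J' (\<lambda>y. - v k y * \<psi> y)" by (intro continuous_intros ck(1)[OF k] \<psi>c)
    show "- v k x * \<psi> x \<noteq> 0" if "x \<in> J'" for x using ck(2)[OF k that] \<psi>nz[OF that] by simp
    show "row (insert j S) k z = of_real (p k - p j * q0 k - q1 k * (LINT x:J|\<mu>. d j x)) + cauchy_int \<nu> J' (\<lambda>y. - v k y * \<psi> y) z" if "Im z \<noteq> 0" for z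
      using main[OF k that] .
    show "p k - p j * q0 k - q1 k * (LINT x:J|\<mu>. d j x) = 0" if "Suc (a + card S) < k"
    proof -
      have "p k = 0" using rk(4)[OF kS] that by simp
      moreover have "q1 k = 0" using ck(5)[OF k] that by simp
      moreover have "p j * q0 k = 0"
      proof (cases "j \<le> b + card S")
        case True then show ?thesis using ck(4)[OF k] that by simp
      next
        case False then show ?thesis using rk(4)[OF j] by simp
      qed
      ultimately show ?thesis by simp
    qed
    fix l x assume l: "l \<in> {b..m} - insert j S" and x: "x \<in> J'"
    show "R (insert j S) k l (of_real x) = of_real (- v k x * \<psi> x / (- v l x * \<psi> x))"
      using ck(6)[OF k l x] \<psi>nz[OF x] by simp
  qed
qed

lemma row_rep_large_nonzero:
  assumes S: "S \<subseteq> {b..m}" and k: "k \<in> {b..m} - S" "a + card S < k" and rr: "row_rep S \<mu> d p"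
    and z: "z \<notin> cset (I (b + card S))"
  shows "of_real (p k) + cauchy_int \<mu> (I (b + card S)) (d k) z \<noteq> 0"
proof -
  have ne: "{b..m} - S \<noteq> {}" using k by blast
  note ok = cut_ok[OF S ne]
  have "heavy_on (I (b + card S)) \<mu>" "continuous_on (I (b + card S)) (d k)"
    "\<And>x. x \<in> I (b + card S) \<Longrightarrow> d k x \<noteq> 0" "p k = 0"
    using rr k by (auto simp: row_rep_def)
  then show ?thesis using cauchy_int_nonzero[OF _ ok _ _ z] by simp
qed

text \<open>
  For large \<open>k\<close> the reduced entry is a Cauchy transform of constant sign and has no zeros. For small \<open>k\<close> this sign argument is
  not available, but then \<open>S\<close> contains a large index \<open>i\<close>. Exchanging \<open>k\<close> and \<open>i\<close> multiplies the entry by a Cauchy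
  transform of constant sign and turns it, up to sign, into an entry in the large column \<open>i\<close>, which has no
  zeros. Comparing the orders at infinity of both sides shows that the constant at infinity is not zero either.
\<close>
lemma row_rep_small_nonzero:
  assumes S: "S \<subseteq> {b..m}" and k: "k \<in> {b..m} - S" "k \<le> a + card S" and rr: "row_rep S \<mu> d p"
    and ex: "\<And>T. T \<subseteq> {b..m} \<Longrightarrow> {b..m} - T \<noteq> {} \<Longrightarrow> card T = card S \<Longrightarrow> \<exists>\<mu> d p. row_rep T \<mu> d p"
  shows "p k \<noteq> 0" "z \<notin> cset (I (b + card S)) \<Longrightarrow> of_real (p k) + cauchy_int \<mu> (I (b + card S)) (d k) z \<noteq> 0"
proof -
  have fin: "finite S" using S finite_subset by blast
  (* Otherwise S and k would fit into the card S many small indices. *)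
  obtain i where i: "i \<in> S" "a + card S < i"
  proof (rule ccontr)
    assume "\<not> thesis"
    then have "insert k S \<subseteq> {b..a + card S}" using S k that by force
    then have "card (insert k S) \<le> card {b..a + card S}" by (intro card_mono) auto
    then show False using k fin by simp
  qed
  define S0 where "S0 = S - {i}"
  have S0: "S0 \<subseteq> {b..m}" "S = insert i S0" "i \<in> {b..m} - S0" "k \<in> {b..m} - S0" "k \<noteq> i" using S i k by (auto simp: S0_def)
  have c0: "card S = Suc (card S0)" using card_Suc_Diff1[OF fin i(1)] by (simp add: S0_def)
  define T where "T = insert k S0"
  have T: "T \<subseteq> {b..m}" "i \<in> {b..m} - T" using S0 by (auto simp: T_def)
  have cT: "card T = card S" using S0 fin c0 by (simp add: T_def)
  obtain \<mu>t dt pt where rt: "row_rep T \<mu>t dt pt" using ex[OF T(1) _ cT] T(2) by blast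
  define J where "J = I (b + card S)"
  have "{b..m} - S \<noteq> {}" using k by blast
  then have J: "compact J" "connected J" using cut_ok[OF S] by (simp_all add: J_def)
  have JT: "I (b + card T) = J" by (simp add: J_def cT)
  have J0: "I (Suc (b + card S0)) = J" by (simp add: J_def c0)
  have ne: "{b..m} - insert k S0 \<noteq> {}" using T by (auto simp: T_def)
  have t: "heavy_on J \<mu>t" "continuous_on J (dt i)" "\<And>x. x \<in> J \<Longrightarrow> dt i x \<noteq> 0" "pt i = 0"
    "\<And>z. Im z \<noteq> 0 \<Longrightarrow> row T i z = of_real (pt i) + cauchy_int \<mu>t J (dt i) z"
    using rt T(2) i(2) cT unfolding row_rep_def JT by auto
  have r: "heavy_on J \<mu>" "continuous_on J (d k)" "\<And>z. Im z \<noteq> 0 \<Longrightarrow> row S k z = of_real (p k) + cauchy_int \<mu> J (d k) z"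
    using rr k unfolding row_rep_def J_def by auto
  obtain \<nu> v q0 q1 where cr: "cut_rep I b m R S0 k \<nu> v q0 q1"
    using tail_rep[OF S0(1,4) ne] by blast
  have i': "i \<in> {b..m} - insert k S0" using S0 by auto
  have v: "heavy_on J \<nu>" "continuous_on J (v i)" "\<And>x. x \<in> J \<Longrightarrow> v i x \<noteq> 0"
    "\<And>z. z \<notin> cset J \<Longrightarrow> R S0 i k z = cauchy_int \<nu> J (v i) z"
    using cr i' i(2) k(2) c0 unfolding cut_rep_def J0 by auto
  note mt = heavy_onD[OF t(1)] J(1) t(2)
  note mr = heavy_onD[OF r(1)] J(1) r(2)
  note mv = heavy_onD[OF v(1)] J(1) v(2)
  have nr: "(of_real (p k) + cauchy_int \<mu> J (d k) z) * cauchy_int \<nu> J (v i) z = - cauchy_int \<mu>t J (dt i) z"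
    if z: "Im z \<noteq> 0" for z
  proof -
    have zJ: "z \<notin> cset J" using z by (rule nonreal_notin)
    have 1: "row S k z = row S0 k z - row S0 i z * R S0 k i z"
      unfolding S0(2) using row_insert[OF S0(1,3,4,5) z] .
    have 2: "row T i z = row S0 i z - row S0 k z * R S0 i k z"
      unfolding T_def using row_insert[OF S0(1,4,3) S0(5)[symmetric] z] .
    have "R S0 k i z * R S0 i k z = 1"
      using tail_trans[OF S0(1,4,3,4) z] by (simp add: tail_one)
    then have "row S k z * R S0 i k z = - row T i z"
      unfolding 1 2 by (simp add: algebra_simps)
    then show ?thesis using v(4)[OF zJ] t(4,5) r(3) z by simp
  qed
  have all: "(of_real (p k) + cauchy_int \<mu> J (d k) z) * cauchy_int \<nu> J (v i) z = - cauchy_int \<mu>t J (dt i) z"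
    if z: "z \<notin> cset J" for z
    by (rule nonreal_isCont_eq[where f = "\<lambda>z. (of_real (p k) + cauchy_int \<mu> J (d k) z) * cauchy_int \<nu> J (v i) z"
       and g = "\<lambda>z. - cauchy_int \<mu>t J (dt i) z"])
      (intro continuous_intros isCont_cauchy_int mt mr mv z nr, assumption?)+
  show "of_real (p k) + cauchy_int \<mu> (I (b + card S)) (d k) z \<noteq> 0" if z: "z \<notin> cset (I (b + card S))"
    using all[OF z[folded J_def]] cauchy_int_nonzero[OF t(1) J t(2,3) z[folded J_def]]
    unfolding J_def by auto
  show "p k \<noteq> 0"
  proof
    assume pk: "p k = 0"
    have "((\<lambda>z. (of_real (p k) + cauchy_int \<mu> J (d k) z) * (z * cauchy_int \<nu> J (v i) z)) \<longlongrightarrow>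
        (of_real (p k) + 0) * of_real (LINT x:J|\<nu>. v i x)) at_infinity"
      by (intro tendsto_intros cauchy_int_tendsto_0[OF mr] cauchy_int_mult_z_tendsto[OF mv])
    then have "((\<lambda>z. (of_real (p k) + cauchy_int \<mu> J (d k) z) * (z * cauchy_int \<nu> J (v i) z)) \<longlongrightarrow> 0) at_infinity"
      by (simp add: pk)
    moreover have "\<forall>\<^sub>F z in at_infinity. (of_real (p k) + cauchy_int \<mu> J (d k) z) * (z * cauchy_int \<nu> J (v i) z) = - (z * cauchy_int \<mu>t J (dt i) z)"
      using eventually_notin_cset[OF J(1)]
    proof eventually_elim
      case (elim z)
      have "(of_real (p k) + cauchy_int \<mu> J (d k) z) * (z * cauchy_int \<nu> J (v i) z) = z * ((of_real (p k) + cauchy_int \<mu> J (d k) z) * cauchy_int \<nu> J (v i) z)"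
        by (simp add: algebra_simps)
      then show ?case unfolding all[OF elim] by simp
    qed
    ultimately have "((\<lambda>z. - (z * cauchy_int \<mu>t J (dt i) z)) \<longlongrightarrow> 0) at_infinity"
      by (rule Lim_transform_eventually)
    moreover have "((\<lambda>z. - (z * cauchy_int \<mu>t J (dt i) z)) \<longlongrightarrow> - of_real (LINT x:J|\<mu>t. dt i x)) at_infinity"
      by (intro tendsto_intros cauchy_int_mult_z_tendsto[OF mt])
    ultimately have "- complex_of_real (LINT x:J|\<mu>t. dt i x) = 0"
      using tendsto_unique[OF trivial_limit_at_infinity] by blast
    then show False using const_sign_mass_nonzero[OF t(1) J t(2,3)] by simp
  qed
qed

lemma row_rep_nonzero:
  assumes S: "S \<subseteq> {b..m}" and k: "k \<in> {b..m} - S" and rr: "row_rep S \<mu> d p"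
    and ex: "\<And>T. T \<subseteq> {b..m} \<Longrightarrow> {b..m} - T \<noteq> {} \<Longrightarrow> card T = card S \<Longrightarrow> \<exists>\<mu> d p. row_rep T \<mu> d p"
    and z: "z \<notin> cset (I (b + card S))"
  shows "of_real (p k) + cauchy_int \<mu> (I (b + card S)) (d k) z \<noteq> 0"
  using row_rep_large_nonzero[OF S k _ rr z] row_rep_small_nonzero(2)[OF S k _ rr ex z] by linarith

lemma row_rep_ex: "S \<subseteq> {b..m} \<Longrightarrow> {b..m} - S \<noteq> {} \<Longrightarrow> \<exists>\<mu> d p. row_rep S \<mu> d p"
proof (induction "card S" arbitrary: S)
  case 0
  then have "S = {}" using finite_subset by fastforce
  then have "row_rep S \<mu>0 w (\<lambda>_. 0)"
    using w \<mu>0 unfolding row_rep_def by (auto simp: row_def)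
  then show ?case by blast
next
  case (Suc r)
  have fin: "finite S" using Suc.prems(1) finite_subset by blast
  obtain j where j: "j \<in> S" using Suc.hyps(2) by (metis card.empty ex_in_conv nat.distinct(1))
  define S0 where "S0 = S - {j}"
  have S0: "S0 \<subseteq> {b..m}" "j \<in> {b..m} - S0" "S = insert j S0" "{b..m} - insert j S0 \<noteq> {}" "{b..m} - S0 \<noteq> {}"
    using j Suc.prems by (auto simp: S0_def)
  have c0: "r = card S0" using Suc.hyps(2) card_Suc_Diff1[OF fin j] by (simp add: S0_def)
  obtain \<mu> d p where rr: "row_rep S0 \<mu> d p" using Suc.hyps(1)[OF c0 S0(1,5)] by blast
  obtain \<nu> v q0 q1 where cr: "cut_rep I b m R S0 j \<nu> v q0 q1" using tail_rep[OF S0(1,2,4)] by blast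
  have ex: "\<exists>\<mu> d p. row_rep T \<mu> d p" if "T \<subseteq> {b..m}" "{b..m} - T \<noteq> {}" "card T = card S0" for T
    using Suc.hyps(1)[of T] that c0 by simp
  show ?case
    using row_rep_insert[OF S0(1,2,4) rr cr row_rep_nonzero[OF S0(1,2) rr ex]] S0(3) by blast
qed

lemmas row_rep_small_nonzero' = row_rep_small_nonzero[OF _ _ _ _ row_rep_ex]
lemmas row_rep_nonzero' = row_rep_nonzero[OF _ _ _ row_rep_ex]

text \<open>
  If \<open>a\<close> is among the columns, expanding along column \<open>a\<close>, whose only nonzero entry is in row \<open>a\<close>, leaves a minor of the
  rows below. Otherwise the ratio of minors is the ratio of the reduced entries of row \<open>a\<close>.
\<close>
definition next_ratio :: "nat set \<Rightarrow> nat \<Rightarrow> nat \<Rightarrow> complex \<Rightarrow> complex" where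
  "next_ratio S k j z = (if k = j then 1 else if a \<in> S then R (S - {a}) k j z
     else real_ext (\<lambda>z. row S k z / row S j z) z)"

lemma next_ratio_in: "a \<in> S \<Longrightarrow> next_ratio S k j z = R (S - {a}) k j z"
  by (simp add: next_ratio_def tail_one)

lemma row_a: "row S a z = 1"
  by (simp add: row_def)

lemma row_nonzero:
  assumes S: "S \<subseteq> {b..m}" and k: "k \<in> {a..m} - S" and z: "Im z \<noteq> 0"
  shows "row S k z \<noteq> 0"
proof (cases "k = a")
  case False
  then have k': "k \<in> {b..m} - S" using k by auto
  then obtain \<mu> d p where rr: "row_rep S \<mu> d p" using row_rep_ex[OF S] by blast
  then have "row S k z = of_real (p k) + cauchy_int \<mu> (I (b + card S)) (d k) z"
    using k' z by (auto simp: row_rep_def)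
  then show ?thesis using row_rep_nonzero'[OF S k' rr _ _ nonreal_notin[OF z]] by simp
qed (simp add: row_a)

lemma next_ratio_out:
  assumes "S \<subseteq> {b..m}" "j \<in> {a..m} - S" "Im z \<noteq> 0"
  shows "next_ratio S k j z = row S k z / row S j z"
proof -
  have "a \<notin> S" using assms(1) by auto
  then show ?thesis using row_nonzero[OF assms] assms(3) by (simp add: next_ratio_def real_ext_def)
qed

lemma next_ratio_trans:
  assumes S: "S \<subseteq> {a..m}" and k: "k \<in> {a..m} - S" and j: "j \<in> {a..m} - S" and i: "i \<in> {a..m} - S" and z: "Im z \<noteq> 0"
  shows "next_ratio S k j z * next_ratio S j i z = next_ratio S k i z"
proof (cases "a \<in> S")
  case True
  have "S - {a} \<subseteq> {b..m}" "k \<in> {b..m} - (S - {a})" "j \<in> {b..m} - (S - {a})" "i \<in> {b..m} - (S - {a})"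
    using S k j i True by (auto simp: Suc_le_eq order_less_le)
  from tail_trans[OF this z] show ?thesis by (simp only: next_ratio_in[OF True])
next
  case False
  then have S': "S \<subseteq> {b..m}" using S by (auto simp: Suc_le_eq order_less_le)
  show ?thesis using row_nonzero[OF S' j z] row_nonzero[OF S' i z]
    by (simp add: next_ratio_out[OF S' j z] next_ratio_out[OF S' i z])
qed

text \<open>
  When \<open>a\<close> is not in \<open>S\<close>, every term is expressed by the reduced entries for \<open>S\<close> and the tail ratios through
  \<open>row_insert\<close>; the cases differ in which of the three indices, if any, is the column \<open>a\<close>.
\<close>
lemma next_ratio_pluecker:
  assumes S: "S \<subseteq> {a..m}" and k: "k \<in> {a..m} - S" and j: "j \<in> {a..m} - S" and i: "i \<in> {a..m} - S"
    and ne: "k \<noteq> j" "j \<noteq> i" "k \<noteq> i" and z: "Im z \<noteq> 0"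
  shows "next_ratio S k j z = next_ratio S i j z * next_ratio (insert j S) k i z + next_ratio (insert i S) k j z"
proof (cases "a \<in> S")
  case True
  have "insert j S - {a} = insert j (S - {a})" "insert i S - {a} = insert i (S - {a})"
    using True j i by auto
  moreover have "S - {a} \<subseteq> {b..m}" "k \<in> {b..m} - (S - {a})" "j \<in> {b..m} - (S - {a})" "i \<in> {b..m} - (S - {a})"
    using S k j i True by (auto simp: Suc_le_eq order_less_le)
  from tail_pluecker[OF this ne z] calculation show ?thesis using True by (simp add: next_ratio_in)
next
  case False
  then have S': "S \<subseteq> {b..m}" using S by (auto simp: Suc_le_eq order_less_le)
  have Sa: "insert a S - {a} = S" using False by auto
  note o = next_ratio_out[OF S' _ z]
  have ins: "insert x S \<subseteq> {b..m}" if "x \<in> {a..m} - S" "x \<noteq> a" for x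
    using S' that by (auto simp: Suc_le_eq order_less_le)
  have bm: "x \<in> {b..m} - S" if "x \<in> {a..m} - S" "x \<noteq> a" for x
    using that by (auto simp: Suc_le_eq order_less_le)
  have oi: "next_ratio (insert x S) y u z = row (insert x S) y z / row (insert x S) u z"
    if "x \<in> {a..m} - S" "x \<noteq> a" "u \<in> {a..m} - S" "u \<noteq> x" for x y u
    using next_ratio_out[OF ins[OF that(1,2)] _ z] that by simp
  have nzi: "row (insert x S) u z \<noteq> 0"
    if "x \<in> {a..m} - S" "x \<noteq> a" "u \<in> {a..m} - S" "u \<noteq> x" for x u
    using row_nonzero[OF ins[OF that(1,2)] _ z] that by simp
  have ri: "row (insert x S) u z = row S u z - row S x z * R S u x z"
    if "x \<in> {a..m} - S" "x \<noteq> a" "u \<in> {a..m} - S" "u \<noteq> x" "u \<noteq> a" for x u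
    using row_insert[OF S' bm[OF that(1,2)] bm[OF that(3,5)] that(4) z] .
  consider "j = a" | "i = a" | "k = a" | "j \<noteq> a" "i \<noteq> a" "k \<noteq> a" by blast
  then show ?thesis
  proof cases
    case 1
    then have "next_ratio (insert j S) k i z = R S k i z" by (simp add: next_ratio_in Sa)
    moreover have "next_ratio S k a z = row S k z" "next_ratio S i a z = row S i z" using o[OF j] 1 by (simp_all add: row_a)
    ultimately show ?thesis using ne 1 oi[OF i _ j] ri[OF i _ k] by (simp add: row_a algebra_simps)
  next
    case 2
    then have "next_ratio (insert i S) k j z = R S k j z" by (simp add: next_ratio_in Sa)
    then show ?thesis using ne 2 oi[OF j _ i] ri[OF j _ k] row_nonzero[OF S' j z]
      by (simp add: o[OF j] row_a field_simps)
  next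
    case 3
    have RR: "R S i j z * R S j i z = 1"
      using tail_trans[OF S' bm[OF i] bm[OF j] bm[OF i] z] ne 3 by (simp add: tail_one)
    have e: "row (insert i S) j z = - R S j i z * row (insert j S) i z"
    proof -
      have p1: "row (insert i S) j z = row S j z - row S i z * R S j i z" using ri[OF i _ j] ne 3 by simp
      have p2: "row (insert j S) i z = row S i z - row S j z * R S i j z" using ri[OF j _ i] ne 3 by simp
      have "- R S j i z * (row S i z - row S j z * R S i j z) = - R S j i z * row S i z + row S j z * (R S i j z * R S j i z)"
        by (simp add: algebra_simps)
      then show ?thesis unfolding p1 p2 RR by (simp add: algebra_simps)
    qed
    have Rji: "R S j i z \<noteq> 0" using RR by auto
    have "row S i z / row S j z * (1 / row (insert j S) i z) + 1 / row (insert i S) j z =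
        (row S i z * R S j i z - row S j z) / (row S j z * row (insert j S) i z * R S j i z)"
      unfolding e using row_nonzero[OF S' j z] nzi[OF j _ i] ne 3 Rji by (simp add: divide_simps)
    also have "row S i z * R S j i z - row S j z = row (insert j S) i z * R S j i z"
    proof -
      have p2: "row (insert j S) i z = row S i z - row S j z * R S i j z" using ri[OF j _ i] ne 3 by simp
      have "(row S i z - row S j z * R S i j z) * R S j i z = row S i z * R S j i z - row S j z * (R S i j z * R S j i z)"
        by (simp add: algebra_simps)
      then show ?thesis unfolding p2 RR by simp
    qed
    also have "row (insert j S) i z * R S j i z / (row S j z * row (insert j S) i z * R S j i z) = 1 / row S j z"
      using nzi[OF j _ i] ne 3 Rji by simp
    finally show ?thesis using ne 3 by (simp add: o[OF j] oi[OF j _ i] oi[OF i _ j] row_a)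
  next
    case 4
    have RR: "R S i j z * R S j i z = 1" and Rk: "R S i j z * R S k i z = R S k j z"
      using tail_trans[OF S' bm[OF i] bm[OF j] bm[OF i] z] tail_trans[OF S' bm[OF k] bm[OF i] bm[OF j] z] ne 4
      by (simp_all add: tail_one mult.commute)
    have Rij: "R S i j z \<noteq> 0" using RR by auto
    have e: "row (insert j S) i z = - R S i j z * row (insert i S) j z"
    proof -
      have p1: "row (insert i S) j z = row S j z - row S i z * R S j i z" using ri[OF i _ j] ne 4 by simp
      have p2: "row (insert j S) i z = row S i z - row S j z * R S i j z" using ri[OF j _ i] ne 4 by simp
      have "- R S i j z * (row S j z - row S i z * R S j i z) = - R S i j z * row S j z + row S i z * (R S i j z * R S j i z)"
        by (simp add: algebra_simps)
      then show ?thesis unfolding p1 p2 RR by (simp add: algebra_simps)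
    qed
    have n1: "row (insert i S) j z \<noteq> 0" using nzi[OF i _ j] ne 4 by simp
    have n2: "row S j z \<noteq> 0" by (rule row_nonzero[OF S' j z])
    have key: "row S k z * (- R S i j z * row (insert i S) j z) = row S i z * row (insert j S) k z - row S j z * R S i j z * row (insert i S) k z"
    proof -
      have k1: "row (insert i S) j z = row S j z - row S i z * R S j i z" using ri[OF i _ j] ne 4 by simp
      have k2: "row (insert j S) k z = row S k z - row S j z * (R S i j z * R S k i z)" using ri[OF j _ k] ne 4 Rk by simp
      have k3: "row (insert i S) k z = row S k z - row S i z * R S k i z" using ri[OF i _ k] ne 4 by simp
      have "row S k z * (- R S i j z * (row S j z - row S i z * R S j i z)) = - row S k z * R S i j z * row S j z + row S k z * row S i z * (R S i j z * R S j i z)"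
        by (simp add: algebra_simps)
      then show ?thesis unfolding k1 k2 k3 RR by (simp add: algebra_simps)
    qed
    have "row S i z / row S j z * (row (insert j S) k z / row (insert j S) i z) + row (insert i S) k z / row (insert i S) j z
       = (row S i z * row (insert j S) k z - row S j z * R S i j z * row (insert i S) k z) / (row S j z * (- R S i j z * row (insert i S) j z))"
      unfolding e using n1 n2 Rij by (simp add: divide_simps)
    also have "\<dots> = row S k z / row S j z"
      unfolding key[symmetric] using n1 n2 Rij by simp
    finally show ?thesis using ne 4 by (simp add: o[OF j] oi[OF j _ i] oi[OF i _ j])
  qed
qed

lemma next_ratio_rep_in:
  assumes S: "S \<subseteq> {a..m}" and aS: "a \<in> S" and j: "j \<in> {a..m} - S" and ne: "{a..m} - insert j S \<noteq> {}"
  shows "\<exists>\<mu> d p0 p1. cut_rep I a m next_ratio S j \<mu> d p0 p1"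
proof -
  define S1 where "S1 = S - {a}"
  have fin: "finite S" using S finite_subset by blast
  have S1: "S1 \<subseteq> {b..m}" "j \<in> {b..m} - S1" using S j aS by (auto simp: S1_def Suc_le_eq order_less_le)
  have set: "{a..m} - insert j S = {b..m} - insert j S1" using aS by (auto simp: S1_def Suc_le_eq order_less_le)
  have c: "a + card S = b + card S1" using card_Suc_Diff1[OF fin aS] by (simp add: S1_def)
  have ins: "insert j S - {a} = insert j S1" using aS j by (auto simp: S1_def)
  obtain \<mu> d p0 p1 where cr: "cut_rep I b m R S1 j \<mu> d p0 p1"
    using tail_rep[OF S1] ne set by metis
  have "cut_rep I a m next_ratio S j \<mu> d p0 p1"
    using cr unfolding cut_rep_def set c using aS ins by (simp add: next_ratio_in S1_def[symmetric])
  then show ?thesis by blast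
qed

lemma next_ratio_rep_a:
  assumes S: "S \<subseteq> {b..m}" and ne: "{a..m} - insert a S \<noteq> {}"
  shows "\<exists>\<mu> d p0 p1. cut_rep I a m next_ratio S a \<mu> d p0 p1"
proof -
  have set: "{a..m} - insert a S = {b..m} - S" by (auto simp: Suc_le_eq order_less_le)
  obtain \<mu> d p where rr: "row_rep S \<mu> d p" using row_rep_ex[OF S] ne set by metis
  have aS: "a \<notin> S" using S by auto
  have ins: "insert a S - {a} = S" using aS by auto
  have c: "Suc (a + card S) = b + card S" by simp
  have m: "sets \<mu> = sets borel" "finite_measure \<mu>" using rr by (auto simp: row_rep_def heavy_on_def)
  have ok: "compact (I (b + card S))" using cut_ok[OF S] ne set by auto
  have "cut_rep I a m next_ratio S a \<mu> d p (\<lambda>_. 0)"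
    unfolding cut_rep_def set c
  proof (intro conjI ballI allI impI)
    show "heavy_on (I (b + card S)) \<mu>" using rr by (simp add: row_rep_def)
    fix k assume k: "k \<in> {b..m} - S"
    then have ka: "k \<noteq> a" by auto
    show dk: "continuous_on (I (b + card S)) (d k)" using rr k by (auto simp: row_rep_def)
    show "d k x \<noteq> 0" if "x \<in> I (b + card S)" for x using rr k that by (auto simp: row_rep_def)
    show "next_ratio S k a z = of_real (p k) + of_real 0 * z + cauchy_int \<mu> (I (b + card S)) (d k) z"
      if z: "z \<notin> cset (I (b + card S))" for z
    proof -
      have "real_ext (\<lambda>z. row S k z / row S a z) z = of_real (p k) + cauchy_int \<mu> (I (b + card S)) (d k) z"
      proof (rule real_ext_eq)
        show "isCont (\<lambda>a. of_real (p k) + cauchy_int \<mu> (I (b + card S)) (d k) a) z"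
          by (intro continuous_intros isCont_cauchy_int[OF m ok dk z])
        show "row S k w / row S a w = of_real (p k) + cauchy_int \<mu> (I (b + card S)) (d k) w" if "Im w \<noteq> 0" for w
          using rr k that by (auto simp: row_rep_def row_a)
      qed
      then show ?thesis using ka aS by (simp add: next_ratio_def)
    qed
    show "p k = 0" if "a + card S < k" using rr k that by (auto simp: row_rep_def)
    show "next_ratio (insert a S) k l (of_real x) = of_real (d k x / d l x)"
      if "l \<in> {b..m} - S" "x \<in> I (b + card S)" for l x
      using rr k that by (auto simp: row_rep_def next_ratio_in ins)
  qed auto
  then show ?thesis by blast
qed

text \<open>
  The substantial case, in which the denominator is not the constant one. Write \<open>F k\<close> for the reduced entries. Elimination of
  column \<open>j\<close> gives \<open>F k / F j = R S k j + (reduced entry for S \<union> {j}) * (1 / F j)\<close>. The first two functions have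
  the next interval as cut and \<open>1 / F j\<close> is, by \<open>reciprocal_of_cauchy_int\<close>, an affine function plus a
  Cauchy transform on the present one; the singularities on the next interval cancel. The affine parts are then read
  off from the behaviour of \<open>F k / F j\<close> at infinity.
\<close>
lemma next_ratio_rep_j:
  assumes S: "S \<subseteq> {b..m}" and j: "j \<in> {b..m} - S"
  shows "\<exists>\<mu> d p0 p1. cut_rep I a m next_ratio S j \<mu> d p0 p1"
proof -
  have fin: "finite S" using S finite_subset by blast
  have aS: "a \<notin> S" "a \<notin> insert j S" using S j by auto
  have ne: "{b..m} - S \<noteq> {}" using j by blast
  have ins: "insert j S \<subseteq> {b..m}" and ci: "card (insert j S) = Suc (card S)" using S j fin by auto
  define J where "J = I (b + card S)"
  define J2 where "J2 = I (Suc (b + card S))"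
  have J: "compact J" "connected J" using cut_ok[OF S ne] by (simp_all add: J_def)
  have JS: "I (Suc (a + card S)) = J" by (simp add: J_def)
  obtain \<mu> d p where rr: "row_rep S \<mu> d p" using row_rep_ex[OF S ne] by blast
  have hm: "heavy_on J \<mu>" using rr by (simp add: row_rep_def J_def)
  note m = heavy_onD[OF hm] J(1)
  have rk: "continuous_on J (d k)" "\<And>x. x \<in> J \<Longrightarrow> d k x \<noteq> 0"
    "\<And>z. Im z \<noteq> 0 \<Longrightarrow> row S k z = of_real (p k) + cauchy_int \<mu> J (d k) z"
    "a + card S < k \<Longrightarrow> p k = 0"
    "\<And>l x. l \<in> {b..m} - S \<Longrightarrow> x \<in> J \<Longrightarrow> R S k l (of_real x) = of_real (d k x / d l x)"
    if "k \<in> {b..m} - S" for k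
    using rr that by (auto simp: row_rep_def J_def)
  (* F and G are the reduced entries for S and for S with j added, extended to the real points off
     their cuts. *)
  define F where "F k z = (if k = a then 1 else of_real (p k) + cauchy_int \<mu> J (d k) z)" for k z
  have Fnz: "F k z \<noteq> 0" if "k \<in> {a..m} - S" "z \<notin> cset J" for k z
    using row_rep_nonzero'[OF S _ rr, of k z] that by (auto simp: F_def J_def Suc_le_eq order_less_le)
  have Frow: "row S k z = F k z" if "k \<in> {a..m} - S" "Im z \<noteq> 0" for k z
    using rk(3)[of k z] that by (auto simp: F_def row_a Suc_le_eq order_less_le)
  have Fcont: "isCont (F k) z" if "k \<in> {a..m} - S" "z \<notin> cset J" for k z
  proof (cases "k = a")
    case False
    then have "k \<in> {b..m} - S" using that by auto
    then have "isCont (\<lambda>z. of_real (p k) + cauchy_int \<mu> J (d k) z) z"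
      by (intro continuous_intros isCont_cauchy_int[OF m rk(1) that(2)])
    then show ?thesis using False by (simp add: F_def[abs_def])
  qed (simp add: F_def[abs_def])
  have ja: "j \<noteq> a" "j \<in> {a..m} - S" using j by auto
  have Fj: "F j z = of_real (p j) + cauchy_int \<mu> J (d j) z" for z using ja by (simp add: F_def)
  obtain \<tau> l0 l1 e where t: "heavy_on J \<tau>" "e \<noteq> (0::real)" "p j \<noteq> 0 \<Longrightarrow> l1 = 0"
    "\<And>z. z \<notin> cset J \<Longrightarrow> 1 / F j z = of_real l0 + of_real l1 * z + cauchy_int \<tau> J (\<lambda>_. e) z"
    using reciprocal_of_cauchy_int[OF hm J rk(1,2)[OF j], of "p j"] Fnz[OF ja(2)] unfolding Fj by metis
  note mt = heavy_onD[OF t(1)] J(1)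
  have "\<exists>\<nu> v q0 q1. {b..m} - insert j S \<noteq> {} \<longrightarrow> cut_rep I b m R S j \<nu> v q0 q1"
  proof (cases "{b..m} - insert j S = {}")
    case False
    from tail_rep[OF S j this] show ?thesis by metis
  qed simp
  then obtain \<nu> v q0 q1 where cr: "{b..m} - insert j S \<noteq> {} \<Longrightarrow> cut_rep I b m R S j \<nu> v q0 q1"
    by metis
  define u where "u k y = - v k y * (p j + real_cauchy_int \<mu> J (d j) y)" for k y
  define P where "P k = p k - p j * q0 k - q1 k * (LINT x:J|\<mu>. d j x)" for k
  have rr2: "row_rep (insert j S) \<nu> u P" if "{b..m} - insert j S \<noteq> {}"
    using row_rep_insert[OF S j that rr cr[OF that]] Fnz[OF ja(2)] unfolding Fj
    by (simp add: J_def u_def[abs_def] P_def[abs_def])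
  have facts: "compact J2" "J \<inter> J2 = {}" "sets \<nu> = sets borel" "finite_measure \<nu>" "continuous_on J2 (u k)" "continuous_on J2 (v k)"
    "\<And>z. z \<notin> cset J2 \<Longrightarrow> R S k j z = of_real (q0 k) + of_real (q1 k) * z + cauchy_int \<nu> J2 (v k) z"
    "\<And>z. Im z \<noteq> 0 \<Longrightarrow> row (insert j S) k z = of_real (P k) + cauchy_int \<nu> J2 (u k) z"
    "\<And>z. z \<notin> cset J2 \<Longrightarrow> of_real (P k) + cauchy_int \<nu> J2 (u k) z \<noteq> 0"
    if k: "k \<in> {b..m} - insert j S" for k
  proof -
    have ne2: "{b..m} - insert j S \<noteq> {}" using k by blast
    have J2: "I (b + card (insert j S)) = J2" by (simp add: ci J2_def)
    have le: "b + card S < m" using card_less[OF ins ne2] ci by simp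
    show "compact J2" "J \<inter> J2 = {}" using I le disj[of "b + card S"] by (auto simp: J2_def J_def)
    show "sets \<nu> = sets borel" "finite_measure \<nu>" "continuous_on J2 (u k)"
      "\<And>z. Im z \<noteq> 0 \<Longrightarrow> row (insert j S) k z = of_real (P k) + cauchy_int \<nu> J2 (u k) z"
      using rr2[OF ne2] k unfolding row_rep_def J2 heavy_on_def by auto
    show "continuous_on J2 (v k)"
      "\<And>z. z \<notin> cset J2 \<Longrightarrow> R S k j z = of_real (q0 k) + of_real (q1 k) * z + cauchy_int \<nu> J2 (v k) z"
      using cr[OF ne2] k unfolding cut_rep_def J2_def by auto
    show "\<And>z. z \<notin> cset J2 \<Longrightarrow> of_real (P k) + cauchy_int \<nu> J2 (u k) z \<noteq> 0"
      using row_rep_nonzero'[OF ins k rr2[OF ne2]] unfolding J2 by simp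
  qed
  define \<Psi> where "\<Psi> k x = (if k = a then 1 else P k + real_cauchy_int \<nu> J2 (u k) x)" for k x
  define G where "G k z = (if k = a then 1 else of_real (P k) + cauchy_int \<nu> J2 (u k) z)" for k z
  have G\<Psi>: "G k (of_real x) = of_real (\<Psi> k x)" for k x
    by (simp add: G_def \<Psi>_def cauchy_int_eq_real_cauchy_int)
  have kb: "k \<in> {b..m} - insert j S" if "k \<in> {a..m} - insert j S" "k \<noteq> a" for k
    using that by (auto simp: Suc_le_eq order_less_le)
  have xJ2: "complex_of_real x \<notin> cset J2" if "x \<in> J" "k \<in> {b..m} - insert j S" for x k
    using facts(2)[OF that(2)] that(1) by auto
  have Gnz: "G k (of_real x) \<noteq> 0" if "k \<in> {a..m} - insert j S" "x \<in> J" for k x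
    using facts(9)[OF kb[OF that(1)] xJ2[OF that(2) kb[OF that(1)]]] by (cases "k = a") (auto simp: G_def)
  have Gcont: "isCont (G k) (of_real x)" if "k \<in> {a..m} - insert j S" "x \<in> J" for k x
  proof (cases "k = a")
    case False
    note k = kb[OF that(1) False]
    have "isCont (\<lambda>z. of_real (P k) + cauchy_int \<nu> J2 (u k) z) (of_real x)"
      by (intro continuous_intros isCont_cauchy_int[OF facts(3,4,1,5)[OF k] xJ2[OF that(2) k]])
    then show ?thesis using False by (simp add: G_def[abs_def])
  qed (simp add: G_def[abs_def])
  have Grow: "row (insert j S) k z = G k z" if "k \<in> {a..m} - insert j S" "Im z \<noteq> 0" for k z
    using facts(8)[OF kb[OF that(1)] that(2)] by (cases "k = a") (auto simp: G_def row_a)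
  have \<Psi>nz: "\<Psi> k x \<noteq> 0" if "k \<in> {a..m} - insert j S" "x \<in> J" for k x
    using Gnz[OF that] by (simp add: G\<Psi>)
  have \<Psi>c: "continuous_on J (\<Psi> k)" if "k \<in> {a..m} - insert j S" for k
  proof (cases "k = a")
    case False
    note k = kb[OF that False]
    have "continuous_on J (\<lambda>x. P k + real_cauchy_int \<nu> J2 (u k) x)"
      by (intro continuous_intros continuous_on_real_cauchy_int[OF facts(3,4,1,5,2)[OF k]])
    then show ?thesis using False by (simp add: \<Psi>_def[abs_def])
  qed (simp add: \<Psi>_def[abs_def])
  define c0 where "c0 k = (if k = a then l0 else q0 k + P k * l0 + l1 * (LINT y:J2|\<nu>. u k y))" for k
  define c1 where "c1 k = (if k = a then l1 else q1 k + P k * l1)" for k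
  let ?D = "\<lambda>k x. e * \<Psi> k x"
  have Dc: "continuous_on J (?D k)" if "k \<in> {a..m} - insert j S" for k
    by (intro continuous_intros \<Psi>c[OF that])
  have rep0: "F k z / F j z = of_real (c0 k) + of_real (c1 k) * z + cauchy_int \<tau> J (?D k) z"
    if k: "k \<in> {a..m} - insert j S" and z: "Im z \<noteq> 0" for k z
  proof (cases "k = a")
    case True
    then show ?thesis using t(4)[OF nonreal_notin[OF z]] by (simp add: F_def[of a] c0_def c1_def \<Psi>_def)
  next
    case False
    note kb' = kb[OF k False]
    have kS: "k \<in> {b..m} - S" "k \<noteq> j" using kb' by auto
    have zJ: "z \<notin> cset J" "z \<notin> cset J2" using z by (auto intro: nonreal_notin)
    have Fjz: "F j z \<noteq> 0" using Fnz[OF ja(2) zJ(1)] .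
    have "row (insert j S) k z = row S k z - row S j z * R S k j z" by (rule row_insert[OF S j kS z])
    then have "F k z = F j z * R S k j z + (of_real (P k) + cauchy_int \<nu> J2 (u k) z)"
      using facts(8)[OF kb' z] Frow[OF _ z, of k] Frow[OF ja(2) z] kS by auto
    then have "F k z / F j z = R S k j z + (of_real (P k) + cauchy_int \<nu> J2 (u k) z) * (1 / F j z)"
      using Fjz by (simp add: field_simps)
    also have "\<dots> = of_real (q0 k) + of_real (q1 k) * z + cauchy_int \<nu> J2 (v k) z + (of_real (P k) + cauchy_int \<nu> J2 (u k) z) * (of_real l0 + of_real l1 * z + cauchy_int \<tau> J (\<lambda>_. e) z)"
      by (simp only: facts(7)[OF kb' zJ(2)] t(4)[OF zJ(1)])
    also have "\<dots> = of_real (q0 k + P k * l0 + l1 * (LINT y:J2|\<nu>. u k y)) + of_real (q1 k + P k * l1) * z + cauchy_int \<tau> J (\<lambda>x. e * (P k + real_cauchy_int \<nu> J2 (u k) x)) z"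
    proof (rule eliminate_second_cut[OF mt facts(3,4,1)[OF kb'] facts(6,5,2)[OF kb'] zJ])
      fix y assume y: "y \<in> J2"
      then have yJ: "complex_of_real y \<notin> cset J" using facts(2)[OF kb'] by auto
      have "1 / complex_of_real (p j + real_cauchy_int \<mu> J (d j) y) = of_real (l0 + l1 * y + real_cauchy_int \<tau> J (\<lambda>_. e) y)"
        using t(4)[OF yJ] by (simp add: Fj cauchy_int_eq_real_cauchy_int)
      then have "complex_of_real (1 / (p j + real_cauchy_int \<mu> J (d j) y)) = of_real (l0 + l1 * y + real_cauchy_int \<tau> J (\<lambda>_. e) y)"
        by simp
      then have 1: "l0 + l1 * y + real_cauchy_int \<tau> J (\<lambda>_. e) y = 1 / (p j + real_cauchy_int \<mu> J (d j) y)"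
        by (simp only: of_real_eq_iff)
      have "complex_of_real (p j + real_cauchy_int \<mu> J (d j) y) \<noteq> 0"
        using Fnz[OF ja(2) yJ] by (simp add: Fj cauchy_int_eq_real_cauchy_int)
      then have "p j + real_cauchy_int \<mu> J (d j) y \<noteq> 0" by (simp only: of_real_eq_0_iff not_False_eq_True)
      then show "u k y * (l0 + l1 * y + real_cauchy_int \<tau> J (\<lambda>_. e) y) = - v k y" unfolding 1 by (simp add: u_def)
    qed
    finally show ?thesis using False by (simp add: c0_def c1_def \<Psi>_def)
  qed
  have Rcont: "isCont (\<lambda>z. of_real (c0 k) + of_real (c1 k) * z + cauchy_int \<tau> J (?D k) z) z"
    if "k \<in> {a..m} - insert j S" "z \<notin> cset J" for k z
    by (intro continuous_intros isCont_cauchy_int[OF mt Dc[OF that(1)] that(2)])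
  have rep: "F k z / F j z = of_real (c0 k) + of_real (c1 k) * z + cauchy_int \<tau> J (?D k) z"
    if k: "k \<in> {a..m} - insert j S" and z: "z \<notin> cset J" for k z
  proof (rule nonreal_isCont_eq[OF _ Rcont[OF that] rep0[OF k]])
    show "isCont (\<lambda>z. F k z / F j z) z" using k by (intro continuous_intros Fcont Fnz ja(2) z) auto
  qed
  have lim: "c1 k = 0" "of_real (c0 k) = L" if k: "k \<in> {a..m} - insert j S" and L: "((\<lambda>z. F k z / F j z) \<longlongrightarrow> L) at_infinity" for k L
  proof -
    have "\<forall>\<^sub>F z in at_infinity. F k z / F j z = of_real (c0 k) + of_real (c1 k) * z + cauchy_int \<tau> J (?D k) z"
      using eventually_notin_cset[OF J(1)] by eventually_elim (rule rep[OF k])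
    from Lim_transform_eventually[OF L this] affine_plus_vanishing_limit[OF cauchy_int_tendsto_0[OF mt Dc[OF k]]]
    show "c1 k = 0" "of_real (c0 k) = L" by blast+
  qed
  have Flim: "(F k \<longlongrightarrow> of_real (if k = a then 1 else p k)) at_infinity" if "k \<in> {a..m} - S" for k
  proof (cases "k = a")
    case False
    then have k: "k \<in> {b..m} - S" using that by auto
    have "((\<lambda>z. of_real (p k) + cauchy_int \<mu> J (d k) z) \<longlongrightarrow> of_real (p k) + 0) at_infinity"
      by (intro tendsto_intros cauchy_int_tendsto_0[OF m rk(1)[OF k]])
    then show ?thesis using False by (simp add: F_def[abs_def])
  qed (simp add: F_def[abs_def])
  have small: "c1 k = 0" "a + card S < k \<Longrightarrow> c0 k = 0" if js: "j \<le> a + card S" and k: "k \<in> {a..m} - insert j S" for k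
  proof -
    have kS: "k \<in> {a..m} - S" using k by auto
    have pj: "p j \<noteq> 0" by (rule row_rep_small_nonzero'(1)[OF S j js rr])
    have "((\<lambda>z. F k z / F j z) \<longlongrightarrow> of_real (if k = a then 1 else p k) / of_real (if j = a then 1 else p j)) at_infinity"
      using pj ja by (intro tendsto_divide Flim kS) auto
    note l = lim[OF k this]
    show "c1 k = 0" by (rule l(1))
    show "c0 k = 0" if "a + card S < k"
    proof -
      have "p k = 0" using rk(4)[OF _ that] kS that by auto
      then show ?thesis using l(2) that by simp
    qed
  qed
  (* Both entries are of order 1/z, so their quotient is bounded. *)
  have large: "c1 k = 0" if js: "a + card S < j" and k: "k \<in> {a..m} - insert j S" and kl: "a + card S < k" for k
  proof -
    have kb': "k \<in> {b..m} - S" using k kl by auto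
    have pk: "p k = 0" "p j = 0" using rk(4)[OF kb' kl] rk(4)[OF j js] by auto
    have Mj: "(LINT x:J|\<mu>. d j x) \<noteq> 0" by (rule const_sign_mass_nonzero[OF hm J rk(1,2)[OF j]])
    have 1: "((\<lambda>z. z * cauchy_int \<mu> J (d k) z / (z * cauchy_int \<mu> J (d j) z)) \<longlongrightarrow>
        of_real (LINT x:J|\<mu>. d k x) / of_real (LINT x:J|\<mu>. d j x)) at_infinity"
      using Mj by (intro tendsto_divide cauchy_int_mult_z_tendsto m rk(1) kb' j) auto
    have "\<forall>\<^sub>F z::complex in at_infinity. z \<noteq> 0" unfolding eventually_at_infinity by (intro exI[of _ 1]) auto
    then have "\<forall>\<^sub>F z in at_infinity. z * cauchy_int \<mu> J (d k) z / (z * cauchy_int \<mu> J (d j) z) = F k z / F j z"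
      by eventually_elim (use pk kl ja in \<open>simp add: F_def\<close>)
    from lim(1)[OF k Lim_transform_eventually[OF 1 this]] show ?thesis .
  qed
  have "cut_rep I a m next_ratio S j \<tau> ?D c0 c1"
    unfolding cut_rep_def JS
  proof (intro conjI ballI allI impI)
    show "heavy_on J \<tau>" by (rule t(1))
    fix k assume k: "k \<in> {a..m} - insert j S"
    then have kS: "k \<in> {a..m} - S" by auto
    show "continuous_on J (?D k)" by (rule Dc[OF k])
    show "e * \<Psi> k x \<noteq> 0" if "x \<in> J" for x using \<Psi>nz[OF k that] t(2) by simp
    show "next_ratio S k j z = of_real (c0 k) + of_real (c1 k) * z + cauchy_int \<tau> J (?D k) z" if z: "z \<notin> cset J" for z
    proof -
      have "real_ext (\<lambda>z. row S k z / row S j z) z = of_real (c0 k) + of_real (c1 k) * z + cauchy_int \<tau> J (?D k) z"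
        by (rule real_ext_eq[OF Rcont[OF k z]]) (simp add: Frow[OF kS] Frow[OF ja(2)] rep0[OF k])
      then show ?thesis using k aS by (auto simp: next_ratio_def)
    qed
    show "c0 k = 0" if "j \<le> a + card S" "a + card S < k" using small(2)[OF that(1) k that(2)] .
    show "c1 k = 0" if "j \<le> a + card S" "a + card S < k" using small(1)[OF that(1) k] .
    show "c1 k = 0" if "k \<le> a + card S \<longrightarrow> j \<le> a + card S"
      using small(1)[OF _ k] large[OF _ k] that by (cases "j \<le> a + card S") auto
    fix l x assume l: "l \<in> {a..m} - insert j S" and x: "x \<in> J"
    show "next_ratio (insert j S) k l (of_real x) = of_real (e * \<Psi> k x / (e * \<Psi> l x))"
    proof (cases "k = l")
      case True
      then show ?thesis using \<Psi>nz[OF l x] t(2) by (simp add: next_ratio_def)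
    next
      case False
      have "real_ext (\<lambda>z. row (insert j S) k z / row (insert j S) l z) (of_real x) = G k (of_real x) / G l (of_real x)"
        by (rule real_ext_eq[where g = "\<lambda>z. G k z / G l z"])
          (intro continuous_intros Gcont[OF k x] Gcont[OF l x] Gnz[OF l x], simp add: Grow[OF k] Grow[OF l])
      then show ?thesis using False aS t(2) by (simp add: next_ratio_def G\<Psi>)
    qed
  qed
  then show ?thesis by blast
qed

lemma next_ratio_family: "minor_family I a m next_ratio"
  unfolding minor_family_def
proof (intro conjI allI impI)
  show "next_ratio S k k z = 1" for S k z by (simp add: next_ratio_def)
  show "next_ratio S k j z * next_ratio S j i z = next_ratio S k i z"
    if "S \<subseteq> {a..m} \<and> k \<in> {a..m} - S \<and> j \<in> {a..m} - S \<and> i \<in> {a..m} - S \<and> Im z \<noteq> 0" for S k j i z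
    using that by (elim conjE) (rule next_ratio_trans)
  show "next_ratio S k j z = next_ratio S i j z * next_ratio (insert j S) k i z + next_ratio (insert i S) k j z"
    if "S \<subseteq> {a..m} \<and> k \<in> {a..m} - S \<and> j \<in> {a..m} - S \<and> i \<in> {a..m} - S \<and>
       k \<noteq> j \<and> j \<noteq> i \<and> k \<noteq> i \<and> Im z \<noteq> 0" for S k j i z
    using that by (elim conjE) (rule next_ratio_pluecker)
  fix S j assume A: "S \<subseteq> {a..m} \<and> j \<in> {a..m} - S \<and> {a..m} - insert j S \<noteq> {}"
  show "\<exists>\<mu> d p0 p1. cut_rep I a m next_ratio S j \<mu> d p0 p1"
  proof (cases "a \<in> S")
    case True
    then show ?thesis using next_ratio_rep_in A by blast
  next
    case False
    then have S: "S \<subseteq> {b..m}" using A by (auto simp: Suc_le_eq order_less_le)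
    show ?thesis
    proof (cases "j = a")
      case True
      then show ?thesis using next_ratio_rep_a[OF S] A by blast
    next
      case False
      then have "j \<in> {b..m} - S" using A by auto
      then show ?thesis by (rule next_ratio_rep_j[OF S])
    qed
  qed
qed

lemma next_ratio_base: "k \<in> {b..m} \<Longrightarrow> z \<notin> cset (I b) \<Longrightarrow> next_ratio {} k a z = cauchy_int \<mu>0 (I b) (w k) z"
proof -
  assume k: "k \<in> {b..m}" and z: "z \<notin> cset (I b)"
  have "real_ext (\<lambda>z. row {} k z / row {} a z) z = cauchy_int \<mu>0 (I b) (w k) z"
  proof (rule real_ext_eq)
    show "isCont (cauchy_int \<mu>0 (I b) (w k)) z"
      using am I w(1)[OF k] by (intro isCont_cauchy_int[OF heavy_onD[OF \<mu>0]] z) auto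
  qed (use k in \<open>auto simp: row_def\<close>)
  then show ?thesis using k by (auto simp: next_ratio_def)
qed

end

section \<open>Divisors of linear forms\<close>

text \<open>
  Roots of \<open>q\<close> are split off one at a time; continuity of the cofactor restores the identity at the root itself.
\<close>
lemma poly_dvd_of_continuous_cofactor:
  fixes p q :: "complex poly"
  assumes "q \<noteq> 0" "open U" "\<And>z. poly q z = 0 \<Longrightarrow> z \<in> U" "continuous_on U H"
    "\<And>z. z \<in> U \<Longrightarrow> poly p z = poly q z * H z"
  shows "q dvd p"
  using assms
proof (induction "degree q" arbitrary: p q)
  case 0
  then obtain c where "q = [:c:]" by (metis degree_eq_zeroE)
  then show ?case using 0 by (simp add: const_poly_dvd_iff dvd_field_iff)
next
  case (Suc n)
  then have "\<not> constant (poly q)" by (simp add: constant_degree)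
  then obtain a where a: "poly q a = 0" using fundamental_theorem_of_algebra by blast
  then obtain q' where q': "q = [:- a, 1:] * q'" using poly_eq_0_iff_dvd by (metis dvd_def)
  have aU: "a \<in> U" using Suc.prems a by blast
  have "poly p a = 0" using Suc.prems(5)[OF aU] a by simp
  then obtain p' where p': "p = [:- a, 1:] * p'" using poly_eq_0_iff_dvd by (metis dvd_def)
  have q'0: "q' \<noteq> 0" using q' Suc.prems(1) by auto
  then have dq: "degree q = Suc (degree q')" unfolding q' by (subst degree_mult_eq) auto
  have eq: "poly p' z = poly q' z * H z" if z: "z \<in> U" for z
  proof (cases "z = a")
    case False
    have "(z - a) * poly p' z = (z - a) * (poly q' z * H z)"
      using Suc.prems(5)[OF z] by (simp add: p' q' algebra_simps)
    then show ?thesis using False by simp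
  next
    case True
    have H: "isCont H a" using Suc.prems(2,4) aU by (simp add: continuous_on_eq_continuous_at)
    have l: "((\<lambda>z. poly q' z * H z) \<longlongrightarrow> poly q' a * H a) (at a)" and l2: "(poly p' \<longlongrightarrow> poly p' a) (at a)"
      by (intro tendsto_mult H[unfolded isCont_def] poly_isCont[unfolded isCont_def])+
    have "\<forall>\<^sub>F z in at a. poly q' z * H z = poly p' z"
    proof -
      have "\<forall>\<^sub>F z in at a. z \<in> U \<and> z \<noteq> a"
        using eventually_at_in_open'[OF Suc.prems(2) aU] eventually_neq_at_within[of a a UNIV] by eventually_elim auto
      then show ?thesis
      proof eventually_elim
        case (elim z)
        have "(z - a) * poly p' z = (z - a) * (poly q' z * H z)"
          using Suc.prems(5)[of z] elim by (simp add: p' q' algebra_simps)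
        then show ?case using elim by simp
      qed
    qed
    from Lim_transform_eventually[OF l this] l2 show ?thesis
      using True tendsto_unique[OF trivial_limit_at] by blast
  qed
  have "q' dvd p'"
  proof (rule Suc.hyps(1)[OF _ q'0 Suc.prems(2) _ Suc.prems(4) eq])
    show "n = degree q'" using Suc.hyps(2) dq by simp
    show "z \<in> U" if "poly q' z = 0" for z using Suc.prems(3)[of z] that by (simp add: q')
  qed
  then show ?case unfolding p' q' by (rule mult_dvd_mono[OF dvd_refl])
qed

lemma degree_less_iff_coeff: "(p = 0 \<or> degree p < n) \<longleftrightarrow> (\<forall>i\<ge>n. coeff p i = 0)"
proof
  assume "p = 0 \<or> degree p < n"
  then show "\<forall>i\<ge>n. coeff p i = 0" by (auto intro: coeff_eq_0)
next
  assume "\<forall>i\<ge>n. coeff p i = 0"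
  then show "p = 0 \<or> degree p < n" by (metis leading_coeff_0_iff not_le)
qed

text \<open>
  Dividing the form by \<open>W\<close> and multiplying by \<open>Q\<close> gives a function \<open>Q H\<close> that is holomorphic off \<open>J\<close>, and it is the Cauchy
  transform of \<open>D Q / W\<close>: the polynomial remainders have degree below that of \<open>W\<close> and are divisible by \<open>W\<close>,
  hence zero. By the degree condition \<open>Q H\<close> is \<open>o(1/z)\<close> at infinity, so the total mass is zero.
\<close>
lemma orthogonality:
  assumes h: "heavy_on J \<mu>" "compact J" and D: "continuous_on J D"
    and W: "\<And>x. x \<in> J \<Longrightarrow> poly W x \<noteq> 0" and P: "P = 0 \<or> degree P < n"
    and H: "H holomorphic_on - cset J"
    and eq: "\<And>z. z \<notin> cset J \<Longrightarrow> poly (cpoly P) z + cauchy_int \<mu> J D z = poly (cpoly W) z * H z"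
    and Q: "degree Q + n < degree W"
  shows "(LINT x:J|\<mu>. D x * poly Q x / poly W x) = 0"
proof -
  note m = heavy_onD[OF h(1)] h(2)
  have W0: "W \<noteq> 0" using Q by auto
  define D2 where "D2 x = D x * poly Q x / poly W x" for x
  have D2: "continuous_on J D2" unfolding D2_def using D W by (intro continuous_intros) auto
  obtain E1 where E1: "E1 = 0 \<or> degree E1 < degree W"
    "\<And>z. z \<notin> cset J \<Longrightarrow> poly (cpoly W) z * cauchy_int \<mu> J D2 z = cauchy_int \<mu> J (\<lambda>x. poly W x * D2 x) z + poly (cpoly E1) z"
    using poly_mult_cauchy_int[OF m D2] by blast
  obtain E2 where E2: "E2 = 0 \<or> degree E2 < degree Q"
    "\<And>z. z \<notin> cset J \<Longrightarrow> poly (cpoly Q) z * cauchy_int \<mu> J D z = cauchy_int \<mu> J (\<lambda>x. poly Q x * D x) z + poly (cpoly E2) z"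
    using poly_mult_cauchy_int[OF m D] by blast
  have cc: "cauchy_int \<mu> J (\<lambda>x. poly W x * D2 x) z = cauchy_int \<mu> J (\<lambda>x. poly Q x * D x) z" for z
    by (rule cauchy_int_cong) (use W in \<open>simp add: D2_def\<close>)
  define X where "X = Q * P + E2 - E1"
  have X: "poly (cpoly X) z = poly (cpoly W) z * (poly (cpoly Q) z * H z - cauchy_int \<mu> J D2 z)" if z: "z \<notin> cset J" for z
  proof -
    have "poly (cpoly X) z = poly (cpoly Q) z * poly (cpoly P) z + poly (cpoly E2) z - poly (cpoly E1) z"
      by (simp add: X_def cpoly_diff cpoly_add cpoly_mult)
    also have "\<dots> = poly (cpoly Q) z * (poly (cpoly P) z + cauchy_int \<mu> J D z) - poly (cpoly W) z * cauchy_int \<mu> J D2 z"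
      using E1(2)[OF z] E2(2)[OF z] unfolding cc by (simp add: algebra_simps)
    also have "\<dots> = poly (cpoly W) z * (poly (cpoly Q) z * H z - cauchy_int \<mu> J D2 z)"
      unfolding eq[OF z] by (simp add: algebra_simps)
    finally show ?thesis .
  qed
  have op: "open (- cset J)" using cset_closed[OF h(2)] by (rule open_Compl)
  have "cpoly W dvd cpoly X"
  proof (rule poly_dvd_of_continuous_cofactor[OF _ op, where H = "\<lambda>z. poly (cpoly Q) z * H z - cauchy_int \<mu> J D2 z"])
    show "cpoly W \<noteq> 0" using W0 by (simp add: cpoly_eq_0_iff)
    show "z \<in> - cset J" if "poly (cpoly W) z = 0" for z
    proof
      assume "z \<in> cset J"
      then show False using that W by (auto simp: poly_cpoly_of_real)
    qed
    show "continuous_on (- cset J) (\<lambda>z. poly (cpoly Q) z * H z - cauchy_int \<mu> J D2 z)"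
      by (intro continuous_intros holomorphic_on_imp_continuous_on H cauchy_int_holomorphic[OF m D2])
  qed (use X in auto)
  moreover have "X = 0 \<or> degree X < degree W"
    unfolding degree_less_iff_coeff
  proof (intro allI impI)
    fix i assume i: "degree W \<le> i"
    have "coeff (Q * P) i = 0"
    proof (cases "P = 0")
      case False
      then show ?thesis using P Q i degree_mult_le[of Q P] by (intro coeff_eq_0) linarith
    qed simp
    moreover have "coeff E2 i = 0" using E2(1) Q i by (cases "E2 = 0") (auto intro!: coeff_eq_0)
    moreover have "coeff E1 i = 0" using E1(1) i by (cases "E1 = 0") (auto intro!: coeff_eq_0)
    ultimately show "coeff X i = 0" by (simp add: X_def)
  qed
  ultimately have "X = 0" by (metis cpoly_eq_0_iff degree_cpoly dvd_imp_degree_le not_le)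
  then have HQ: "poly (cpoly Q) z * H z = cauchy_int \<mu> J D2 z" if "z \<notin> cset J" "poly (cpoly W) z \<noteq> 0" for z
    using X[OF that(1)] that(2) by simp
  have Wev: "\<forall>\<^sub>F z in at_infinity. poly (cpoly W) z \<noteq> 0"
  proof -
    have "finite {z. poly (cpoly W) z = 0}" using W0 by (simp add: poly_roots_finite cpoly_eq_0_iff)
    then have "bounded {z. poly (cpoly W) z = 0}" by (rule finite_imp_bounded)
    then obtain B where "\<And>z. poly (cpoly W) z = 0 \<Longrightarrow> norm z \<le> B" by (auto simp: bounded_iff)
    then show ?thesis unfolding eventually_at_infinity by (intro exI[of _ "B + 1"]) force
  qed
  have lim: "((\<lambda>z. poly (cpoly A) z / poly (cpoly W) z) \<longlongrightarrow> 0) at_infinity" if "A = 0 \<or> degree A < degree W" for A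
  proof (cases "A = 0")
    case False
    then show ?thesis using that poly_divide_tendsto_0_at_infinity[of "cpoly A" "cpoly W"] by (simp add: degree_cpoly)
  qed simp
  have 1: "((\<lambda>z. poly (cpoly ([:0,1:] * Q * P)) z / poly (cpoly W) z +
      (z * cauchy_int \<mu> J D z) * (poly (cpoly Q) z / poly (cpoly W) z)) \<longlongrightarrow> 0 + of_real (LINT x:J|\<mu>. D x) * 0) at_infinity"
  proof (intro tendsto_intros lim cauchy_int_mult_z_tendsto[OF m D])
    show "[:0, 1:] * Q * P = 0 \<or> degree ([:0, 1:] * Q * P) < degree W"
    proof (cases "Q = 0 \<or> P = 0")
      case False
      have "degree ([:0, 1:] * Q * P) \<le> 1 + degree Q + degree P"
        using degree_mult_le[of "[:0,1:] * Q" P] degree_mult_le[of "[:0,1:]" Q] by simp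
      then show ?thesis using P Q False by auto
    qed auto
    show "Q = 0 \<or> degree Q < degree W" using Q by auto
  qed
  have "\<forall>\<^sub>F z in at_infinity. poly (cpoly ([:0,1:] * Q * P)) z / poly (cpoly W) z +
      (z * cauchy_int \<mu> J D z) * (poly (cpoly Q) z / poly (cpoly W) z) = z * cauchy_int \<mu> J D2 z"
    using Wev eventually_notin_cset[OF h(2)]
  proof eventually_elim
    case (elim z)
    have "poly (cpoly ([:0,1:] * Q * P)) z + (z * cauchy_int \<mu> J D z) * poly (cpoly Q) z = z * poly (cpoly Q) z * (poly (cpoly P) z + cauchy_int \<mu> J D z)"
      by (simp add: cpoly_mult cpoly_pCons algebra_simps del: mult_pCons_left)
    also have "\<dots> = z * (poly (cpoly Q) z * H z) * poly (cpoly W) z" unfolding eq[OF elim(2)] by simp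
    also have "\<dots> = z * cauchy_int \<mu> J D2 z * poly (cpoly W) z" unfolding HQ[OF elim(2,1)] by simp
    finally show ?case using elim(1) by (simp add: field_simps)
  qed
  from Lim_transform_eventually[OF 1 this] have "((\<lambda>z. z * cauchy_int \<mu> J D2 z) \<longlongrightarrow> 0) at_infinity" by simp
  from tendsto_unique[OF trivial_limit_at_infinity this cauchy_int_mult_z_tendsto[OF m D2]]
  show ?thesis by (simp add: D2_def)
qed

lemma family_holomorphic:
  assumes fam: "minor_family I a m R" and S: "S \<subseteq> {a..m}" and k: "k \<in> {a..m} - S" and j: "j \<in> {a..m} - S"
    and I: "\<And>i. a < i \<Longrightarrow> i \<le> m \<Longrightarrow> compact (I i)"
  shows "R S k j holomorphic_on - cset (I (Suc (a + card S)))"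
proof (cases "k = j")
  case True
  then have "R S k j = (\<lambda>_. 1)" using fam by (auto simp: minor_family_def)
  then show ?thesis by simp
next
  case False
  have "\<exists>\<mu> d p0 p1. cut_rep I a m R S j \<mu> d p0 p1"
    by (rule fam[unfolded minor_family_def, THEN conjunct2, THEN conjunct2, THEN conjunct2, rule_format])
      (use S j k False in auto)
  then obtain \<mu> d p0 p1 where cr: "cut_rep I a m R S j \<mu> d p0 p1" by blast
  define J where "J = I (Suc (a + card S))"
  have kk: "k \<in> {a..m} - insert j S" using k False by auto
  have r: "heavy_on J \<mu>" "continuous_on J (d k)"
    "\<And>z. z \<notin> cset J \<Longrightarrow> R S k j z = of_real (p0 k) + of_real (p1 k) * z + cauchy_int \<mu> J (d k) z"
    using cr kk unfolding cut_rep_def J_def by auto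
  have "card (insert j (insert k S)) \<le> card {a..m}" using S k j by (intro card_mono) auto
  moreover have "card (insert j (insert k S)) = Suc (Suc (card S))" using False k j finite_subset[OF S] by simp
  ultimately have "compact J" using I unfolding J_def by simp
  then have "(\<lambda>z. of_real (p0 k) + of_real (p1 k) * z + cauchy_int \<mu> J (d k) z) holomorphic_on - cset J"
    by (intro holomorphic_intros cauchy_int_holomorphic heavy_onD[OF r(1)] r(2))
  then show ?thesis unfolding J_def[symmetric] by (rule holomorphic_transform) (simp add: r(3))
qed

lemma interval_limpt_minus_finite:
  fixes \<alpha> \<beta> :: real
  assumes "\<alpha> < \<beta>" "x \<in> {\<alpha>..\<beta>}" "finite F"
  shows "x islimpt ({\<alpha>..\<beta>} - F)"
proof -
  have "x islimpt {\<alpha>..\<beta>}" using assms(1,2) by (simp add: islimpt_Icc)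
  moreover have "{\<alpha>..\<beta>} \<subseteq> ({\<alpha>..\<beta>} - F) \<union> F" by auto
  ultimately have "x islimpt (({\<alpha>..\<beta>} - F) \<union> F)" using islimpt_subset by blast
  then have "x islimpt ({\<alpha>..\<beta>} - F) \<or> x islimpt F" by (rule islimpt_Un[THEN iffD1])
  then show ?thesis using islimpt_finite[OF assms(3)] by blast
qed

text \<open>
  Counting zeros through real polynomial divisors without roots on the cut takes care of multiplicities and of
  conjugate pairs at the same time, and such a polynomial can serve directly as a varying weight on the cut.
\<close>
definition divides_off :: "real set \<Rightarrow> (complex \<Rightarrow> complex) \<Rightarrow> real poly \<Rightarrow> bool" where
  "divides_off J f W \<longleftrightarrow> W \<noteq> 0 \<and> (\<forall>x\<in>J. poly W x \<noteq> 0) \<and>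
     (\<exists>H. H holomorphic_on - cset J \<and> (\<forall>z. z \<notin> cset J \<longrightarrow> f z = poly (cpoly W) z * H z))"

lemma holomorphic_factor_root:
  assumes "open U" "H holomorphic_on U" "a \<in> U" "H a = 0"
  obtains H1 where "H1 holomorphic_on U" "\<And>z. H z = (z - a) * H1 z"
proof -
  define H1 where "H1 z = (if z = a then deriv H a else (H z - H a) / (z - a))" for z
  have "H1 holomorphic_on U" unfolding H1_def using assms by (intro pole_lemma) (auto simp: interior_open)
  moreover have "H z = (z - a) * H1 z" for z using assms(4) by (simp add: H1_def)
  ultimately show ?thesis using that by blast
qed

text \<open>
  With \<open>Q\<close> of maximal degree the cofactor cannot vanish at a real point off the cut, since the corresponding linear factor
  could be moved into \<open>Q\<close>. On an interval \<open>J\<close> a real cofactor therefore has constant sign.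
\<close>
lemma maximal_divisor:
  assumes J2: "closed (cset J2)" "J \<inter> J2 = {}"
    and f: "f holomorphic_on - cset J2"
    and bound: "\<And>Q. divides_off J2 f Q \<Longrightarrow> degree Q < M"
  obtains Q H where "divides_off J2 f Q" "H holomorphic_on - cset J2"
    "\<And>z. z \<notin> cset J2 \<Longrightarrow> f z = poly (cpoly Q) z * H z" "\<And>x. x \<in> J \<Longrightarrow> H (of_real x) \<noteq> 0"
proof -
  have "divides_off J2 f 1" using f unfolding divides_off_def by auto
  then obtain Q where Q: "divides_off J2 f Q" and mx: "\<And>Q'. divides_off J2 f Q' \<Longrightarrow> degree Q' \<le> degree Q"
    using ex_has_greatest_nat[of "divides_off J2 f" 1 degree M] bound by (meson less_imp_le)
  then obtain H where H: "H holomorphic_on - cset J2" "\<And>z. z \<notin> cset J2 \<Longrightarrow> f z = poly (cpoly Q) z * H z"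
    and Q0: "Q \<noteq> 0" "\<And>x. x \<in> J2 \<Longrightarrow> poly Q x \<noteq> 0" by (auto simp: divides_off_def)
  show ?thesis
  proof (rule that[OF Q H])
    fix x assume x: "x \<in> J"
    show "H (of_real x) \<noteq> 0"
    proof
      assume Hx: "H (of_real x) = 0"
      have xJ: "x \<notin> J2" using x J2 by auto
      then have "complex_of_real x \<in> - cset J2" by auto
      then obtain H3 where H3: "H3 holomorphic_on - cset J2" and eq: "\<And>z. H z = (z - of_real x) * H3 z"
        using holomorphic_factor_root[OF open_Compl[OF J2(1)] H(1) _ Hx] by blast
      have "divides_off J2 f (Q * [:- x, 1:])"
        unfolding divides_off_def
      proof (intro conjI exI[of _ H3] ballI allI impI H3)
        show "f z = poly (cpoly (Q * [:- x, 1:])) z * H3 z" if "z \<notin> cset J2" for z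
          using H(2)[OF that] eq[of z] by (simp add: cpoly_mult cpoly_pCons algebra_simps del: mult_pCons_right)
        show "Q * [:- x, 1:] \<noteq> 0" using Q0(1) by (simp del: mult_pCons_right)
      qed (use Q0 xJ in auto)
      from mx[OF this] show False using Q0 by (simp add: degree_mult_eq del: mult_pCons_right)
    qed
  qed
qed

text \<open>
  Induction on the number of columns outside \<open>S\<close>. For a single column the cut is empty and the form is a polynomial.
  Otherwise the form may be divided by any of its functions, and \<open>j\<close> is chosen to
  maximise \<open>n k\<close>, where a small index counts one more. By the growth clauses of \<open>cut_rep\<close> the polynomial part \<open>P\<close> of the
  quotient form then has degree less than \<open>n j\<close>, so the density \<open>D\<close> of its Cauchy part, divided by \<open>W\<close>, is
  orthogonal to polynomials of degree less than \<open>degree W - n j\<close>. But \<open>D\<close> divided by one of the weights is the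
  form for \<open>S \<union> {j}\<close>, and the induction hypothesis bounds the degree of its maximal real divisor \<open>Q\<close>. If \<open>W\<close> had too
  large a degree, \<open>Q\<close> would be an admissible test polynomial, while \<open>D Q\<close> has constant sign up to finitely
  many zeros: a contradiction.
\<close>
lemma degree_divisor_of_form_less:
  assumes fam: "minor_family I a m R"
    and I: "\<And>i. a < i \<Longrightarrow> i \<le> m \<Longrightarrow> compact (I i)" "\<And>i. a < i \<Longrightarrow> i \<le> m \<Longrightarrow> connected (I i)"
    and disj: "\<And>i. a < i \<Longrightarrow> i < m \<Longrightarrow> I i \<inter> I (Suc i) = {}" and last: "I (Suc m) = {}"
  shows "S \<subseteq> {a..m} \<Longrightarrow> j0 \<in> {a..m} - S \<Longrightarrow> (\<And>k. k \<in> {a..m} - S \<Longrightarrow> p k = 0 \<or> degree (p k) < n k) \<Longrightarrow>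
     k0 \<in> {a..m} - S \<Longrightarrow> p k0 \<noteq> 0 \<Longrightarrow>
     divides_off (I (Suc (a + card S))) (\<lambda>z. \<Sum>k\<in>{a..m} - S. poly (cpoly (p k)) z * R S k j0 z) W \<Longrightarrow>
     degree W < (\<Sum>k\<in>{a..m} - S. n k)"
proof (induction "card ({a..m} - S)" arbitrary: S j0 k0 p W rule: less_induct)
  case (less S j0 k0 p W)
  note S = less.prems(1) and j0 = less.prems(2) and p = less.prems(3)
  define K where "K = {a..m} - S"
  have finS: "finite S" using S finite_subset by blast
  have finK: "finite K" by (simp add: K_def)
  define t where "t = a + card S"
  define J where "J = I (Suc t)"
  obtain H0 where W: "W \<noteq> 0" "\<And>x. x \<in> J \<Longrightarrow> poly W x \<noteq> 0" and H0: "H0 holomorphic_on - cset J"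
    "\<And>z. z \<notin> cset J \<Longrightarrow> (\<Sum>k\<in>K. poly (cpoly (p k)) z * R S k j0 z) = poly (cpoly W) z * H0 z"
    using less.prems(6) by (auto simp: divides_off_def J_def K_def t_def)
  have one: "R S' k k z = 1" for S' k z using fam by (simp add: minor_family_def)
  have cK: "card S + card K = Suc m - a"
  proof -
    have "card K = card {a..m} - card S" unfolding K_def using S finS by (intro card_Diff_subset) auto
    moreover have "card S \<le> card {a..m}" using S by (intro card_mono) auto
    ultimately show ?thesis by simp
  qed
  show ?case
  proof (cases "\<exists>j. K = {j}")
    case True
    then obtain j where Kj: "K = {j}" by blast
    then have jj: "j0 = j" "k0 = j" using less.prems(2,4) by (auto simp: K_def[symmetric])
    have "a \<le> m" using j0 by auto
    then have "a + card S = m" using cK Kj by simp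
    then have "J = {}" using last by (simp add: J_def t_def)
    then have eq: "poly (cpoly (p j)) z = poly (cpoly W) z * H0 z" for z
      using H0(2)[of z] by (simp add: Kj jj one)
    have "cpoly W dvd cpoly (p j)"
      by (rule poly_dvd_of_continuous_cofactor[of _ UNIV H0]) (use W H0(1) eq \<open>J = {}\<close> in \<open>auto simp: cpoly_eq_0_iff holomorphic_on_imp_continuous_on\<close>)
    then have "degree W \<le> degree (p j)"
      using dvd_imp_degree_le[of "cpoly W" "cpoly (p j)"] less.prems(5) jj by (simp add: degree_cpoly cpoly_eq_0_iff)
    also have "\<dots> < n j" using p[of j] less.prems(5) jj Kj by (auto simp: K_def[symmetric])
    finally show ?thesis unfolding K_def[symmetric] Kj by simp
  next
    case False
    (* The extra one for small indices makes room for the affine part of small over large. *)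
    define key where "key k = n k + (if k \<le> t then 1 else 0)" for k
    have "j0 \<in> K" using j0 by (simp add: K_def)
    then have "Max (key ` K) \<in> key ` K" using finK by (intro Max_in) auto
    then obtain j where j: "j \<in> K" and jm: "Max (key ` K) = key j" by auto
    have mx: "key k \<le> key j" if "k \<in> K" for k unfolding jm[symmetric] using finK that by auto
    obtain k1 where "k1 \<in> K" "k1 \<noteq> j" using False j by blast
    then have ne: "{a..m} - insert j S \<noteq> {}" by (auto simp: K_def)
    define K' where "K' = {a..m} - insert j S"
    have K': "K' = K - {j}" by (auto simp: K'_def K_def)
    have jS: "j \<in> {a..m} - S" using j by (simp add: K_def)
    have Sj: "insert j S \<subseteq> {a..m}" "card (insert j S) = Suc (card S)" using S jS finS by auto
    have le: "t < m"
    proof -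
      have "{j, k1} \<subseteq> K" using j \<open>k1 \<in> K\<close> by auto
      then have "card {j, k1} \<le> card K" using finK by (intro card_mono)
      then show ?thesis using cK \<open>k1 \<noteq> j\<close> by (simp add: t_def)
    qed
    have J: "compact J" "connected J" using I le by (auto simp: J_def t_def)
    have op: "open (- cset J)" using cset_closed[OF J(1)] by (rule open_Compl)
    have "\<exists>\<mu> d p0 p1. cut_rep I a m R S j \<mu> d p0 p1"
      by (rule fam[unfolded minor_family_def, THEN conjunct2, THEN conjunct2, THEN conjunct2, rule_format])
        (use S jS ne in auto)
    then obtain \<mu> d q0 q1 where cr: "cut_rep I a m R S j \<mu> d q0 q1" by blast
    have hm: "heavy_on J \<mu>" using cr by (simp add: cut_rep_def J_def t_def)
    note m = heavy_onD[OF hm] J(1)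
    have ck: "continuous_on J (d k)" "\<And>x. x \<in> J \<Longrightarrow> d k x \<noteq> 0"
      "\<And>z. z \<notin> cset J \<Longrightarrow> R S k j z = of_real (q0 k) + of_real (q1 k) * z + cauchy_int \<mu> J (d k) z"
      "j \<le> t \<Longrightarrow> t < k \<Longrightarrow> q0 k = 0 \<and> q1 k = 0" "(k \<le> t \<Longrightarrow> j \<le> t) \<Longrightarrow> q1 k = 0"
      "\<And>l x. l \<in> K' \<Longrightarrow> x \<in> J \<Longrightarrow> R (insert j S) k l (of_real x) = of_real (d k x / d l x)"
      if "k \<in> K'" for k
      using cr that unfolding cut_rep_def J_def[unfolded t_def, symmetric] K'_def[symmetric] t_def by auto
    have hol: "R S k i holomorphic_on - cset J" if "k \<in> K" "i \<in> K" for k i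
      unfolding J_def t_def using that by (intro family_holomorphic[OF fam S] I) (auto simp: K_def)
    define H where "H z = H0 z * R S j0 j z" for z
    have H: "H holomorphic_on - cset J" unfolding H_def
      using H0(1) hol[OF \<open>j0 \<in> K\<close> j] by (rule holomorphic_on_mult)
    have iC: "isCont f z" if "f holomorphic_on - cset J" "z \<notin> cset J" for f z
      using holomorphic_on_imp_continuous_on[OF that(1)] that(2) op by (simp add: continuous_on_eq_continuous_at)
    have LH: "(\<Sum>k\<in>K. poly (cpoly (p k)) z * R S k j z) = poly (cpoly W) z * H z" if z: "z \<notin> cset J" for z
    proof (rule nonreal_isCont_eq[where f = "\<lambda>z. \<Sum>k\<in>K. poly (cpoly (p k)) z * R S k j z" and g = "\<lambda>z. poly (cpoly W) z * H z"])
      show "isCont (\<lambda>z. \<Sum>k\<in>K. poly (cpoly (p k)) z * R S k j z) z"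
        by (intro iC[OF _ z] holomorphic_intros hol j) auto
      show "isCont (\<lambda>z. poly (cpoly W) z * H z) z"
        by (intro iC[OF _ z] holomorphic_intros H)
      fix w :: complex assume w: "Im w \<noteq> 0"
      have tr: "R S k j w = R S k j0 w * R S j0 j w" if "k \<in> K" for k
        by (rule fam[unfolded minor_family_def, THEN conjunct2, THEN conjunct1, rule_format, symmetric])
          (use that S w j \<open>j0 \<in> K\<close> in \<open>auto simp: K_def\<close>)
      have "(\<Sum>k\<in>K. poly (cpoly (p k)) w * R S k j w) = (\<Sum>k\<in>K. poly (cpoly (p k)) w * R S k j0 w) * R S j0 j w"
        unfolding sum_distrib_right by (rule sum.cong[OF refl]) (simp add: tr)
      then show "(\<Sum>k\<in>K. poly (cpoly (p k)) w * R S k j w) = poly (cpoly W) w * H w"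
        using H0(2)[OF nonreal_notin[OF w]] by (simp add: H_def)
    qed
    have "\<forall>k\<in>K'. \<exists>E. (E = 0 \<or> degree E < degree (p k)) \<and>
      (\<forall>z. z \<notin> cset J \<longrightarrow> poly (cpoly (p k)) z * cauchy_int \<mu> J (d k) z = cauchy_int \<mu> J (\<lambda>x. poly (p k) x * d k x) z + poly (cpoly E) z)"
      (is "\<forall>k\<in>K'. \<exists>E. ?good k E")
    proof
      fix k assume k: "k \<in> K'"
      show "\<exists>E. ?good k E" using poly_mult_cauchy_int[OF m ck(1)[OF k], of "p k"] by blast
    qed
    from bchoice[OF this] obtain E where "\<forall>k\<in>K'. ?good k (E k)" by blast
    then have E: "\<And>k. k \<in> K' \<Longrightarrow> E k = 0 \<or> degree (E k) < degree (p k)"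
      "\<And>k z. k \<in> K' \<Longrightarrow> z \<notin> cset J \<Longrightarrow> poly (cpoly (p k)) z * cauchy_int \<mu> J (d k) z = cauchy_int \<mu> J (\<lambda>x. poly (p k) x * d k x) z + poly (cpoly (E k)) z"
      by blast+
    define D where "D x = (\<Sum>k\<in>K'. poly (p k) x * d k x)" for x
    define P where "P = p j + (\<Sum>k\<in>K'. p k * [:q0 k, q1 k:] + E k)"
    have Dc: "continuous_on J D" unfolding D_def by (intro continuous_intros ck(1))
    have DP: "poly (cpoly P) z + cauchy_int \<mu> J D z = poly (cpoly W) z * H z" if z: "z \<notin> cset J" for z
    proof -
      have "cauchy_int \<mu> J (\<lambda>x. \<Sum>k\<in>F. poly (p k) x * d k x) z = (\<Sum>k\<in>F. cauchy_int \<mu> J (\<lambda>x. poly (p k) x * d k x) z)"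
        if "finite F" "F \<subseteq> K'" for F
        using that
      proof (induction F rule: finite_induct)
        case empty
        then show ?case by (simp add: cauchy_int_def set_lebesgue_integral_def)
      next
        case (insert x F)
        have "continuous_on J (\<lambda>xa. poly (p x) xa * d x xa)" "continuous_on J (\<lambda>xa. \<Sum>k\<in>F. poly (p k) xa * d k xa)"
          using insert.prems by (auto intro!: continuous_intros ck(1))
        then show ?case using insert by (simp add: cauchy_int_add[OF m _ _ z])
      qed
      then have Dz: "cauchy_int \<mu> J D z = (\<Sum>k\<in>K'. cauchy_int \<mu> J (\<lambda>x. poly (p k) x * d k x) z)"
        unfolding D_def using finK K' by simp
      have "poly (cpoly P) z + cauchy_int \<mu> J D z = poly (cpoly (p j)) z + (\<Sum>k\<in>K'. poly (cpoly (p k)) z * (of_real (q0 k) + of_real (q1 k) * z) + (cauchy_int \<mu> J (\<lambda>x. poly (p k) x * d k x) z + poly (cpoly (E k)) z))"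
        unfolding Dz P_def by (simp add: cpoly_add cpoly_sum cpoly_mult cpoly_pCons poly_sum sum.distrib algebra_simps del: mult_pCons_right)
      also have "\<dots> = poly (cpoly (p j)) z + (\<Sum>k\<in>K'. poly (cpoly (p k)) z * R S k j z)"
      proof (intro arg_cong2[of _ _ _ _ "(+)"] refl sum.cong)
        fix k assume k: "k \<in> K'"
        show "poly (cpoly (p k)) z * (of_real (q0 k) + of_real (q1 k) * z) + (cauchy_int \<mu> J (\<lambda>x. poly (p k) x * d k x) z + poly (cpoly (E k)) z) = poly (cpoly (p k)) z * R S k j z"
          by (simp only: E(2)[OF k z, symmetric] ck(3)[OF k z] distrib_left)
      qed
      also have "\<dots> = (\<Sum>k\<in>K. poly (cpoly (p k)) z * R S k j z)"
        using sum.remove[OF finK j, of "\<lambda>k. poly (cpoly (p k)) z * R S k j z"] by (simp add: one K')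
      also have "\<dots> = poly (cpoly W) z * H z" by (rule LH[OF z])
      finally show ?thesis .
    qed
    have Pdeg: "P = 0 \<or> degree P < n j"
      unfolding degree_less_iff_coeff
    proof (intro allI impI)
      fix i assume i: "n j \<le> i"
      have 1: "coeff (p j) i = 0" using p[OF jS] i degree_less_iff_coeff by blast
      have 2: "coeff (p k * [:q0 k, q1 k:] + E k) i = 0" if k: "k \<in> K'" for k
      proof (cases "p k = 0")
        case True
        then show ?thesis using E(1)[OF k] by auto
      next
        case False
        have kK: "k \<in> K" "k \<in> {a..m} - S" using k by (auto simp: K' K_def)
        have dk: "degree (p k) < n k" using p[OF kK(2)] False by blast
        have m1: "n k + (if k \<le> t then 1 else 0) \<le> n j + (if j \<le> t then 1 else 0)" using mx[OF kK(1)] by (simp add: key_def)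
        have "coeff (E k) i = 0"
          using E(1)[OF k] dk m1 i by (cases "E k = 0") (auto intro!: coeff_eq_0 split: if_splits)
        moreover have "coeff (p k * [:q0 k, q1 k:]) i = 0"
        proof (cases "q1 k = 0")
          case q1: True
          show ?thesis
          proof (cases "q0 k = 0")
            case q0: False
            then have "\<not> (j \<le> t \<and> t < k)" using ck(4)[OF k] by blast
            then have "n k \<le> n j" using m1 by (auto split: if_splits)
            then show ?thesis using q1 dk i by (simp add: coeff_eq_0)
          qed (simp add: q1)
        next
          case False
          then have "k \<le> t" "\<not> j \<le> t" using ck(5)[OF k] by blast+
          then have "n k + 1 \<le> n j" using m1 by simp
          moreover have "degree (p k * [:q0 k, q1 k:]) \<le> degree (p k) + 1"
          proof -
            have "degree [:q0 k, q1 k:] \<le> 1" by simp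
            then show ?thesis using degree_mult_le[of "p k" "[:q0 k, q1 k:]"] by linarith
          qed
          ultimately show ?thesis using dk i by (intro coeff_eq_0) linarith
        qed
        ultimately show ?thesis by (simp del: mult_pCons_right)
      qed
      show "coeff P i = 0" unfolding P_def using 1 2 by (simp add: coeff_sum del: mult_pCons_right)
    qed
    have nsum: "(\<Sum>k\<in>K. n k) = n j + (\<Sum>k\<in>K'. n k)" unfolding K' by (rule sum.remove[OF finK j])
    show ?thesis
      unfolding K_def[symmetric]
    proof (rule ccontr)
      assume "\<not> degree W < sum n K"
      then have big: "n j + (\<Sum>k\<in>K'. n k) \<le> degree W" by (simp add: nsum)
      show False
      proof (cases "\<exists>k\<in>K'. p k \<noteq> 0")
        case False
        then have "D = (\<lambda>_. 0)" by (simp add: D_def fun_eq_iff)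
        then have PW: "poly (cpoly P) z = poly (cpoly W) z * H z" if "z \<notin> cset J" for z
          using DP[OF that] by (simp add: cauchy_int_def set_lebesgue_integral_def)
        have "cpoly W dvd cpoly P"
        proof (rule poly_dvd_of_continuous_cofactor[OF _ op])
          show "z \<in> - cset J" if "poly (cpoly W) z = 0" for z
          proof
            assume "z \<in> cset J"
            then show False using that W by (auto simp: poly_cpoly_of_real)
          qed
        qed (use W PW in \<open>auto simp: cpoly_eq_0_iff intro!: holomorphic_on_imp_continuous_on[OF H]\<close>)
        moreover have "P = p j" using False E(1) by (simp add: P_def)
        moreover have "p j \<noteq> 0"
        proof
          assume "p j = 0"
          moreover have "k0 = j \<or> k0 \<in> K'" using less.prems(4) by (auto simp: K'_def)
          ultimately show False using False less.prems(5) by auto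
        qed
        ultimately have "degree W \<le> degree P" "P \<noteq> 0"
          using dvd_imp_degree_le[of "cpoly W" "cpoly P"] by (auto simp: degree_cpoly cpoly_eq_0_iff)
        then show False using Pdeg big by auto
      next
        case True
        then obtain k2 where k2: "k2 \<in> K'" "p k2 \<noteq> 0" by blast
        define J2 where "J2 = I (Suc (Suc t))"
        have JJ2: "J \<inter> J2 = {}" using disj[of "Suc t"] le last by (cases "Suc t = m") (auto simp: J_def J2_def t_def)
        have cut2: "I (Suc (a + card (insert j S))) = J2" by (simp add: Sj J2_def t_def)
        have cl2: "closed (cset J2)"
        proof (cases "Suc t = m")
          case True then show ?thesis using last by (simp add: J2_def)
        next
          case False then show ?thesis using I(1)[of "Suc (Suc t)"] le by (intro cset_closed) (simp add: J2_def t_def)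
        qed
        (* The density D divided by the weight of column k2: a form in the family with one column less. *)
        define L2 where "L2 z = (\<Sum>k\<in>K'. poly (cpoly (p k)) z * R (insert j S) k k2 z)" for z
        have L2h: "L2 holomorphic_on - cset J2" unfolding L2_def cut2[symmetric]
          by (intro holomorphic_intros family_holomorphic[OF fam Sj(1)] I) (use k2 in \<open>auto simp: K'_def\<close>)
        have IH: "degree Q < (\<Sum>k\<in>K'. n k)" if "divides_off J2 L2 Q" for Q
          unfolding K'_def
        proof (rule less.hyps[where p = p])
          show "card ({a..m} - insert j S) < card ({a..m} - S)" 
            unfolding K'_def[symmetric] K' K_def[symmetric] by (rule card_Diff1_less[OF finK j])
          show "divides_off (I (Suc (a + card (insert j S)))) (\<lambda>z. \<Sum>k\<in>{a..m} - insert j S. poly (cpoly (p k)) z * R (insert j S) k k2 z) Q"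
            using that unfolding cut2 L2_def K'_def .
        qed (use Sj k2 p in \<open>auto simp: K'_def\<close>)
        obtain Q H2 where Q: "divides_off J2 L2 Q" and H2: "H2 holomorphic_on - cset J2"
          "\<And>z. z \<notin> cset J2 \<Longrightarrow> L2 z = poly (cpoly Q) z * H2 z" "\<And>x. x \<in> J \<Longrightarrow> H2 (of_real x) \<noteq> 0"
          using maximal_divisor[OF cl2 JJ2 L2h IH] by blast
        have Q0: "Q \<noteq> 0" using Q by (simp add: divides_off_def)
        have ort: "(LINT x:J|\<mu>. D x * poly Q x / poly W x) = 0"
          by (rule orthogonality[OF hm J(1) Dc W(2) Pdeg H DP]) (use IH[OF Q] big in auto)
        have L2x: "L2 (of_real x) = of_real (D x / d k2 x)" if x: "x \<in> J" for x
        proof -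
          have "L2 (of_real x) = (\<Sum>k\<in>K'. of_real (poly (p k) x * (d k x / d k2 x)))"
            unfolding L2_def by (intro sum.cong refl) (simp add: ck(6)[OF _ k2(1) x] poly_cpoly_of_real)
          also have "\<dots> = of_real (D x / d k2 x)" by (simp add: D_def sum_divide_distrib)
          finally show ?thesis .
        qed
        have xJ2: "complex_of_real x \<notin> cset J2" if "x \<in> J" for x using that JJ2 by auto
        have H2c: "continuous_on J (\<lambda>x. H2 (of_real x))"
        proof -
          have "continuous_on J (H2 \<circ> of_real)"
          proof (intro continuous_on_compose continuous_on_of_real_id)
            have "cset J \<subseteq> - cset J2" using JJ2 by auto
            then show "continuous_on (cset J) H2"
              by (rule continuous_on_subset[OF holomorphic_on_imp_continuous_on[OF H2(1)]])
          qed
          then show ?thesis by (simp add: o_def)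
        qed
        obtain \<alpha> \<beta> where ab: "\<alpha> < \<beta>" "J = {\<alpha>..\<beta>}" using heavy_on_interval[OF hm J] .
        have finQ: "finite {x. poly Q x = 0}" using Q0 by (rule poly_roots_finite)
        (* The cofactor is real on J off the roots of Q, hence everywhere on J by continuity. *)
        have Im0: "Im (H2 (of_real x)) = 0" if x: "x \<in> J" for x
        proof -
          let ?F = "at x within (J - {x. poly Q x = 0})"
          have "x islimpt (J - {x. poly Q x = 0})"
            using interval_limpt_minus_finite[OF ab(1) _ finQ] x ab(2) by simp
          then have nb: "?F \<noteq> bot" by (simp add: trivial_limit_within)
          have "((\<lambda>x. Im (H2 (of_real x))) \<longlongrightarrow> Im (H2 (of_real x))) ?F"
            using H2c x by (intro tendsto_Im) (auto simp: continuous_on_def intro: tendsto_within_subset)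
          moreover have "\<forall>\<^sub>F x in ?F. Im (H2 (of_real x)) = 0"
          proof -
            have "Im (H2 (of_real y)) = 0" if y: "y \<in> J" "poly Q y \<noteq> 0" for y
            proof -
              have "of_real (poly Q y) * H2 (of_real y) = of_real (D y / d k2 y)"
                using H2(2)[OF xJ2[OF y(1)]] L2x[OF y(1)] by (simp add: poly_cpoly_of_real)
              then have "Im (of_real (poly Q y) * H2 (of_real y)) = 0" by (simp only: Im_complex_of_real)
              then show ?thesis using y(2) by simp
            qed
            then show ?thesis by (auto simp: eventually_at_filter)
          qed
          then have "((\<lambda>x. Im (H2 (of_real x))) \<longlongrightarrow> 0) ?F" by (rule tendsto_eventually)
          ultimately show ?thesis using tendsto_unique[OF nb] by blast
        qed
        define g where "g x = Re (H2 (of_real x))" for x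
        have gc: "continuous_on J g" unfolding g_def by (intro continuous_intros H2c)
        have gnz: "g x \<noteq> 0" if "x \<in> J" for x
          using H2(3)[OF that] Im0[OF that] by (auto simp: g_def complex_eq_iff)
        have Dg: "D x = d k2 x * (poly Q x * g x)" if x: "x \<in> J" for x
        proof -
          have "of_real (poly Q x) * H2 (of_real x) = of_real (D x / d k2 x)"
            using H2(2)[OF xJ2[OF x]] L2x[OF x] by (simp add: poly_cpoly_of_real)
          then have "Re (of_real (poly Q x) * H2 (of_real x)) = D x / d k2 x" by (simp only: Re_complex_of_real)
          then show ?thesis using ck(2)[OF k2(1) x] by (simp add: g_def field_simps)
        qed
        have "(LINT x:J|\<mu>. (poly Q x)\<^sup>2 * (d k2 x * g x / poly W x)) \<noteq> 0"
        proof (rule const_sign_integral_nonzero[OF hm J])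
          show "continuous_on J (\<lambda>x. d k2 x * g x / poly W x)"
            using W(2) by (intro continuous_intros ck(1) k2 gc) auto
          show "d k2 x * g x / poly W x \<noteq> 0" if "x \<in> J" for x
            using ck(2)[OF k2(1) that] gnz[OF that] W(2)[OF that] by simp
          have "{x\<in>J. (poly Q x)\<^sup>2 = 0} \<subseteq> {x. poly Q x = 0}" by auto
          then show "finite {x\<in>J. (poly Q x)\<^sup>2 = 0}" using finQ by (rule finite_subset)
        qed (auto intro!: continuous_intros)
        moreover have "(LINT x:J|\<mu>. (poly Q x)\<^sup>2 * (d k2 x * g x / poly W x)) = (LINT x:J|\<mu>. D x * poly Q x / poly W x)"
          by (rule set_integral_cong_on) (simp add: Dg power2_eq_square)
        ultimately show False using ort by simp
      qed
    qed
  qed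
qed

lemma isCont_eq_eventually:
  fixes f g :: "complex \<Rightarrow> complex"
  assumes "isCont f z" "isCont g z" "\<forall>\<^sub>F w in at z. f w = g w"
  shows "f z = g z"
  using Lim_transform_eventually[OF assms(1)[unfolded isCont_def] assms(3)] assms(2)[unfolded isCont_def]
    tendsto_unique[OF trivial_limit_at] by blast

section \<open>Zeros with multiplicity\<close>

text \<open>
  In a divisor \<open>W\<close> of maximal degree all zeros are accounted for: at a further zero the cofactor would split off a linear
  factor, or, at a nonreal zero, by symmetry a real quadratic factor. So the zeros and their orders are those of \<open>W\<close>.
\<close>
lemma zeros_from_divisor_bound:
  assumes J: "compact J" and L: "L holomorphic_on - cset J" and sym: "\<And>z. z \<notin> cset J \<Longrightarrow> L (cnj z) = cnj (L z)"
    and bound: "\<And>W. divides_off J L W \<Longrightarrow> degree W < M"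
  shows "finite {z\<in>- cset J. L z = 0}" "card {z\<in>- cset J. L z = 0} < M"
    "(\<Sum>z\<in>{z\<in>- cset J. L z = 0}. zorder L z) \<le> int M - 1"
proof -
  have op: "open (- cset J)" using cset_closed[OF J] by (rule open_Compl)
  have "divides_off J L 1" using L unfolding divides_off_def by auto
  then obtain W where W: "divides_off J L W" and mx: "\<And>W'. divides_off J L W' \<Longrightarrow> degree W' \<le> degree W"
    using ex_has_greatest_nat[of "divides_off J L" 1 degree M] bound by (meson less_imp_le)
  then obtain H where H: "H holomorphic_on - cset J" "\<And>z. z \<notin> cset J \<Longrightarrow> L z = poly (cpoly W) z * H z"
    and W0: "W \<noteq> 0" "\<And>x. x \<in> J \<Longrightarrow> poly W x \<noteq> 0" by (auto simp: divides_off_def)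
  have cJ: "cnj z \<notin> cset J" if "z \<notin> cset J" for z
  proof
    assume "cnj z \<in> cset J"
    then obtain x where "x \<in> J" "cnj z = of_real x" by auto
    then have "z = of_real x" by (metis complex_cnj_cnj complex_cnj_complex_of_real)
    then show False using that \<open>x \<in> J\<close> by blast
  qed
  have finW: "finite {z. poly (cpoly W) z = 0}" using W0 by (simp add: poly_roots_finite cpoly_eq_0_iff)
  have ic: "isCont H z" if "z \<notin> cset J" for z
    using holomorphic_on_imp_continuous_on[OF H(1)] that op by (simp add: continuous_on_eq_continuous_at)
  have Hsym: "H (cnj z) = cnj (H z)" if z: "z \<notin> cset J" for z
  proof (rule isCont_eq_eventually[where f = "\<lambda>z. H (cnj z)" and g = "\<lambda>z. cnj (H z)"])
    show "isCont (\<lambda>z. H (cnj z)) z"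
      using ic[OF cJ[OF z]] by (intro isCont_o2[where f = cnj and g = H] continuous_intros)
    show "isCont (\<lambda>z. cnj (H z)) z" by (intro continuous_intros ic z)
    have "finite ({z. poly (cpoly W) z = 0} - {z})" using finW by simp
    from open_Int[OF open_Compl[OF finite_imp_closed[OF this]] op]
    have "open (- ({z. poly (cpoly W) z = 0} - {z}) \<inter> - cset J)" .
    then have "\<forall>\<^sub>F w in at z. w \<in> - ({z. poly (cpoly W) z = 0} - {z}) \<inter> - cset J"
      using z by (intro eventually_at_in_open') auto
    then show "\<forall>\<^sub>F w in at z. H (cnj w) = cnj (H w)"
      using eventually_neq_at_within[of z z UNIV]
    proof eventually_elim
      case (elim w)
      then have w: "w \<notin> cset J" "poly (cpoly W) w \<noteq> 0" by auto
      have "poly (cpoly W) (cnj w) * H (cnj w) = cnj (poly (cpoly W) w * H w)"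
        unfolding H(2)[OF cJ[OF w(1)], symmetric] H(2)[OF w(1), symmetric] by (rule sym[OF w(1)])
      then have "cnj (poly (cpoly W) w) * H (cnj w) = cnj (poly (cpoly W) w) * cnj (H w)"
        by (simp only: poly_cpoly_cnj complex_cnj_mult)
      then show ?case using w(2) by simp
    qed
  qed
  have Hnz: "H z \<noteq> 0" if z: "z \<notin> cset J" for z
  proof
    assume Hz: "H z = 0"
    obtain H1 where H1: "H1 holomorphic_on - cset J" "\<And>w. H w = (w - z) * H1 w"
      using holomorphic_factor_root[OF op H(1)] z Hz by blast
    obtain V H2 where V: "degree V > 0" "\<And>x. x \<in> J \<Longrightarrow> poly V x \<noteq> 0" "H2 holomorphic_on - cset J"
      "\<And>w. H w = poly (cpoly V) w * H2 w"
    proof (cases "Im z = 0")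
      case True
      then have zr: "z = of_real (Re z)" by (simp add: complex_eq_iff)
      then have "Re z \<notin> J" using z by (metis image_eqI)
      then show ?thesis using that[of "[:- Re z, 1:]" H1] H1 zr by (auto simp: cpoly_pCons)
    next
      case False
      then have ne: "cnj z - z \<noteq> 0" by (auto simp: complex_eq_iff)
      have "H (cnj z) = 0" using Hsym[OF z] Hz by simp
      then have "H1 (cnj z) = 0" using H1(2)[of "cnj z"] ne by simp
      then obtain H2 where H2: "H2 holomorphic_on - cset J" "\<And>w. H1 w = (w - cnj z) * H2 w"
        using holomorphic_factor_root[OF op H1(1), of "cnj z"] cJ[OF z] by auto
      (* The real quadratic with roots z and its conjugate. *)
      define V where "V = [:(Re z)\<^sup>2 + (Im z)\<^sup>2, - 2 * Re z, 1:]"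
      have Vx: "poly V x = (x - Re z)\<^sup>2 + (Im z)\<^sup>2" for x by (simp add: V_def power2_eq_square algebra_simps)
      have "poly V x \<noteq> 0" for x unfolding Vx using False by (simp add: sum_power2_eq_zero_iff)
      moreover have "degree V > 0" by (simp add: V_def)
      moreover have "poly (cpoly V) w = (w - z) * (w - cnj z)" for w
        by (simp add: V_def cpoly_pCons complex_eq_iff power2_eq_square algebra_simps)
      ultimately show ?thesis using that[of V H2] H1 H2 by (auto simp: mult.assoc)
    qed
    have "divides_off J L (W * V)"
      unfolding divides_off_def
    proof (intro conjI exI[of _ H2] ballI allI impI V(3))
      show "W * V \<noteq> 0" using W0 V(1) by auto
      show "poly (W * V) x \<noteq> 0" if "x \<in> J" for x using W0 V(2) that by simp
      show "L w = poly (cpoly (W * V)) w * H2 w" if "w \<notin> cset J" for w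
        using H(2)[OF that] V(4)[of w] by (simp add: cpoly_mult)
    qed
    from mx[OF this] show False using W0 V(1) by (subst (asm) degree_mult_eq) auto
  qed
  have Z: "{z\<in>- cset J. L z = 0} = {z. poly (cpoly W) z = 0}"
  proof -
    have "z \<notin> cset J" if "poly (cpoly W) z = 0" for z
      using that W0(2) by (auto simp: poly_cpoly_of_real)
    then show ?thesis using H(2) Hnz by (metis (mono_tags, lifting) Compl_iff mult_eq_0_iff)
  qed
  show "finite {z\<in>- cset J. L z = 0}" unfolding Z by (rule finW)
  have cW: "cpoly W \<noteq> 0" using W0 by (simp add: cpoly_eq_0_iff)
  show "card {z\<in>- cset J. L z = 0} < M"
    unfolding Z using card_poly_roots_bound[OF cW] bound[OF W] by (simp add: degree_cpoly)
  have ord: "zorder L z = int (order z (cpoly W))" if z: "z \<in> - cset J" for z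
  proof -
    obtain q where q: "cpoly W = [:- z, 1:] ^ order z (cpoly W) * q" "\<not> [:- z, 1:] dvd q"
      using order_decomp[OF cW] by blast
    show ?thesis
    proof (rule zorder_eqI[OF op z, of "\<lambda>w. poly q w * H w"])
      show "(\<lambda>w. poly q w * H w) holomorphic_on - cset J" by (intro holomorphic_intros H)
      show "poly q z * H z \<noteq> 0" using q(2) Hnz z by (simp add: poly_eq_0_iff_dvd)
      fix w assume w: "w \<in> - cset J" "w \<noteq> z"
      have "poly (cpoly W) w = (w - z) ^ order z (cpoly W) * poly q w"
        by (subst q(1)) (simp add: poly_power)
      then show "L w = poly q w * H w * (w - z) powi int (order z (cpoly W))"
        using H(2)[of w] w(1) by (simp add: power_int_def)
    qed
  qed
  have "(\<Sum>z\<in>{z\<in>- cset J. L z = 0}. zorder L z) = (\<Sum>z\<in>{z\<in>- cset J. L z = 0}. int (order z (cpoly W)))"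
    by (rule sum.cong[OF refl]) (rule ord, simp)
  also have "\<dots> = int (\<Sum>z\<in>{z. poly (cpoly W) z = 0}. order z (cpoly W))" unfolding Z by simp
  also have "\<dots> \<le> int (degree W)" using sum_order_le_degree[OF cW] by (simp only: degree_cpoly zle_int)
  also have "\<dots> \<le> int M - 1" using bound[OF W] by simp
  finally show "(\<Sum>z\<in>{z\<in>- cset J. L z = 0}. zorder L z) \<le> int M - 1" .
qed

section \<open>Nikishin systems\<close>
definition csgn :: "csmeasure \<Rightarrow> real" where
  "csgn s = (case s of Pos _ \<Rightarrow> 1 | Neg _ \<Rightarrow> - 1)"

lemma csgn_nonzero: "csgn s \<noteq> 0"
  by (simp add: csgn_def split: csmeasure.split)

lemma csintegral_eq: "csintegral s f = csgn s *\<^sub>R (LINT x|total_variation s. f x)"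
  by (cases s) (simp_all add: csgn_def)

text \<open>
  The complement of the support is a union of null sets from a countable base.
\<close>
lemma AE_csupport:
  assumes b: "sets (total_variation s) = sets borel"
  shows "AE x in total_variation s. x \<in> csupport s"
proof -
  obtain B :: "real set set" where B: "countable B" "topological_basis B" using ex_countable_basis by blast
  let ?C = "{U\<in>B. emeasure (total_variation s) U = 0}"
  have cC: "countable ?C" using B(1) by (rule countable_subset[rotated]) auto
  have "AE x in total_variation s. \<forall>U\<in>?C. x \<notin> U"
    unfolding AE_ball_countable[OF cC]
  proof
    fix U assume U: "U \<in> ?C"
    then have "open U" using B(2) topological_basis_open by blast
    then show "AE x in total_variation s. x \<notin> U"
      using U b by (intro AE_not_in) (auto simp: null_sets_def)
  qed
  then show ?thesis
  proof eventually_elim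
    case (elim x)
    show ?case unfolding csupport_def
    proof (intro CollectI allI impI)
      fix U :: "real set" assume U: "open U" "x \<in> U"
      then obtain V where V: "V \<in> B" "x \<in> V" "V \<subseteq> U" using B(2) topological_basisE by metis
      have "emeasure (total_variation s) V \<noteq> 0" using elim V by auto
      moreover have "emeasure (total_variation s) V \<le> emeasure (total_variation s) U"
        using V(3) U(1) b by (intro emeasure_mono) auto
      ultimately show "0 < emeasure (total_variation s) U" by (metis le_zero_eq not_gr_zero)
    qed
  qed
qed

lemma AE_Co_supp:
  assumes "sets (total_variation s) = sets borel"
  shows "AE x in total_variation s. x \<in> Co_supp s"
  using AE_csupport[OF assms] by eventually_elim (simp add: Co_supp_def hull_inc)

lemma M_class_facts:
  assumes s: "s \<in> M_class (Co_supp s)"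
  shows "sets (total_variation s) = sets borel" "finite_measure (total_variation s)"
    "compact (Co_supp s)" "connected (Co_supp s)" "heavy_on (Co_supp s) (total_variation s)"
proof -
  show b: "sets (total_variation s) = sets borel" and f: "finite_measure (total_variation s)"
    using s by (auto simp: M_class_def)
  have cs: "compact (csupport s)" "infinite (csupport s)" using s by (auto simp: M_class_def)
  show c: "compact (Co_supp s)" unfolding Co_supp_def using cs(1) by (rule compact_convex_hull)
  show "connected (Co_supp s)" unfolding Co_supp_def by (intro convex_connected convex_convex_hull)
  show "heavy_on (Co_supp s) (total_variation s)"
    unfolding heavy_on_def
  proof (intro conjI b f allI impI notI)
    fix X :: "real set" assume X: "finite X" and null: "emeasure (total_variation s) (Co_supp s - X) = 0"
    obtain p where p: "p \<in> csupport s" "p \<notin> X" using cs(2) X by (metis finite_subset subsetI)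
    have op: "open (- X)" using X by (intro open_Compl finite_imp_closed)
    then have "emeasure (total_variation s) (- X) > 0" using p by (auto simp: csupport_def)
    have "Co_supp s - X \<in> sets (total_variation s)"
      using X c b by (auto intro!: sets.Diff simp: borel_closed compact_imp_closed finite_imp_closed)
    then have "AE x in total_variation s. x \<notin> Co_supp s - X" using null by (intro AE_not_in) (auto simp: null_sets_def)
    with AE_Co_supp[OF b] have "AE x in total_variation s. x \<notin> - X" by eventually_elim auto
    moreover have "- X \<in> sets (total_variation s)" using op b by simp
    ultimately have "emeasure (total_variation s) (- X) = 0"
      using AE_iff_measurable[of "- X" "total_variation s" "\<lambda>x. x \<notin> - X"] sets_eq_imp_space_eq[OF b] by auto
    then show False using \<open>emeasure (total_variation s) (- X) > 0\<close> by simp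
  qed
qed

lemma cauchy_transform_of_real:
  "cauchy_transform s (complex_of_real x) = of_real (cauchy_transform s x)"
proof -
  have "(\<lambda>t. 1 / (complex_of_real x - of_real t)) = (\<lambda>t. of_real (1 / (x - t)))" by auto
  then show ?thesis unfolding cauchy_transform_def csintegral_eq
    by (simp only: integral_complex_of_real of_real_mult[symmetric] scaleR_conv_of_real) simp
qed

lemma measurable_cauchy_transform:
  assumes b: "sets (total_variation s) = sets borel" and sf: "sigma_finite_measure (total_variation s)"
  shows "(cauchy_transform s :: real \<Rightarrow> real) \<in> borel_measurable borel"
proof -
  interpret sigma_finite_measure "total_variation s" by fact
  have "(\<lambda>x::real. LINT t|total_variation s. 1 / (x - t)) \<in> borel_measurable borel"
  proof (rule borel_measurable_lebesgue_integral)
    have m: "(\<lambda>p::real \<times> real. 1 / (fst p - snd p)) \<in> borel_measurable (borel \<Otimes>\<^sub>M borel)" by measurable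
    have "sets (borel \<Otimes>\<^sub>M total_variation s) = sets (borel \<Otimes>\<^sub>M (borel :: real measure))"
      using b by (intro sets_pair_measure_cong) auto
    from measurable_cong_sets[OF this refl] m
    show "(\<lambda>(x, t). 1 / (x - t)) \<in> borel_measurable (borel \<Otimes>\<^sub>M total_variation s)"
      unfolding split_beta' by blast
  qed
  then show ?thesis unfolding cauchy_transform_def csintegral_eq by simp
qed

lemma csintegral_kernel:
  assumes s: "s \<in> M_class (Co_supp s)" and g: "g \<in> borel_measurable borel" 
  shows "csintegral s (\<lambda>x. g x *\<^sub>R (1 / (z - of_real x))) = cauchy_int (total_variation s) (Co_supp s) (\<lambda>x. csgn s * g x) z"
proof -
  note M = M_class_facts[OF s]
  have I: "Co_supp s \<in> sets borel" using M(3) by (simp add: borel_closed compact_imp_closed)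
  have gm: "(\<lambda>x. g x *\<^sub>R (1 / (z - complex_of_real x))) \<in> borel_measurable borel"
    using g by measurable
  have "(LINT x|total_variation s. g x *\<^sub>R (1 / (z - complex_of_real x))) =
      (LINT x|total_variation s. indicator (Co_supp s) x *\<^sub>R (g x *\<^sub>R (1 / (z - complex_of_real x))))"
  proof (rule integral_cong_AE)
    show "AE x in total_variation s. g x *\<^sub>R (1 / (z - complex_of_real x)) = indicator (Co_supp s) x *\<^sub>R (g x *\<^sub>R (1 / (z - complex_of_real x)))"
      using AE_Co_supp[OF M(1)] by eventually_elim simp
    have "(\<lambda>x. indicator (Co_supp s) x *\<^sub>R (g x *\<^sub>R (1 / (z - complex_of_real x)))) \<in> borel_measurable borel"
      using I g by measurable
    then show "(\<lambda>x. g x *\<^sub>R (1 / (z - complex_of_real x))) \<in> borel_measurable (total_variation s)"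
      "(\<lambda>x. indicator (Co_supp s) x *\<^sub>R (g x *\<^sub>R (1 / (z - complex_of_real x)))) \<in> borel_measurable (total_variation s)"
      using gm by (simp_all only: measurable_cong_sets[OF M(1) refl])
  qed
  then have "csintegral s (\<lambda>x. g x *\<^sub>R (1 / (z - of_real x))) = of_real (csgn s) * cauchy_int (total_variation s) (Co_supp s) g z"
    unfolding csintegral_eq cauchy_int_def set_lebesgue_integral_def by (simp add: scaleR_conv_of_real)
  also have "\<dots> = cauchy_int (total_variation s) (Co_supp s) (\<lambda>x. csgn s * g x) z" by (rule cauchy_int_cmult[symmetric])
  finally show ?thesis .
qed

text \<open>
  The Fubini-type measurability of the Cauchy transform in the definition of the iterated measures needs
  sigma-finiteness; it passes to a density, whatever its sign.
\<close>
lemma sigma_finite_nikishin: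
  assumes "\<And>i. j \<le> i \<Longrightarrow> i \<le> k \<Longrightarrow> sets (total_variation (\<sigma> i)) = sets borel \<and> finite_measure (total_variation (\<sigma> i))"
    and "j \<le> k"
  shows "sets (total_variation (nikishin \<sigma> j k)) = sets borel \<and> sigma_finite_measure (total_variation (nikishin \<sigma> j k))"
  using assms
proof (induction "k - j" arbitrary: j)
  case 0
  then have "nikishin \<sigma> j k = \<sigma> j" by (subst nikishin.simps) simp
  then show ?case using 0 finite_measure.axioms(1) by fastforce
next
  case (Suc d)
  let ?s = "nikishin \<sigma> (j + 1) k"
  have IH: "sets (total_variation ?s) = sets borel \<and> sigma_finite_measure (total_variation ?s)"
    using Suc by (intro Suc.hyps(1)) auto
  have h: "(cauchy_transform ?s :: real \<Rightarrow> real) \<in> borel_measurable borel"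
    using IH by (intro measurable_cauchy_transform) auto
  have b: "sets (total_variation (\<sigma> j)) = sets borel" "finite_measure (total_variation (\<sigma> j))" using Suc.prems by auto
  then interpret finite_measure "total_variation (\<sigma> j)" by simp
  have m: "(cauchy_transform ?s :: real \<Rightarrow> real) \<in> borel_measurable (total_variation (\<sigma> j))"
    using h b(1) by (simp cong: measurable_cong_sets)
  have d: "sets (density (total_variation (\<sigma> j)) (\<lambda>x. ennreal (f x))) = sets borel \<and>
     sigma_finite_measure (density (total_variation (\<sigma> j)) (\<lambda>x. ennreal (f x)))"
    if "f \<in> borel_measurable (total_variation (\<sigma> j))" for f
    using that b(1) by (subst sigma_finite_iff_density_finite) auto
  have eq: "nikishin \<sigma> j k = csdensity (\<sigma> j) (cauchy_transform ?s)"
  proof -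
    have "j < k" using Suc.hyps(2) by simp
    then show ?thesis by (subst nikishin.simps) (simp add: csprod_def)
  qed
  have "total_variation (csdensity s hh) = density (total_variation s) (\<lambda>x. ennreal (hh x)) \<or>
      total_variation (csdensity s hh) = density (total_variation s) (\<lambda>x. ennreal (- hh x))" for s hh
    by (cases s) auto
  then show ?case unfolding eq using d[OF m] d[OF borel_measurable_uminus[OF m]] by metis
qed

lemma family_trans_off_cut:
  assumes fam: "minor_family I a m R" and S: "S \<subseteq> {a..m}" and kji: "k \<in> {a..m} - S" "j \<in> {a..m} - S" "i \<in> {a..m} - S"
    and I: "\<And>i. a < i \<Longrightarrow> i \<le> m \<Longrightarrow> compact (I i)" and z: "z \<notin> cset (I (Suc (a + card S)))"
    and cl: "closed (cset (I (Suc (a + card S))))"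
  shows "R S k j z * R S j i z = R S k i z"
proof (rule nonreal_isCont_eq[where f = "\<lambda>z. R S k j z * R S j i z"])
  have c: "isCont (R S x y) z" if "x \<in> {a..m} - S" "y \<in> {a..m} - S" for x y
    using holomorphic_on_imp_continuous_on[OF family_holomorphic[OF fam S that I]] z cl
    by (simp add: continuous_on_eq_continuous_at open_Compl)
  show "isCont (\<lambda>z. R S k j z * R S j i z) z" by (intro continuous_intros c kji)
  show "isCont (R S k i) z" by (intro c kji)
  show "R S k j w * R S j i w = R S k i w" if "Im w \<noteq> 0" for w
    by (rule fam[unfolded minor_family_def, THEN conjunct2, THEN conjunct1, rule_format])
      (intro conjI S kji that)
qed

text \<open>
  Induction from the last row to the first. The densities in the definition of the measures are the functions
  \<open>R {} k (a+1)\<close> of the family for the rows below, so they are continuous and without zeros on the interval of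
  \<open>\<sigma> (a+1)\<close>. Hence they have constant sign there, the iterated measures are what their notation suggests, and
  the hypotheses of the elimination step hold.
\<close>
lemma nikishin_family:
  assumes gen: "nikishin_generators m \<sigma>"
  defines "I \<equiv> \<lambda>i. if i \<le> m then Co_supp (\<sigma> i) else {}"
  shows "a \<le> m \<Longrightarrow> \<exists>R. minor_family I a m R \<and>
    (\<forall>k\<in>{Suc a..m}. \<forall>z. z \<notin> cset (I (Suc a)) \<longrightarrow> R {} k a z = cauchy_transform (nikishin \<sigma> (Suc a) k) z)"
proof (induction "m - a" arbitrary: a)
  case 0
  then have "minor_family I a m (\<lambda>_ _ _ _. 1)" by (auto simp: minor_family_def)
  then show ?case using 0 by fastforce
next
  case (Suc d)
  have am: "a < m" using Suc.hyps(2) by simp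
  let ?b = "Suc a"
  have M: "\<sigma> i \<in> M_class (Co_supp (\<sigma> i))" if "1 \<le> i" "i \<le> m" for i
    using gen that by (auto simp: nikishin_generators_def)
  have I: "compact (I i)" "connected (I i)" if "a < i" "i \<le> m" for i
    using M_class_facts[OF M, of i] that by (auto simp: I_def)
  have disj: "I i \<inter> I (Suc i) = {}" if "a < i" "i < m" for i
    using gen that by (auto simp: nikishin_generators_def I_def)
  have "d = m - ?b" "?b \<le> m" using Suc.hyps(2) by auto
  from Suc.hyps(1)[OF this] obtain R where R: "minor_family I ?b m R"
    "\<And>k z. k \<in> {Suc ?b..m} \<Longrightarrow> z \<notin> cset (I (Suc ?b)) \<Longrightarrow> R {} k ?b z = cauchy_transform (nikishin \<sigma> (Suc ?b) k) z"
    by blast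
  have one: "R S k k z = 1" for S k z using R(1) by (simp add: minor_family_def)
  let ?s = "\<sigma> ?b"
  have Ms: "?s \<in> M_class (Co_supp ?s)" using M am by simp
  note MC = M_class_facts[OF Ms]
  have Ib: "I ?b = Co_supp ?s" using am by (simp add: I_def)
  define h :: "nat \<Rightarrow> real \<Rightarrow> real" where
    "h k x = (if k = ?b then 1 else cauchy_transform (nikishin \<sigma> (Suc ?b) k) x)" for k x
  define w where "w k x = csgn ?s * h k x" for k x
  have II: "I ?b \<inter> I (Suc ?b) = {}"
  proof (cases "?b < m")
    case True then show ?thesis using disj[of ?b] by simp
  next
    case False then show ?thesis by (simp add: I_def)
  qed
  have cl: "closed (cset (I (Suc ?b)))"
  proof (cases "?b < m")
    case True then show ?thesis using I(1)[of "Suc ?b"] by (intro cset_closed) simp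
  next
    case False then show ?thesis by (simp add: I_def)
  qed
  have I': "compact (I i)" if "?b < i" "i \<le> m" for i using I(1)[of i] that by simp
  have off: "complex_of_real x \<notin> cset (I (Suc ?b))" if "x \<in> I ?b" for x using that II by auto
  have hR: "R {} k ?b (of_real x) = of_real (h k x)" if "k \<in> {?b..m}" "x \<in> I ?b" for k x
  proof (cases "k = ?b")
    case False
    then have "k \<in> {Suc ?b..m}" using that by auto
    from R(2)[OF this off[OF that(2)]] False show ?thesis by (simp add: h_def cauchy_transform_of_real)
  qed (simp add: h_def one)
  have tr: "R {} k j (of_real x) * R {} j i (of_real x) = R {} k i (of_real x)"
    if "k \<in> {?b..m}" "j \<in> {?b..m}" "i \<in> {?b..m}" "x \<in> I ?b" for k j i x
    by (rule family_trans_off_cut[OF R(1) _ _ _ _ I']) (use that off cl in auto)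
  have hnz: "h k x \<noteq> 0" if "k \<in> {?b..m}" "x \<in> I ?b" for k x
  proof -
    have "?b \<in> {?b..m}" using am by simp
    from tr[OF this that(1) this that(2)] hR[OF that] show ?thesis by (auto simp: one)
  qed
  have hc: "continuous_on (I ?b) (h k)" if k: "k \<in> {?b..m}" for k
  proof -
    have bb: "?b \<in> {?b..m}" using am by simp
    have "R {} k ?b holomorphic_on - cset (I (Suc (?b + card ({} :: nat set))))"
      by (rule family_holomorphic[OF R(1) _ _ _ I']) (use k bb in auto)
    then have c: "continuous_on (- cset (I (Suc ?b))) (R {} k ?b)"
      by (intro holomorphic_on_imp_continuous_on) simp
    have "cset (I ?b) \<subseteq> - cset (I (Suc ?b))" using II by auto
    from continuous_on_subset[OF c this]
    have "continuous_on (I ?b) (R {} k ?b \<circ> of_real)"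
      by (intro continuous_on_compose continuous_on_of_real_id)
    then have "continuous_on (I ?b) (\<lambda>x. Re (R {} k ?b (of_real x)))" by (intro continuous_intros) (simp add: o_def)
    then show ?thesis by (rule continuous_on_eq) (simp add: hR[OF k])
  qed
  interpret T: tower_step I a m R w "total_variation ?s"
  proof
    show "heavy_on (I ?b) (total_variation ?s)" using MC(5) by (simp add: Ib)
    show "continuous_on (I ?b) (w k)" if "k \<in> {?b..m}" for k
      unfolding w_def by (intro continuous_intros hc[OF that])
    show "w k x \<noteq> 0" if "k \<in> {?b..m}" "x \<in> I ?b" for k x
      using hnz[OF that] csgn_nonzero by (simp add: w_def)
    show "R {} k l (of_real x) = of_real (w k x / w l x)" if "k \<in> {?b..m}" "l \<in> {?b..m}" "x \<in> I ?b" for k l x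
    proof -
      have bb: "?b \<in> {?b..m}" using am by simp
      have "R {} k l (of_real x) * of_real (h l x) = of_real (h k x)"
        using tr[OF that(1,2) bb that(3)] by (simp only: hR[OF that(1,3)] hR[OF that(2,3)])
      then have "R {} k l (of_real x) = of_real (h k x / h l x)"
        using hnz[OF that(2,3)] by (simp add: field_simps)
      then show ?thesis using csgn_nonzero[of ?s] by (simp add: w_def)
    qed
  qed (use am I disj R(1) in auto)
  show ?case
  proof (intro exI[of _ T.next_ratio] conjI ballI allI impI T.next_ratio_family)
    fix k z assume k: "k \<in> {?b..m}" and z: "z \<notin> cset (I ?b)"
    have M': "sets (total_variation (\<sigma> i)) = sets borel \<and> finite_measure (total_variation (\<sigma> i))" if "Suc ?b \<le> i" "i \<le> k" for i
      using M_class_facts[OF M, of i] that k by auto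
    let ?t = "nikishin \<sigma> (Suc ?b) k"
    have hm: "h k \<in> borel_measurable borel"
    proof (cases "k = ?b")
      case True then show ?thesis by (simp add: h_def[abs_def])
    next
      case False
      then have "sets (total_variation ?t) = sets borel \<and> sigma_finite_measure (total_variation ?t)"
        using sigma_finite_nikishin[OF M'] k by simp
      then show ?thesis using measurable_cauchy_transform[of ?t] False by (simp add: h_def[abs_def])
    qed
    have "T.next_ratio {} k a z = cauchy_int (total_variation ?s) (I ?b) (w k) z" by (rule T.next_ratio_base[OF k z])
    also have "\<dots> = csintegral ?s (\<lambda>x. h k x *\<^sub>R (1 / (z - of_real x)))"
      unfolding csintegral_kernel[OF Ms hm] Ib w_def ..
    also have "\<dots> = cauchy_transform (nikishin \<sigma> ?b k) z"
    proof (cases "k = ?b")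
      case True
      then show ?thesis by (subst nikishin.simps) (simp add: h_def cauchy_transform_def)
    next
      case False
      then have hk: "h k = cauchy_transform ?t" by (simp add: h_def fun_eq_iff)
      have eq: "nikishin \<sigma> ?b k = csdensity ?s (h k)"
        using False k unfolding hk by (subst nikishin.simps) (simp add: csprod_def)
      have hm': "h k \<in> borel_measurable (total_variation ?s)"
        using measurable_cong_sets[OF MC(1) refl] hm by blast
      have "(\<lambda>x. 1 / (z - complex_of_real x)) \<in> borel_measurable borel" by measurable
      then have km: "(\<lambda>x. 1 / (z - complex_of_real x)) \<in> borel_measurable (total_variation ?s)"
        using measurable_cong_sets[OF MC(1) refl] by blast
      have "(\<forall>x\<in>I ?b. 0 < h k x) \<or> (\<forall>x\<in>I ?b. h k x < 0)"
        by (rule connected_const_sign) (use I(2)[of ?b] am hc[OF k] hnz[OF k] in auto)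
      then have "(AE x in total_variation ?s. 0 \<le> h k x) \<or> (AE x in total_variation ?s. h k x \<le> 0)"
      proof
        assume "\<forall>x\<in>I ?b. 0 < h k x"
        then have "AE x in total_variation ?s. 0 \<le> h k x"
          using AE_Co_supp[OF MC(1)] unfolding Ib by (auto elim!: eventually_mono simp: less_imp_le)
        then show ?thesis ..
      next
        assume "\<forall>x\<in>I ?b. h k x < 0"
        then have "AE x in total_variation ?s. h k x \<le> 0"
          using AE_Co_supp[OF MC(1)] unfolding Ib by (auto elim!: eventually_mono simp: less_imp_le)
        then show ?thesis ..
      qed
      from csintegral_csdensity[OF hm' km this] show ?thesis
        unfolding eq cauchy_transform_def by simp
    qed
    finally show "T.next_ratio {} k a z = cauchy_transform (nikishin \<sigma> ?b k) z" .
  qed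
qed

theorem theorem1p1:
  fixes m :: nat and \<sigma> :: "nat \<Rightarrow> csmeasure"
  assumes "nikishin_generators m \<sigma>"
  shows "(\<forall>\<Delta>::real set. is_interval \<Delta> \<and> \<Delta> \<inter> Delta1 m \<sigma> = {} \<longrightarrow>
            AT_system m (\<lambda>k. if k = 0 then (\<lambda>x. 1) else cauchy_transform (nikishin \<sigma> 1 k)) \<Delta>)
       \<and> (\<forall>(n :: nat \<Rightarrow> nat) (p :: nat \<Rightarrow> real poly). admissible_polys m n p \<longrightarrow>
            zeros_mult_le (nikishin_form m \<sigma> p) (- (complex_of_real ` Delta1 m \<sigma>))
              (int (\<Sum>k\<le>m. n k) - 1))"
proof -
  define I where "I = (\<lambda>i. if i \<le> m then Co_supp (\<sigma> i) else {})"
  define J where "J = Delta1 m \<sigma>"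
  have J: "J = I 1" by (simp add: J_def I_def Delta1_def)
  have M: "\<sigma> i \<in> M_class (Co_supp (\<sigma> i))" if "0 < i" "i \<le> m" for i
    using assms that by (auto simp: nikishin_generators_def)
  have I: "compact (I i)" "connected (I i)" if "0 < i" "i \<le> m" for i
    using M_class_facts[OF M, of i] that by (auto simp: I_def)
  have disj: "I i \<inter> I (Suc i) = {}" if "0 < i" "i < m" for i
    using assms that by (auto simp: nikishin_generators_def I_def)
  have "\<exists>R. minor_family I 0 m R \<and>
    (\<forall>k\<in>{Suc 0..m}. \<forall>z. z \<notin> cset (I (Suc 0)) \<longrightarrow> R {} k 0 z = cauchy_transform (nikishin \<sigma> (Suc 0) k) z)"
    unfolding I_def by (rule nikishin_family[OF assms]) simp
  then obtain R where R: "minor_family I 0 m R"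
    "\<And>k z. k \<in> {1..m} \<Longrightarrow> z \<notin> cset J \<Longrightarrow> R {} k 0 z = cauchy_transform (nikishin \<sigma> 1 k) z"
    unfolding J One_nat_def by blast
  have one: "R S k k z = 1" for S k z using R(1) by (simp add: minor_family_def)
  have cJ: "compact J"
  proof (cases "m = 0")
    case True then show ?thesis by (simp add: J_def Delta1_def)
  next
    case False then show ?thesis using I(1)[of 1] by (simp add: J)
  qed
  have hol: "R {} k 0 holomorphic_on - cset J" if "k \<le> m" for k
    using family_holomorphic[OF R(1), of "{}" k 0] I(1) that by (simp add: J)
  have form: "nikishin_form m \<sigma> p z = (\<Sum>k\<in>{0..m}. poly (cpoly (p k)) z * R {} k 0 z)" if "z \<notin> cset J" for p z
  proof -
    have "(\<Sum>k\<in>{0..m}. poly (cpoly (p k)) z * R {} k 0 z) = poly (cpoly (p 0)) z + (\<Sum>k=1..m. poly (cpoly (p k)) z * R {} k 0 z)"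
      by (simp add: sum.atLeast_Suc_atMost one)
    also have "(\<Sum>k=1..m. poly (cpoly (p k)) z * R {} k 0 z) = (\<Sum>k=1..m. poly (cpoly (p k)) z * cauchy_transform (nikishin \<sigma> 1 k) z)"
      by (rule sum.cong[OF refl]) (simp add: R(2)[OF _ that])
    finally show ?thesis by (simp add: nikishin_form_def)
  qed
  have fhol: "nikishin_form m \<sigma> p holomorphic_on - cset J" for p
  proof (rule holomorphic_transform)
    show "(\<lambda>z. \<Sum>k\<in>{0..m}. poly (cpoly (p k)) z * R {} k 0 z) holomorphic_on - cset J"
      by (intro holomorphic_intros hol) auto
  qed (simp add: form)
  have ct_cnj: "cauchy_transform s (cnj z) = cnj (cauchy_transform s z)" for s z
  proof -
    have "(\<lambda>x. 1 / (cnj z - complex_of_real x)) = (\<lambda>x. cnj (1 / (z - of_real x)))" by auto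
    then show ?thesis unfolding cauchy_transform_def csintegral_eq
      by (simp only: Bochner_Integration.integral_cnj) (simp add: scaleR_conv_of_real)
  qed
  have fsym: "nikishin_form m \<sigma> p (cnj z) = cnj (nikishin_form m \<sigma> p z)" for p z
    by (simp add: nikishin_form_def poly_cpoly_cnj ct_cnj)
  have zeros: "finite {z\<in>- cset J. nikishin_form m \<sigma> p z = 0}"
    "card {z\<in>- cset J. nikishin_form m \<sigma> p z = 0} < (\<Sum>k\<le>m. n k)"
    "(\<Sum>z\<in>{z\<in>- cset J. nikishin_form m \<sigma> p z = 0}. zorder (nikishin_form m \<sigma> p) z) \<le> int (\<Sum>k\<le>m. n k) - 1"
    if adm: "admissible_polys m n p" for n p
  proof -
    obtain k0 where k0: "k0 \<le> m" "p k0 \<noteq> 0" using adm by (auto simp: admissible_polys_def)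
    have bound: "degree W < (\<Sum>k\<le>m. n k)" if W: "divides_off J (nikishin_form m \<sigma> p) W" for W
    proof -
      have "degree W < (\<Sum>k\<in>{0..m} - {}. n k)"
      proof (rule degree_divisor_of_form_less[OF R(1) I disj])
        show "divides_off (I (Suc (0 + card ({} :: nat set)))) (\<lambda>z. \<Sum>k\<in>{0..m} - {}. poly (cpoly (p k)) z * R {} k 0 z) W"
          using W form by (simp add: divides_off_def J)
      qed (use adm k0 in \<open>auto simp: admissible_polys_def I_def\<close>)
      then show ?thesis by (simp add: atLeast0AtMost)
    qed
    show "finite {z\<in>- cset J. nikishin_form m \<sigma> p z = 0}"
      "card {z\<in>- cset J. nikishin_form m \<sigma> p z = 0} < (\<Sum>k\<le>m. n k)"
      "(\<Sum>z\<in>{z\<in>- cset J. nikishin_form m \<sigma> p z = 0}. zorder (nikishin_form m \<sigma> p) z) \<le> int (\<Sum>k\<le>m. n k) - 1"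
      using zeros_from_divisor_bound[OF cJ fhol fsym bound] by blast+
  qed
  show ?thesis
  proof (intro conjI allI impI)
    fix n p assume adm: "admissible_polys m n p"
    show "zeros_mult_le (nikishin_form m \<sigma> p) (- cset (Delta1 m \<sigma>)) (int (\<Sum>k\<le>m. n k) - 1)"
      unfolding zeros_mult_le_def J_def[symmetric] using zeros(1,3)[OF adm] by blast
  next
    fix \<Delta> :: "real set" assume \<Delta>: "is_interval \<Delta> \<and> \<Delta> \<inter> Delta1 m \<sigma> = {}"
    then have off: "complex_of_real x \<notin> cset J" if "x \<in> \<Delta>" for x using that by (auto simp: J_def)
    let ?u = "\<lambda>k. if k = 0 then (\<lambda>x::real. 1) else cauchy_transform (nikishin \<sigma> 1 k)"
    have u: "R {} k 0 (of_real x) = of_real (?u k x)" if "k \<le> m" "x \<in> \<Delta>" for k x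
      using R(2)[OF _ off[OF that(2)], of k] that(1) by (auto simp: one cauchy_transform_of_real)
    have cont: "continuous_on \<Delta> (?u k)" if k: "k \<le> m" for k
    proof -
      have "cset \<Delta> \<subseteq> - cset J" using off by auto
      from continuous_on_subset[OF holomorphic_on_imp_continuous_on[OF hol[OF k]] this]
      have "continuous_on \<Delta> (R {} k 0 \<circ> of_real)"
        by (intro continuous_on_compose continuous_on_of_real_id)
      then have "continuous_on \<Delta> (\<lambda>x. Re (R {} k 0 (of_real x)))" by (intro continuous_intros) (simp add: o_def)
      then show ?thesis by (rule continuous_on_eq) (simp only: u[OF k] Re_complex_of_real)
    qed
    have fx: "nikishin_form m \<sigma> p (of_real x) = of_real (\<Sum>k\<le>m. poly (p k) x * ?u k x)" if x: "x \<in> \<Delta>" for p x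
    proof -
      have "nikishin_form m \<sigma> p (of_real x) = (\<Sum>k\<in>{0..m}. of_real (poly (p k) x * ?u k x))"
        unfolding form[OF off[OF x]] by (rule sum.cong[OF refl]) (simp only: u[OF _ x] atLeastAtMost_iff poly_cpoly_of_real of_real_mult)
      then show ?thesis by (simp only: of_real_sum atLeast0AtMost)
    qed
    show "AT_system m ?u \<Delta>"
      unfolding AT_system_def AT_system_for_def Let_def
    proof (intro allI conjI impI)
      show "is_interval \<Delta>" using \<Delta> by simp
      show "continuous_on \<Delta> (?u k)" if "k \<le> m" for k by (rule cont[OF that])
      fix n p assume adm: "admissible_polys m n p"
      let ?Z = "{x\<in>\<Delta>. (\<Sum>k\<le>m. poly (p k) x * ?u k x) = 0}"
      let ?C = "{z\<in>- cset J. nikishin_form m \<sigma> p z = 0}"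
      have sub: "cset ?Z \<subseteq> ?C" using off fx by (auto simp only: mem_Collect_eq image_iff Compl_iff of_real_eq_0_iff)
      have inj: "inj_on complex_of_real ?Z" by (simp add: inj_on_def)
      have "finite (cset ?Z)" using sub zeros(1)[OF adm] by (rule finite_subset)
      then show "finite ?Z" using inj by (rule finite_imageD)
      have "card ?Z = card (cset ?Z)" using inj by (simp add: card_image)
      also have "\<dots> \<le> card ?C" using sub zeros(1)[OF adm] by (intro card_mono)
      also have "\<dots> < (\<Sum>k\<le>m. n k)" by (rule zeros(2)[OF adm])
      finally show "int (card ?Z) \<le> int (\<Sum>k\<le>m. n k) - 1" by (simp del: of_nat_sum)
    qed
  qed
qed

end
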